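(* Let $N_r$ denote the number of sides (equivalently, vertices) of the typical Poisson–Voronoi cell in the plane conditioned to have inradius (centered at the nucleus) equal to $r$. Let $a_1 = 4\pi\cdot 3^{-1/3}\,\Gamma(5/3)$. Then, as $r\to+\infty$: (i) $\mathbf{E} N_r \sim a_1 r^{2/3}$; (ii) $\lim_{r\to+\infty} N_r\,(a_1 r^{2/3})^{-1} = 1$ in $L^1$.
   Context: $\Phi$ is a homogeneous Poisson point process in $\mathbb{R}^2$ with intensity measure the two-dimensional Lebesgue measure $V_2$. The typical Poisson–Voronoi cell is realized as $C(0)=\{y\in\mathbb{R}^2:\ \|y\|\le\|y-x\| \text{ for all } x\in\Phi\}$. $D(x,r)$ is the closed disk of center $x$ and radius $r$, $\mathbb{D}=D(0,1)$, and $R_m$ is the radius of the largest disk centered at the origin contained in $C(0)$. $\mathcal{C}_r$ is a random compact convex set with the law of $C(0)$ conditioned on $\{R_m=r\}$, and $N_r$ is a random variable with the law of the number of sides of $C(0)$ conditioned on $\{R_m=r\}$. Explicitly, conditionally on $\{R_m=r\}$, $\Phi$ is distributed as $\Phi_r\cup\{2r\cdot X_0\}$ where $\Phi_r$ is a Poisson point process of intensity measure $\mathbf{1}_{D(0,2r)^c}(x)\,dx$ and $X_0$ is an independent uniform point on $\partial\mathbb{D}$. Coupling on one probability space (for all $r>0$): let $x_0=(1;0)$, let $\Lambda$ be a Poisson point process on $\mathbb{R}^2\times\mathbb{R}_+$ of intensity measure $\mathbf{1}_{\mathbb{D}^c}(x)\mathbf{1}_{\mathbb{R}_+}(t)\,dx\,dt$,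 and $\Psi_t=\{x\in\mathbb{R}^2\setminus\mathbb{D}:\ \exists s\le t,\ (x,s)\in\Lambda\}$. For $x\neq 0$ let $L(x)=\{y\in\mathbb{R}^2:\langle y-x,x\rangle=0\}$ and let $H(x)$ be the closed half-plane bounded by $L(x)$ containing the origin. Put $C_0^r=\bigcap_{x\in\Psi_{4r^2}}H(x)\cap H(x_0)$. Then $\mathcal{C}_r$ is, up to a uniform random rotation about the origin, equal in law to $r\cdot C_0^r$, and $N_r$ is realized as the number of vertices of $C_0^r$. Notation: $\alpha_r\sim\beta_r$ means $\lim_{r\to\infty}\alpha_r/\beta_r=1$. *)

theory Defs
  imports "HOL-Probability.Probability"
begin

subsection \<open>Random locally finite point sets\<close>

definition locally_finite_set :: "'a::metric_space set \<Rightarrow> bool" where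
  "locally_finite_set S \<longleftrightarrow> (\<forall>B. bounded B \<longrightarrow> finite (S \<inter> B))"

text \<open>Point configurations, with the sigma-algebra generated by the counts on bounded Borel sets.\<close>

definition config_space :: "'a::metric_space set measure" where
  "config_space = sigma {S. locally_finite_set S}
     {{S. locally_finite_set S \<and> card (S \<inter> A) = k} | A k. A \<in> sets borel \<and> bounded A}"

text \<open>The intensity measure \<open>\<mu>\<close> is meant to be a Borel measure that is finite on bounded sets and
  has no atoms. Configurations are locally finite and only bounded sets are counted, so \<open>card\<close> is
  never applied to an infinite set; these counts determine the law of the process.\<close>

definition poisson_process ::
    "'w measure \<Rightarrow> 'a::metric_space measure \<Rightarrow> ('w \<Rightarrow> 'a set) \<Rightarrow> bool" where
  "poisson_process M \<mu> \<Phi> \<longleftrightarrow>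
     prob_space M \<and>
     \<Phi> \<in> measurable M config_space \<and>
     (\<forall>A k. A \<in> sets borel \<longrightarrow> bounded A \<longrightarrow>
        measure M {\<omega> \<in> space M. card (\<Phi> \<omega> \<inter> A) = k}
          = exp (- measure \<mu> A) * measure \<mu> A ^ k / fact k) \<and>
     (\<forall>A :: nat \<Rightarrow> 'a set. (\<forall>i. A i \<in> sets borel \<and> bounded (A i)) \<longrightarrow> disjoint_family A \<longrightarrow>
        prob_space.indep_vars M (\<lambda>_. count_space UNIV) (\<lambda>i \<omega>. card (\<Phi> \<omega> \<inter> A i)) UNIV)"

definition uniform_unit_circle :: "(real ^ 2) measure" where
  "uniform_unit_circle =
     distr (uniform_measure lborel {0..2 * pi}) borel (\<lambda>\<theta>. vector [cos \<theta>, sin \<theta>])"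


subsection \<open>The Voronoi cell of the origin\<close>

definition voronoi_cell :: "(real ^ 2) set \<Rightarrow> (real ^ 2) set" where
  "voronoi_cell S = {y. \<forall>x\<in>S. norm y \<le> norm (y - x)}"

text \<open>The sides are the one-dimensional faces of the (two-dimensional) cell.\<close>

definition num_sides :: "(real ^ 2) set \<Rightarrow> nat" where
  "num_sides C = card {F. F facet_of C}"

definition centered_inradius :: "(real ^ 2) set \<Rightarrow> real" where
  "centered_inradius C = Sup {\<rho>. cball 0 \<rho> \<subseteq> C}"

text \<open>The event that the typical cell has centered inradius exactly \<open>r\<close> is a null event. The version
  of the conditional law of the homogeneous unit-intensity Poisson process used here is the explicit
  one: a Poisson process outside the closed disk of radius \<open>2 r\<close>, together with an independent
  uniform point on the bounding circle. The predicate says that \<open>Z\<close> is a process on \<open>M\<close> of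
  this form.\<close>

definition poisson_given_inradius ::
    "'w measure \<Rightarrow> real \<Rightarrow> ('w \<Rightarrow> (real ^ 2) set) \<Rightarrow> bool" where
  "poisson_given_inradius M r Z \<longleftrightarrow>
     (\<exists>\<Phi> X. poisson_process M (density lborel (indicator (- cball 0 (2 * r)))) \<Phi> \<and>
        X \<in> borel_measurable M \<and> distr M borel X = uniform_unit_circle \<and>
        prob_space.indep_set M (sets (vimage_algebra (space M) \<Phi> config_space))
          (sets (vimage_algebra (space M) X borel)) \<and>
        (\<forall>\<omega>\<in>space M. Z \<omega> = \<Phi> \<omega> \<union> {(2 * r) *\<^sub>R X \<omega>}))"

lemma centered_inradius_voronoi_cell:
  assumes "r > 0" and out: "\<And>x. x \<in> S \<Longrightarrow> norm x \<ge> 2 * r" and z: "z \<in> S" "norm z = 2 * r"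
  shows "centered_inradius (voronoi_cell S) = r"
proof -
  have 1: "cball 0 r \<subseteq> voronoi_cell S"
  proof (clarsimp simp: voronoi_cell_def)
    fix y x :: "real ^ 2" assume "norm y \<le> r" "x \<in> S"
    with out[of x] norm_triangle_ineq2[of x y] show "norm y \<le> norm (y - x)"
      by (simp add: norm_minus_commute)
  qed
  have 2: "\<rho> \<le> r" if "cball 0 \<rho> \<subseteq> voronoi_cell S" for \<rho>
  proof (rule ccontr)
    assume "\<not> \<rho> \<le> r"
    define s where "s = min \<rho> (2 * r)"
    define y where "y = (s / (2 * r)) *\<^sub>R z"
    have s: "r < s" "s \<le> \<rho>" "s \<le> 2 * r" using \<open>\<not> \<rho> \<le> r\<close> \<open>r > 0\<close> by (auto simp: s_def)
    have ny: "norm y = s" using s \<open>r > 0\<close> z by (simp add: y_def)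
    have "y - z = (s / (2 * r) - 1) *\<^sub>R z" by (simp add: y_def scaleR_left_diff_distrib)
    then have "norm (y - z) = \<bar>s / (2 * r) - 1\<bar> * (2 * r)" using z by simp
    also have "\<dots> = 2 * r - s" using s \<open>r > 0\<close> by (simp add: field_simps abs_if)
    finally have "norm (y - z) < norm y" using s ny by simp
    moreover have "y \<in> voronoi_cell S" using that ny s by auto
    ultimately show False using z by (auto simp: voronoi_cell_def)
  qed
  show ?thesis unfolding centered_inradius_def
    by (rule cSup_eq_maximum) (use 1 2 in auto)
qed

lemma AE_norm_uniform_unit_circle: "AE x in uniform_unit_circle. norm x = 1"
proof -
  have v: "vector [c, s] = (\<chi> i :: 2. if i = 1 then c else s)" for c s :: real
    by (simp add: vec_eq_iff forall_2)
  have c: "continuous_on UNIV (\<lambda>\<theta>::real. (\<chi> i :: 2. if i = 1 then cos \<theta> else sin \<theta>))"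
  proof (rule continuous_on_vec_lambda)
    show "continuous_on UNIV (\<lambda>\<theta>::real. if i = 1 then cos \<theta> else sin \<theta>)" for i :: 2
      by (cases "i = 1") (simp_all add: continuous_on_cos continuous_on_sin continuous_on_id)
  qed
  have m: "(\<lambda>\<theta>::real. vector [cos \<theta>, sin \<theta>] :: real ^ 2) \<in> borel_measurable borel"
    unfolding v by (rule borel_measurable_continuous_onI[OF c])
  have n: "norm (vector [cos \<theta>, sin \<theta>] :: real ^ 2) = 1" for \<theta> :: real
    by (simp add: norm_vec_def L2_set_def sum_2)
  show ?thesis unfolding uniform_unit_circle_def
    by (subst AE_distr_iff) (use m n in \<open>auto simp: measurable_cong_sets[OF sets_uniform_measure refl]\<close>)
qed

text \<open>Under this law, the cell has centered inradius \<open>r\<close>.\<close>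

lemma AE_centered_inradius:
  assumes "r > 0" and Z: "poisson_given_inradius M r Z"
  shows "AE \<omega> in M. centered_inradius (voronoi_cell (Z \<omega>)) = r"
proof -
  obtain \<Phi> X where P: "poisson_process M (density lborel (indicator (- cball 0 (2 * r)))) \<Phi>"
    and X: "distr M borel X = uniform_unit_circle"
    and Xm: "X \<in> borel_measurable M"
    and Zeq: "\<And>\<omega>. \<omega> \<in> space M \<Longrightarrow> Z \<omega> = \<Phi> \<omega> \<union> {(2 * r) *\<^sub>R X \<omega>}"
    using Z unfolding poisson_given_inradius_def by blast
  interpret prob_space M using P by (simp add: poisson_process_def)
  have Phi: "\<Phi> \<in> measurable M config_space" using P by (simp add: poisson_process_def)
  let ?D = "cball 0 (2 * r) :: (real ^ 2) set"
  have m0: "measure (density lborel (indicator (- ?D))) ?D = 0"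
  proof -
    have "(\<integral>\<^sup>+x. indicator (- ?D) x * indicator ?D x \<partial>lborel) = (\<integral>\<^sup>+x. 0 \<partial>(lborel :: (real ^ 2) measure))"
      by (intro nn_integral_cong) (auto simp: indicator_def)
    then show ?thesis by (simp add: measure_def emeasure_density)
  qed
  have space: "space (config_space :: (real ^ 2) set measure) = {S. locally_finite_set S}"
    unfolding config_space_def by (rule space_measure_of) auto
  have lf: "finite (\<Phi> \<omega> \<inter> ?D)" if "\<omega> \<in> space M" for \<omega>
    using measurable_space[OF Phi that] space by (auto simp: locally_finite_set_def)
  have "prob {\<omega> \<in> space M. card (\<Phi> \<omega> \<inter> ?D) = 0}
          = exp (- measure (density lborel (indicator (- ?D))) ?D)
            * measure (density lborel (indicator (- ?D))) ?D ^ 0 / fact 0"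
    using P[unfolded poisson_process_def, THEN conjunct2, THEN conjunct2, THEN conjunct1,
        rule_format, of ?D 0] by simp
  then have p1: "prob {\<omega> \<in> space M. card (\<Phi> \<omega> \<inter> ?D) = 0} = 1" using m0 by simp
  have "{\<omega> \<in> space M. card (\<Phi> \<omega> \<inter> ?D) = 0} \<in> events"
    using measure_notin_sets p1 by fastforce
  then have "AE \<omega> in M. card (\<Phi> \<omega> \<inter> ?D) = 0"
    using p1 by (simp add: prob_Collect_eq_1)
  moreover have "AE \<omega> in M. norm (X \<omega>) = 1"
    using AE_norm_uniform_unit_circle unfolding X[symmetric] by (subst (asm) AE_distr_iff) (use Xm in auto)
  ultimately show ?thesis using AE_space
  proof eventually_elim
    case (elim \<omega>)
    then have "\<Phi> \<omega> \<inter> ?D = {}" using lf by simp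
    then have "norm x \<ge> 2 * r" if "x \<in> \<Phi> \<omega>" for x
      using that by (force simp: not_le)
    then show ?case
      using elim \<open>r > 0\<close>
      by (intro centered_inradius_voronoi_cell[where z = "(2 * r) *\<^sub>R X \<omega>"]) (auto simp: Zeq)
  qed
qed

definition side_const :: real where
  "side_const = 4 * pi * 3 powr (- 1 / 3) * Gamma (5 / 3)"

end

theory Submission
  imports Defs "HOL-Real_Asymp.Real_Asymp"
begin

text \<open>
  The ray of direction \<open>u\<close> leaves the cell through the bisector of the point \<open>x\<close> that maximises
  \<open>nearness x u = (x \<bullet> u) / (x \<bullet> x)\<close>. The sides are therefore counted by the changes of this nearest
  point along a grid of directions.

  Put \<open>s = r powr (- 2 / 3)\<close>. In parabolic coordinates \<open>(q, w)\<close> around a fixed direction, the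
  points form a Poisson process of intensity \<open>2 / (1 + s\<^sup>2 w\<^sup>2)\<^sup>2\<close> above the parabola \<open>q > w\<^sup>2\<close>, the nearest
  point is the lowest one, and a rotation by the angle \<open>s \<sigma>\<close> replaces the height \<open>q\<close> by
  \<open>q - 2 \<sigma> w\<close> up to terms of higher order. In the limit the lowest point has density
  \<open>2 exp (- 8 / 3 q powr (3 / 2))\<close>, and given this point the nearest point changes with probability about
  \<open>2 \<sigma> (sqrt q - w)\<^sup>2\<close>, twice the area of the wedge swept by the rotation. The integral of the
  product is \<open>\<sigma> side_const / (2 pi)\<close>, and there are \<open>2 pi / (s \<sigma>)\<close> directions.

  Refining the grid for fixed \<open>r\<close> bounds the expectation of the number of sides from above. For the matching lower bound in
  probability the mesh \<open>s \<sigma>\<close> is kept proportional to \<open>s\<close>: the changes are then controlled by local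
  void events, which are independent for directions that are far partial_limit, and Chebyshev's inequality
  applies. The additional point on the circle changes the count by a bounded number only. An upper
  bound in mean and a lower bound in probability by the same constant give convergence in mean.
\<close>

subsection \<open>Sides of a Voronoi cell\<close>

text \<open>A Poisson process is specified here through its counts on bounded Borel sets. The place
  of the Mecke formula for the lowest point is therefore taken by a partition of the chart into
  small squares, with inclusion-exclusion for void probabilities on each of them.

  The two bounds use grids of different mesh for a structural reason. A grid of fixed mesh overlooks
  short sides, so the upper bound must refine the grid before \<open>r\<close> grows. For the lower
  bound every change of the nearest point already certifies a facet of its own, and a mesh
  \<open>e * s\<close> with small fixed \<open>e\<close> suffices: several changes within one step
  are counted once, at a cost of order \<open>e\<^sup>2\<close> per direction against a main term of
  order \<open>e\<close>.

  No second moment of the number of sides is estimated; the variance concerns a finite sum of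
  indicators only.

  The cap below height \<open>q\<close> has area \<open>4 / 3 * (q * sqrt q)\<close>, which gives
  the exponent \<open>8 / 3 * (q * sqrt q)\<close>; taking this exponent as the variable of
  integration produces \<open>Gamma (5 / 3)\<close>.\<close>

text \<open>The ray of direction \<open>u\<close> meets the bisector of \<open>0\<close> and \<open>x\<close> at distance
  \<open>1 / (2 * nearness x u)\<close>, so \<open>nearest S u\<close> lists the points whose bisectors it meets first.\<close>

definition nearness :: "real ^ 2 \<Rightarrow> real ^ 2 \<Rightarrow> real" where
  "nearness x u = (x \<bullet> u) / (x \<bullet> x)"

definition nearest :: "(real ^ 2) set \<Rightarrow> real ^ 2 \<Rightarrow> (real ^ 2) set" where
  "nearest S u = {x \<in> S. \<forall>y\<in>S. nearness y u \<le> nearness x u}"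

lemma nearness_add: "nearness x (u + v) = nearness x u + nearness x v"
  by (simp add: nearness_def inner_add_right add_divide_distrib)

lemma nearness_diff: "nearness x (u - v) = nearness x u - nearness x v"
  by (simp add: nearness_def inner_diff_right diff_divide_distrib)

lemma nearness_scale: "nearness x (t *\<^sub>R u) = t * nearness x u"
  by (simp add: nearness_def)

lemma nearness_le: "nearness x u \<le> norm u / norm x"
proof (cases "x = 0")
  case False
  have "x \<bullet> u \<le> norm x * norm u" by (rule norm_cauchy_schwarz)
  then have "nearness x u \<le> (norm x * norm u) / (x \<bullet> x)"
    by (simp add: nearness_def divide_right_mono)
  also have "\<dots> = norm u / norm x" using False by (simp add: dot_square_norm power2_eq_square)
  finally show ?thesis .
qed (simp add: nearness_def)

lemma nearness_pos: "nearness x u > 0 \<Longrightarrow> x \<bullet> u > 0"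
  unfolding nearness_def using divide_nonpos_nonneg[of "x \<bullet> u" "x \<bullet> x"] by fastforce

lemma divide_le_cross: "0 < p \<Longrightarrow> 0 < p' \<Longrightarrow> A / p \<le> B / p' \<Longrightarrow> A * p' \<le> B * (p :: real)"
  by (simp add: divide_simps mult_ac)

lemma voronoi_cell_iff: "y \<in> voronoi_cell S \<longleftrightarrow> (\<forall>x\<in>S. x \<bullet> y \<le> (x \<bullet> x) / 2)"
proof -
  have "norm y \<le> norm (y - x) \<longleftrightarrow> x \<bullet> y \<le> (x \<bullet> x) / 2" for x
    by (simp add: norm_le inner_diff_left inner_diff_right inner_commute) linarith
  then show ?thesis by (simp add: voronoi_cell_def)
qed

text \<open>The last condition says that every ray from the origin leaves the cell within distance
  \<open>1 / (2 * c)\<close>; it makes the cell a polygon. A cell with infinitely many sides would have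
  \<open>num_sides\<close> equal to \<open>0\<close>.\<close>

locale surrounded =
  fixes S :: "(real ^ 2) set" and c \<rho> :: real
  assumes lf: "locally_finite_set S"
    and rho: "\<rho> > 0" "\<And>x. x \<in> S \<Longrightarrow> \<rho> \<le> norm x"
    and c: "c > 0"
    and sur: "\<And>u. norm u = 1 \<Longrightarrow> \<exists>x\<in>S. c \<le> nearness x u"
begin

text \<open>A point beyond distance \<open>1 / c\<close> has its bisector farther than
  \<open>1 / (2 * c)\<close> from the origin, hence outside the cell. So these finitely many points
  already determine the cell.\<close>

definition near_points where "near_points = S \<inter> cball 0 (1 / c)"

lemma mem_nonzero: "x \<in> S \<Longrightarrow> x \<noteq> 0" using rho by force

lemma finite_near_points: "finite near_points"
  using lf unfolding near_points_def locally_finite_set_def by auto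

lemma nearness_le_rho: "x \<in> S \<Longrightarrow> nearness x u \<le> norm u / \<rho>"
  using rho nearness_le[of x u] by (meson divide_left_mono dual_order.trans mult_pos_pos norm_ge_zero order_less_le_trans)

lemma finite_nearness_ge:
  assumes "e > 0" "norm u = 1" shows "finite {x\<in>S. nearness x u \<ge> e}"
proof (rule finite_subset)
  show "{x\<in>S. nearness x u \<ge> e} \<subseteq> S \<inter> cball 0 (1 / e)"
  proof clarsimp
    fix x assume x: "x \<in> S" "e \<le> nearness x u"
    then have "e \<le> 1 / norm x" using nearness_le[of x u] assms by simp
    then show "norm x \<le> 1 / e" using assms mem_nonzero[OF x(1)] by (simp add: field_simps)
  qed
  show "finite (S \<inter> cball 0 (1 / e))"
    using lf unfolding locally_finite_set_def by auto
qed

text \<open>Only finitely many points reach the level \<open>c\<close>, and at least one does, so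
  the maximum is attained among them.\<close>

lemma nearest_nonempty: assumes "norm u = 1" shows "nearest S u \<noteq> {}"
proof -
  let ?A = "{x\<in>S. nearness x u \<ge> c}"
  have "finite ?A" "?A \<noteq> {}" using finite_nearness_ge[OF c assms] sur[OF assms] by auto
  then have "Max ((\<lambda>x. nearness x u) ` ?A) \<in> (\<lambda>x. nearness x u) ` ?A" by (intro Max_in) auto
  then obtain x where x: "x \<in> ?A" "nearness x u = Max ((\<lambda>x. nearness x u) ` ?A)" by force
  have "nearness y u \<le> nearness x u" if "y \<in> S" for y
  proof (cases "y \<in> ?A")
    case True
    then show ?thesis unfolding x(2) using \<open>finite ?A\<close> by (intro Max_ge) auto
  next
    case False
    then show ?thesis using x(1) that by auto
  qed
  then have "x \<in> nearest S u" using x by (auto simp: nearest_def)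
  then show ?thesis by auto
qed

lemma nearest_ge: assumes "norm u = 1" "x \<in> nearest S u" shows "nearness x u \<ge> c" "x \<in> S"
  using assms sur[of u] by (force simp: nearest_def)+

abbreviation C where "C \<equiv> voronoi_cell S"

text \<open>The point supplied by \<open>sur\<close> in the direction of \<open>y\<close> has norm
  at most \<open>1 / c\<close>, so it is itself in \<open>near_points\<close>. This is why the
  constraints of \<open>near_points\<close> alone bound \<open>y\<close>.\<close>

lemma cell_norm: assumes "\<And>x. x \<in> near_points \<Longrightarrow> x \<bullet> y \<le> (x \<bullet> x) / 2" shows "norm y \<le> 1 / (2 * c)"
proof (cases "y = 0")
  case False
  define u where "u = y /\<^sub>R norm y"
  have u: "norm u = 1" "y = norm y *\<^sub>R u" using False by (auto simp: u_def)
  obtain x where x: "x \<in> S" "c \<le> nearness x u" using sur u(1) by blast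
  have "c \<le> 1 / norm x" using nearness_le[of x u] u x by simp
  then have "norm x \<le> 1 / c" using c mem_nonzero[OF x(1)] by (simp add: field_simps)
  then have "x \<bullet> y \<le> (x \<bullet> x) / 2" using assms x by (auto simp: near_points_def)
  then have *: "norm y * (x \<bullet> u) \<le> (x \<bullet> x) / 2" using u(2) by (metis inner_scaleR_right)
  have xx: "x \<bullet> x > 0" using mem_nonzero[OF x(1)] by simp
  have "norm y * nearness x u \<le> 1 / 2"
    using * xx by (simp add: nearness_def field_simps)
  then have "norm y * c \<le> 1 / 2" using x(2) by (meson dual_order.trans mult_left_mono norm_ge_zero)
  then show ?thesis using c by (simp add: field_simps)
qed (use c in auto)

lemma not_near_strict: assumes "norm y \<le> 1 / (2 * c)" "x \<in> S" "x \<notin> near_points" shows "x \<bullet> y < (x \<bullet> x) / 2"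
proof -
  have x: "norm x > 1 / c" "norm x > 0" using assms mem_nonzero by (auto simp: near_points_def)
  have "x \<bullet> y \<le> norm x * norm y" by (rule norm_cauchy_schwarz)
  also have "\<dots> \<le> norm x * (1 / (2 * c))" using assms by (intro mult_left_mono) auto
  also have "\<dots> = norm x * (1 / c) / 2" by simp
  also have "\<dots> < norm x * norm x / 2" using x by (intro divide_strict_right_mono mult_strict_left_mono) auto
  finally show ?thesis by (simp add: dot_square_norm power2_eq_square)
qed

lemma cell_eq: "C = (\<Inter>x\<in>near_points. {y. x \<bullet> y \<le> (x \<bullet> x) / 2})"
proof (intro set_eqI iffI)
  fix y assume "y \<in> (\<Inter>x\<in>near_points. {y. x \<bullet> y \<le> (x \<bullet> x) / 2})"
  then have *: "x \<bullet> y \<le> (x \<bullet> x) / 2" if "x \<in> near_points" for x using that by auto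
  note n = cell_norm[OF *]
  show "y \<in> C" unfolding voronoi_cell_iff
  proof
    fix x assume "x \<in> S" then show "x \<bullet> y \<le> (x \<bullet> x) / 2" using * not_near_strict[OF n] by (cases "x \<in> near_points") fastforce+
  qed
qed (auto simp: voronoi_cell_iff near_points_def)

lemma cell_polyhedron: "polyhedron C"
  unfolding cell_eq
proof (intro polyhedron_Inter)
  show "polyhedron X" if "X \<in> (\<lambda>x. {y. x \<bullet> y \<le> (x \<bullet> x) / 2}) ` near_points" for X
    using that polyhedron_halfspace_le by blast
qed (use finite_near_points in simp)

lemma strict_interior: assumes "\<And>x. x \<in> near_points \<Longrightarrow> x \<bullet> y < (x \<bullet> x) / 2" shows "y \<in> interior C"
proof (rule interiorI)
  show "open (\<Inter>x\<in>near_points. {y. x \<bullet> y < (x \<bullet> x) / 2})"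
    using finite_near_points open_halfspace_lt by (intro open_INT ballI)
  show "y \<in> (\<Inter>x\<in>near_points. {y. x \<bullet> y < (x \<bullet> x) / 2})" using assms by auto
  show "(\<Inter>x\<in>near_points. {y. x \<bullet> y < (x \<bullet> x) / 2}) \<subseteq> C" unfolding cell_eq by force
qed

lemma convex_cell: "convex C" using cell_polyhedron by (rule polyhedron_imp_convex)

lemma zero_interior: "0 \<in> interior C"
  by (rule strict_interior) (auto simp: near_points_def dest: mem_nonzero)

lemma aff_dim_cell: "aff_dim C = 2"
  using zero_interior aff_dim_nonempty_interior[of C] by auto

lemma bisector_face: assumes "x \<in> S" shows "(C \<inter> {y. x \<bullet> y = (x \<bullet> x) / 2}) face_of C"
  using assms by (intro face_of_Int_supporting_hyperplane_le convex_cell) (auto simp: voronoi_cell_iff)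

text \<open>A point of the facet is a boundary point of the cell, so some constraint is tight there.
  If the point is relatively interior, the face cut out by this bisector contains all of
  \<open>F\<close>; it has dimension at most one, so the two coincide.\<close>

lemma facet_eq:
  assumes F: "F facet_of C" shows "\<exists>x\<in>near_points. F = C \<inter> {y. x \<bullet> y = (x \<bullet> x) / 2}"
proof -
  have Ff: "F face_of C" and F0: "F \<noteq> {}" and dF: "aff_dim F = 1"
    using F aff_dim_cell by (auto simp: facet_of_def)
  have "F \<noteq> C" using dF aff_dim_cell by auto
  then have disj: "F \<inter> interior C = {}" using face_of_disjoint_interior[OF Ff] by auto
  have cF: "convex F" using Ff face_of_imp_convex by blast
  then obtain y where y: "y \<in> rel_interior F" using F0 rel_interior_eq_empty by blast
  then have yF: "y \<in> F" using rel_interior_subset by auto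
  then have yC: "y \<in> C" using Ff face_of_imp_subset by blast
  have "y \<notin> interior C" using yF disj by auto
  then obtain x where x: "x \<in> near_points" "\<not> x \<bullet> y < (x \<bullet> x) / 2" using strict_interior by blast
  then have tight: "x \<bullet> y = (x \<bullet> x) / 2" using yC by (force simp: voronoi_cell_iff near_points_def)
  let ?T = "C \<inter> {y. x \<bullet> y = (x \<bullet> x) / 2}"
  have xS: "x \<in> S" using x by (auto simp: near_points_def)
  note T = bisector_face[OF xS]
  have sub: "F \<subseteq> ?T" by (rule subset_of_face_of[OF T]) (use Ff face_of_imp_subset y yC tight in auto)
  have "F face_of ?T" using face_of_face[OF T] Ff sub by auto
  moreover have "aff_dim ?T \<le> 1"
  proof -
    have "aff_dim ?T \<le> aff_dim {y. x \<bullet> y = (x \<bullet> x) / 2}" by (intro aff_dim_subset) auto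
    also have "\<dots> = 1" using mem_nonzero[OF xS] by (subst aff_dim_hyperplane) auto
    finally show ?thesis .
  qed
  moreover have "convex ?T" using T face_of_imp_convex by blast
  ultimately have "F = ?T" using face_of_aff_dim_lt[of ?T F] dF by force
  then show ?thesis using x by blast
qed

lemma finite_facets: "finite {F. F facet_of C}"
  using cell_polyhedron by (rule finite_polyhedron_facets)

text \<open>A generic point of the facet lies on no other bisector, because each of the finitely
  many others meets a segment inside the facet in at most one point. In the direction of such a
  point the nearness of \<open>x\<close> exceeds that of all others by a uniform gap, and the gap
  persists for neighbouring directions.\<close>

lemma facet_direction:
  assumes F: "F facet_of C"
  shows "\<exists>x u d. x \<in> S \<and> F = C \<inter> {y. x \<bullet> y = (x \<bullet> x) / 2} \<and> d > 0 \<and> norm u = 1 \<and>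
      (\<forall>w. norm w = 1 \<longrightarrow> norm (w - u) < d \<longrightarrow> nearest S w = {x})"
proof -
  obtain x where x: "x \<in> near_points" and Feq: "F = C \<inter> {y. x \<bullet> y = (x \<bullet> x) / 2}"
    using facet_eq[OF F] by auto
  have xS: "x \<in> S" using x by (auto simp: near_points_def)
  have dF: "aff_dim F = 1" and F0: "F \<noteq> {}" and cF: "convex F"
    using F aff_dim_cell face_of_imp_convex by (auto simp: facet_of_def)
  obtain y1 where y1: "y1 \<in> F" using F0 by auto
  have "F \<noteq> {y1}" using dF by auto
  then obtain y2 where y2: "y2 \<in> F" "y2 \<noteq> y1" using y1 by auto
  define Y where "Y t = (1 - t) *\<^sub>R y1 + t *\<^sub>R y2" for t :: real
  have YF: "Y t \<in> F" if "t \<in> {0..1}" for t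
    using that y1 y2 cF unfolding Y_def convex_alt by auto
  have xy: "x \<bullet> y1 = (x \<bullet> x) / 2" "x \<bullet> y2 = (x \<bullet> x) / 2" using y1 y2 Feq by auto
  have bad: "finite {t. z \<bullet> Y t = (z \<bullet> z) / 2}" if z: "z \<in> near_points" "z \<noteq> x" for z
  proof -
    have eq: "z \<bullet> Y t = z \<bullet> y1 + t * (z \<bullet> y2 - z \<bullet> y1)" for t
      by (simp add: Y_def inner_add_right algebra_simps)
    have "z \<in> S" using z by (auto simp: near_points_def)
    note nz' = mem_nonzero[OF this] mem_nonzero[OF xS]
    show ?thesis
    proof (cases "z \<bullet> y2 = z \<bullet> y1")
      case False
      then have "{t. z \<bullet> Y t = (z \<bullet> z) / 2} \<subseteq> {((z \<bullet> z) / 2 - z \<bullet> y1) / (z \<bullet> y2 - z \<bullet> y1)}"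
        unfolding eq by (auto simp: field_simps)
      then show ?thesis using finite_subset by blast
    next
      case True
      \<comment> \<open>Otherwise \<open>z\<close> and \<open>x\<close> would have the same
        bisector: both are orthogonal to \<open>w\<close>, so \<open>z\<close> is a multiple
        \<open>k\<close> of \<open>x\<close>, and the common point \<open>y1\<close> forces
        \<open>k = k * k\<close>, hence \<open>z = x\<close>.\<close>
      have "z \<bullet> y1 \<noteq> (z \<bullet> z) / 2"
      proof
        assume z1: "z \<bullet> y1 = (z \<bullet> z) / 2"
        define w where "w = y2 - y1"
        have zw: "z \<bullet> w = 0" "x \<bullet> w = 0" using True xy by (auto simp: w_def inner_diff_right)
        have w0: "w \<noteq> 0" using y2 by (simp add: w_def)
        have zx: "z$1 * w$1 + z$2 * w$2 = 0" "x$1 * w$1 + x$2 * w$2 = 0"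
          using zw by (auto simp: inner_vec_def sum_2)
        have "(z$1 * x$2 - z$2 * x$1) * w$1 = 0" "(z$1 * x$2 - z$2 * x$1) * w$2 = 0"
          using zx by algebra+
        moreover have "w$1 \<noteq> 0 \<or> w$2 \<noteq> 0" using w0 by (auto simp: vec_eq_iff forall_2)
        ultimately have det: "z$1 * x$2 = z$2 * x$1" by auto
        have e1: "2 * (z$1 * y1$1 + z$2 * y1$2) = z$1 * z$1 + z$2 * z$2"
          "2 * (x$1 * y1$1 + x$2 * y1$2) = x$1 * x$1 + x$2 * x$2"
          using z1 xy(1) by (auto simp: inner_vec_def sum_2)
        have nz2: "z$1 * z$1 + z$2 * z$2 \<noteq> 0" "x$1 * x$1 + x$2 * x$2 \<noteq> 0"
          using nz' by (auto simp: vec_eq_iff forall_2 add_nonneg_eq_0_iff)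
        have "z$1 = x$1 \<and> z$2 = x$2"
        proof -
          obtain k where k: "z$1 = k * x$1" "z$2 = k * x$2"
          proof (cases "x$1 = 0")
            case True
            then have "x$2 \<noteq> 0" using nz2 by auto
            then show ?thesis using that[of "z$2 / x$2"] det True by (auto simp: field_simps)
          next
            case False
            then show ?thesis using that[of "z$1 / x$1"] det by (auto simp: field_simps)
          qed
          have "k * (2 * (x$1 * y1$1 + x$2 * y1$2)) = k * k * (x$1 * x$1 + x$2 * x$2)"
            using e1(1) unfolding k by (simp add: algebra_simps)
          then have "k * (x$1 * x$1 + x$2 * x$2) = k * k * (x$1 * x$1 + x$2 * x$2)" unfolding e1(2) .
          then have "k = k * k" using nz2(2) mult_right_cancel by blast
          moreover have "k \<noteq> 0" using nz2(1) k by auto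
          ultimately have "k = 1" by simp
          then show ?thesis using k by simp
        qed
        then have "z = x" by (auto simp: vec_eq_iff forall_2)
        then show False using z by simp
      qed
      then have "{t. z \<bullet> Y t = (z \<bullet> z) / 2} = {}" unfolding eq True by auto
      then show ?thesis by simp
    qed
  qed
  have "finite (\<Union>z\<in>near_points - {x}. {t. z \<bullet> Y t = (z \<bullet> z) / 2})"
    using finite_near_points bad by auto
  moreover have "infinite {0..1::real}" by (simp add: infinite_Icc)
  ultimately obtain t where t: "t \<in> {0..1}" "t \<notin> (\<Union>z\<in>near_points - {x}. {t. z \<bullet> Y t = (z \<bullet> z) / 2})"
    by (meson finite_subset subsetI)
  define y where "y = Y t"
  have yF: "y \<in> F" using YF t by (simp add: y_def)
  then have yC: "y \<in> C" and yx: "x \<bullet> y = (x \<bullet> x) / 2" using Feq by auto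
  have ny: "norm y \<le> 1 / (2 * c)" using yC by (intro cell_norm) (auto simp: cell_eq)
  have strict: "z \<bullet> y < (z \<bullet> z) / 2" if "z \<in> S" "z \<noteq> x" for z
  proof (cases "z \<in> near_points")
    case True
    then have "z \<bullet> y \<noteq> (z \<bullet> z) / 2" using t that by (auto simp: y_def)
    then show ?thesis using yC that by (force simp: voronoi_cell_iff)
  qed (use not_near_strict[OF ny] that in auto)
  have y0: "y \<noteq> 0" using yx mem_nonzero[OF xS] by auto
  define u where "u = y /\<^sub>R norm y"
  have u: "norm u = 1" using y0 by (simp add: u_def)
  define m where "m = 1 / (2 * norm y)"
  have m: "m > 0" using y0 by (simp add: m_def)
  have nu: "nearness z u = (z \<bullet> y) / (z \<bullet> z) / norm y" for z by (simp add: nearness_def u_def divide_inverse)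
  have xm: "nearness x u = m" using mem_nonzero[OF xS] by (simp add: nu yx m_def)
  have zm: "nearness z u < m" if "z \<in> S" "z \<noteq> x" for z
  proof -
    have "z \<bullet> z > 0" using mem_nonzero that by auto
    then have "(z \<bullet> y) / (z \<bullet> z) < 1 / 2" using strict[OF that] by (simp add: field_simps)
    then have "(z \<bullet> y) / (z \<bullet> z) / norm y < 1 / 2 / norm y" using y0 by (intro divide_strict_right_mono) auto
    then show ?thesis by (simp add: nu m_def)
  qed
  \<comment> \<open>Infinitely many competitors remain, but only finitely many have nearness at
    least \<open>m / 2\<close>; their maximum stays below \<open>m\<close>.\<close>
  have "\<exists>e>0. \<forall>z\<in>S - {x}. nearness z u \<le> m - e"
  proof -
    let ?A = "insert (m / 2) ((\<lambda>z. nearness z u) ` ({z\<in>S. nearness z u \<ge> m / 2} - {x}))"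
    have fA: "finite ?A" using finite_nearness_ge[of "m / 2" u] m u by auto
    have "Max ?A < m" using fA m zm by (subst Max_less_iff) auto
    moreover have "nearness z u \<le> Max ?A" if "z \<in> S - {x}" for z
    proof (cases "nearness z u \<ge> m / 2")
      case True then show ?thesis using fA that by (intro Max_ge) auto
    next
      case False
      then show ?thesis using fA by (meson Max_ge insertI1 le_cases order_trans)
    qed
    ultimately show ?thesis by (intro exI[of _ "m - Max ?A"]) auto
  qed
  then obtain e where e: "e > 0" "\<And>z. z \<in> S \<Longrightarrow> z \<noteq> x \<Longrightarrow> nearness z u \<le> m - e" by auto
  \<comment> \<open>The nearness of a point of \<open>S\<close> is Lipschitz in the direction with
    constant \<open>1 / \<rho>\<close>. Within \<open>e * \<rho> / 2\<close> all values move by less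
    than \<open>e / 2\<close>, which cannot close the gap \<open>e\<close>.\<close>
  have "nearest S w = {x}" if w: "norm w = 1" "norm (w - u) < e * \<rho> / 2" for w
  proof -
    have "norm (w - u) / \<rho> < e / 2" using w rho by (simp add: field_simps)
    then have d: "nearness z w - nearness z u < e / 2" "nearness z u - nearness z w < e / 2" if "z \<in> S" for z
      using nearness_le_rho[OF that, of "w - u"] nearness_le_rho[OF that, of "u - w"]
      by (auto simp: nearness_diff norm_minus_commute field_simps)
    have "nearness z w < nearness x w" if "z \<in> S" "z \<noteq> x" for z
      using d[OF that(1)] d[OF xS] e(2)[OF that] xm by linarith
    then show ?thesis using xS unfolding nearest_def by (fastforce simp: order.strict_iff_order)
  qed
  then show ?thesis using xS Feq u e rho by (intro exI[of _ x] exI[of _ u] exI[of _ "e * \<rho> / 2"]) auto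
qed

end

subsection \<open>Grids of directions\<close>

definition dirv :: "real \<Rightarrow> real ^ 2" where "dirv a = vector [cos a, sin a]"

lemma dirv_nth [simp]: "dirv a $ 1 = cos a" "dirv a $ 2 = sin a"
  by (simp_all add: dirv_def)

lemma inner_dirv: "x \<bullet> dirv a = x $ 1 * cos a + x $ 2 * sin a"
  by (simp add: inner_vec_def sum_2)

lemma norm_dirv [simp]: "norm (dirv a) = 1"
  by (simp add: norm_eq_sqrt_inner inner_dirv power2_eq_square[symmetric])

lemma dirv_2pi [simp]: "dirv (a + 2 * pi) = dirv a"
  by (simp add: vec_eq_iff forall_2)

lemma dirv_pi: "dirv (a + pi) = - dirv a"
  by (simp add: vec_eq_iff forall_2)

lemma dirv_between:
  "sin (c - a) *\<^sub>R dirv b = sin (c - b) *\<^sub>R dirv a + sin (b - a) *\<^sub>R dirv c"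
proof -
  have "sin (c - a) * cos b = sin (c - b) * cos a + sin (b - a) * cos c"
    by (simp add: sin_diff algebra_simps)
  moreover have "sin (c - a) * sin b = sin (c - b) * sin a + sin (b - a) * sin c"
    by (simp add: sin_diff algebra_simps)
  ultimately show ?thesis by (simp add: vec_eq_iff forall_2)
qed

lemma norm_dirv_diff: "norm (dirv a - dirv b) = 2 * \<bar>sin ((a - b) / 2)\<bar>"
proof -
  have "(norm (dirv a - dirv b))\<^sup>2 = (cos a - cos b)\<^sup>2 + (sin a - sin b)\<^sup>2"
    by (subst power2_norm_eq_inner) (simp add: inner_vec_def sum_2 power2_eq_square)
  also have "\<dots> = (cos a ^ 2 + sin a ^ 2) + (cos b ^ 2 + sin b ^ 2) - 2 * cos (a - b)"
    by (simp add: cos_diff power2_eq_square algebra_simps)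
  also have "\<dots> = 2 - 2 * cos (a - b)" by simp
  also have "cos (a - b) = cos (2 * ((a - b) / 2))" by (rule arg_cong[of _ _ cos]) simp
  also have "\<dots> = 1 - 2 * (sin ((a - b) / 2))\<^sup>2" by (rule cos_double_sin)
  also have "2 - 2 * (1 - 2 * (sin ((a - b) / 2))\<^sup>2) = (2 * \<bar>sin ((a - b) / 2)\<bar>)\<^sup>2"
    by (simp add: power_mult_distrib)
  finally show ?thesis by (rule power2_eq_imp_eq) auto
qed

lemma norm_dirv_diff_le: "norm (dirv a - dirv b) \<le> \<bar>a - b\<bar>"
  using abs_sin_x_le_abs_x[of "(a - b) / 2"] by (simp add: norm_dirv_diff)

lemma unit_dirv: assumes "norm u = 1" obtains a where "0 \<le> a" "a < 2 * pi" "u = dirv a"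
proof -
  have "(u $ 1)\<^sup>2 + (u $ 2)\<^sup>2 = 1"
    using assms by (simp add: norm_eq_sqrt_inner inner_vec_def sum_2 power2_eq_square)
  then obtain a where "0 \<le> a" "a < 2 * pi" "u $ 1 = cos a" "u $ 2 = sin a"
    using sincos_total_2pi by metis
  then show ?thesis using that[of a] by (auto simp: vec_eq_iff forall_2)
qed

definition grid :: "nat \<Rightarrow> nat \<Rightarrow> real ^ 2" where "grid n k = dirv (2 * pi * k / n)"

lemma norm_grid [simp]: "norm (grid n k) = 1" by (simp add: grid_def)

lemma grid_dense:
  assumes "norm u = 1" "n > 0" shows "\<exists>k<n. norm (grid n k - u) \<le> 2 * pi / n"
proof -
  obtain a where a: "0 \<le> a" "a < 2 * pi" "u = dirv a" using unit_dirv[OF assms(1)] .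
  define t where "t = a * n / (2 * pi)"
  define k where "k = nat \<lfloor>t\<rfloor>"
  have t: "0 \<le> t" "t < n" using a assms by (auto simp: t_def field_simps)
  have k: "real k \<le> t" "t < real k + 1" using t by (auto simp: k_def)
  have "k < n" using k t by linarith
  have "2 * pi * k / n - a = 2 * pi / n * (k - t)" using assms by (simp add: t_def field_simps)
  then have "\<bar>2 * pi * k / n - a\<bar> = 2 * pi / n * \<bar>k - t\<bar>" by (simp add: abs_mult)
  also have "\<dots> \<le> 2 * pi / n * 1" using k by (intro mult_left_mono) auto
  finally have "norm (grid n k - u) \<le> 2 * pi / n"
    unfolding grid_def a using norm_dirv_diff_le order_trans by fastforce
  then show ?thesis using \<open>k < n\<close> by auto
qed

text \<open>Nearness is linear in the direction, and by \<open>dirv_between\<close> the middle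
  direction is a combination of the outer ones. The coefficients are nonnegative as long as the
  outer directions span less than a half turn.\<close>

lemma nearest_between:
  assumes "x \<in> nearest S (dirv a)" "x \<in> nearest S (dirv c)" "a \<le> b" "b \<le> c" "c - a < pi"
  shows "x \<in> nearest S (dirv b)"
proof (cases "a = c")
  case True then show ?thesis using assms by (metis order.antisym)
next
  case False
  have s: "sin (c - a) > 0" "sin (c - b) \<ge> 0" "sin (b - a) \<ge> 0"
    using assms False by (auto intro!: sin_gt_zero sin_ge_zero)
  have eq: "sin (c - a) * nearness y (dirv b) = sin (c - b) * nearness y (dirv a) + sin (b - a) * nearness y (dirv c)" for y
    by (metis dirv_between nearness_add nearness_scale)
  have "nearness y (dirv b) \<le> nearness x (dirv b)" if "y \<in> S" for y
  proof -
    have "sin (c - a) * nearness y (dirv b) \<le> sin (c - a) * nearness x (dirv b)"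
      unfolding eq using assms that s by (intro add_mono mult_left_mono) (auto simp: nearest_def)
    then show ?thesis using s by simp
  qed
  then show ?thesis using assms by (auto simp: nearest_def)
qed

context surrounded
begin

text \<open>Every facet owns an open arc of directions by \<open>facet_direction\<close>, and there
  are finitely many facets, so a fine grid meets all these arcs; distinct facets belong to distinct
  points. The threshold \<open>n0\<close> depends on the configuration, which is why expectations
  are later compared through Fatou's lemma.\<close>

lemma num_sides_le:
  "\<exists>n0. \<forall>n\<ge>n0. num_sides C \<le> card {x \<in> S. \<exists>k<n. nearest S (grid n k) = {x}}"
proof -
  define Fs where "Fs = {F. F facet_of C}"
  have fin: "finite Fs" using finite_facets by (simp add: Fs_def)
  have "\<forall>F\<in>Fs. \<exists>x u d. x \<in> S \<and> F = C \<inter> {y. x \<bullet> y = (x \<bullet> x) / 2} \<and> d > 0 \<and> norm u = 1 \<and>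
      (\<forall>w. norm w = 1 \<longrightarrow> norm (w - u) < d \<longrightarrow> nearest S w = {x})"
    using facet_direction by (auto simp: Fs_def)
  then obtain X U D where X: "\<And>F. F \<in> Fs \<Longrightarrow> X F \<in> S \<and> F = C \<inter> {y. X F \<bullet> y = (X F \<bullet> X F) / 2} \<and> D F > 0 \<and> norm (U F) = 1 \<and>
      (\<forall>w. norm w = 1 \<longrightarrow> norm (w - U F) < D F \<longrightarrow> nearest S w = {X F})" by metis
  define d :: real where "d = Min (insert 1 (D ` Fs))"
  have d: "d > 0" using fin X by (auto simp: d_def)
  have dD: "d \<le> D F" if "F \<in> Fs" for F using that fin by (auto simp: d_def)
  obtain n0 :: nat where n0: "n0 > 2 * pi / d" using reals_Archimedean2 by blast
  have n00: "real n0 > 0" using n0 d by (meson divide_nonneg_pos less_eq_real_def order_le_less_trans pi_ge_zero mult_nonneg_nonneg zero_le_numeral)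
  show ?thesis
  proof (intro exI allI impI)
    fix n assume n: "n \<ge> n0"
    have n_pos: "n > 0" using n n00 by linarith
    have small: "2 * pi / n < d" using n0 n d n_pos
      by (metis divide_less_eq mult.commute of_nat_0_less_iff of_nat_le_iff order_less_le_trans pos_divide_less_eq)
    let ?T = "{x \<in> S. \<exists>k<n. nearest S (grid n k) = {x}}"
    have "?T \<subseteq> (\<lambda>k. the_elem (nearest S (grid n k))) ` {..<n}"
    proof clarify
      fix x k assume "k < n" "nearest S (grid n k) = {x}"
      then show "x \<in> (\<lambda>k. the_elem (nearest S (grid n k))) ` {..<n}" by (intro image_eqI[of _ _ k]) auto
    qed
    then have fT: "finite ?T" using finite_surj by blast
    have "X ` Fs \<subseteq> ?T"
    proof clarify
      fix F assume F: "F \<in> Fs"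
      obtain k where k: "k < n" "norm (grid n k - U F) \<le> 2 * pi / n"
        using grid_dense[of "U F" n] X[OF F] n_pos by auto
      then have "norm (grid n k - U F) < D F" using small dD[OF F] by linarith
      then show "X F \<in> S \<and> (\<exists>k<n. nearest S (grid n k) = {X F})" using X[OF F] k by auto
    qed
    moreover have "inj_on X Fs"
    proof (rule inj_on_inverseI)
      show "C \<inter> {y. X F \<bullet> y = (X F \<bullet> X F) / 2} = F" if "F \<in> Fs" for F
        using X[OF that] by (elim conjE) (rule sym)
    qed
    ultimately show "num_sides C \<le> card ?T"
      unfolding num_sides_def Fs_def[symmetric] using card_inj_on_le fT by blast
  qed
qed

text \<open>The witness \<open>p\<close> is the point where the ray of direction \<open>u\<close>
  leaves the cell. It is a boundary point, hence on a facet, and a bisector passes through it only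
  if its point attains the maximal nearness.\<close>

lemma facet_at_direction:
  assumes u: "norm u = 1"
  shows "\<exists>F p. F facet_of C \<and> p \<in> F \<and> (\<forall>x\<in>S. x \<bullet> p = (x \<bullet> x) / 2 \<longrightarrow> x \<in> nearest S u)"
proof -
  obtain z where z: "z \<in> nearest S u" using nearest_nonempty[OF u] by auto
  define m where "m = nearness z u"
  have m: "m > 0" using nearest_ge[OF u z] c by (simp add: m_def)
  have zS: "z \<in> S" using nearest_ge[OF u z] by simp
  define p where "p = (1 / (2 * m)) *\<^sub>R u"
  have xp: "x \<bullet> p = nearness x u / m * ((x \<bullet> x) / 2)" if "x \<in> S" for x
    using mem_nonzero[OF that] by (simp add: p_def nearness_def)
  have pC: "p \<in> C" unfolding voronoi_cell_iff
  proof
    fix x assume x: "x \<in> S"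
    have "nearness x u / m \<le> 1" using z x m by (auto simp: nearest_def m_def)
    then have "nearness x u / m * ((x \<bullet> x) / 2) \<le> 1 * ((x \<bullet> x) / 2)" by (intro mult_right_mono) auto
    then show "x \<bullet> p \<le> (x \<bullet> x) / 2" using xp[OF x] by simp
  qed
  let ?T = "C \<inter> {y. z \<bullet> y = (z \<bullet> z) / 2}"
  have "p \<in> ?T" using pC xp[OF zS] m by (simp add: m_def)
  moreover have "0 \<in> C" "0 \<notin> ?T" using zero_interior interior_subset mem_nonzero[OF zS] by auto
  then have "?T \<noteq> C" by blast
  ultimately have "p \<notin> interior C" using face_of_disjoint_interior[OF bisector_face[OF zS]] by auto
  then have "p \<in> C - rel_interior C"
    using pC rel_interior_nonempty_interior zero_interior by auto
  then obtain F where F: "F facet_of C" "p \<in> F"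
    using rel_boundary_of_polyhedron[OF cell_polyhedron] by auto
  have "x \<in> nearest S u" if "x \<in> S" "x \<bullet> p = (x \<bullet> x) / 2" for x
  proof -
    have "nearness x u / m * ((x \<bullet> x) / 2) = 1 * ((x \<bullet> x) / 2)" using xp[OF that(1)] that by simp
    moreover have "(x \<bullet> x) / 2 \<noteq> 0" using mem_nonzero[OF that(1)] by simp
    ultimately have "nearness x u / m = 1" using mult_right_cancel by blast
    then have "nearness x u = m" using m by simp
    then show ?thesis using z that by (auto simp: nearest_def m_def)
  qed
  then show ?thesis using F by blast
qed

text \<open>Distinct indices of \<open>J\<close> receive distinct facets. If \<open>k < l\<close>
  shared one, its point would be nearest in both directions, hence on the arc between them that is
  shorter than a half turn; this arc contains the successor of \<open>k\<close> or, going round the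
  circle, the successor of \<open>l\<close>, against \<open>change\<close>. Opposite directions are
  excluded since nearness changes sign there.\<close>

lemma num_sides_ge:
  assumes J: "J \<subseteq> {..<n}"
    and change: "\<And>k. k \<in> J \<Longrightarrow> nearest S (grid n k) \<inter> nearest S (grid n (Suc k)) = {}"
  shows "card J \<le> num_sides C"
proof -
  have "\<forall>k. \<exists>F p. F facet_of C \<and> p \<in> F \<and> (\<forall>x\<in>S. x \<bullet> p = (x \<bullet> x) / 2 \<longrightarrow> x \<in> nearest S (grid n k))"
    using facet_at_direction by simp
  then obtain F p where F: "\<And>k. F k facet_of C" "\<And>k. p k \<in> F k"
    and Fx: "\<And>k x. x \<in> S \<Longrightarrow> x \<bullet> p k = (x \<bullet> x) / 2 \<Longrightarrow> x \<in> nearest S (grid n k)"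
    by metis
  have no: False if k: "k \<in> J" "l \<in> J" "k < l" "F k = F l" for k l
  proof -
    have n: "n > 0" "l < n" using J k by auto
    obtain x where x: "x \<in> S" "F k = C \<inter> {y. x \<bullet> y = (x \<bullet> x) / 2}"
      using facet_eq[OF F(1)[of k]] by (auto simp: near_points_def)
    have xk: "x \<in> nearest S (grid n k)" using Fx F(2)[of k] x by auto
    have xl: "x \<in> nearest S (grid n l)" using Fx F(2)[of l] x k by auto
    define a b where "a = 2 * pi * k / n" and "b = 2 * pi * l / n"
    have ab: "a < b" "b < a + 2 * pi" using k n by (auto simp: a_def b_def field_simps add_strict_increasing2)
    consider "b - a < pi" | "b - a = pi" | "b - a > pi" by linarith
    then show False
    proof cases
      case 1
      have "x \<in> nearest S (grid n (Suc k))"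
        unfolding grid_def
        by (rule nearest_between[where a = a and c = b])
           (use xk xl 1 k n in \<open>auto simp: a_def b_def grid_def intro!: divide_right_mono mult_left_mono\<close>)
      then show False using change[OF k(1)] xk by auto
    next
      case 2
      then have "grid n l = - grid n k" using dirv_pi[of a] by (simp add: grid_def a_def b_def algebra_simps)
      then have "nearness x (grid n l) = - nearness x (grid n k)" by (simp add: nearness_def)
      moreover have "nearness x (grid n l) \<ge> c" "nearness x (grid n k) \<ge> c"
        using nearest_ge[OF norm_grid] xk xl by auto
      ultimately show False using c by linarith
    next
      case 3
      have le: "2 * pi * real (Suc l) / n \<le> a + 2 * pi"
      proof -
        have "2 * pi * real (Suc l) / n \<le> 2 * pi * real n / n"
          using n by (intro divide_right_mono mult_left_mono) auto
        also have "\<dots> \<le> a + 2 * pi" using n by (simp add: a_def)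
        finally show ?thesis .
      qed
      have "x \<in> nearest S (grid n (Suc l))"
        unfolding grid_def
      proof (rule nearest_between[where a = b and c = "a + 2 * pi"])
        show "x \<in> nearest S (dirv (a + 2 * pi))" using xk by (simp add: grid_def a_def)
        show "x \<in> nearest S (dirv b)" using xl by (simp add: grid_def b_def)
        show "b \<le> 2 * pi * real (Suc l) / n" using n by (auto simp: b_def intro!: divide_right_mono mult_left_mono)
      qed (use 3 le in auto)
      then show False using change[OF k(2)] xl by auto
    qed
  qed
  have "inj_on F J"
  proof (rule inj_onI)
    fix k l assume "k \<in> J" "l \<in> J" "F k = F l"
    then show "k = l" using no[of k l] no[of l k] by (metis linorder_neqE_nat)
  qed
  then show ?thesis
    unfolding num_sides_def using F finite_facets by (intro card_inj_on_le[of F J]) auto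
qed

end

lemma card_image_le_changes:
  fixes c :: "nat \<Rightarrow> 'b"
  shows "card (c ` {..<n}) \<le> 1 + card {k. Suc k < n \<and> c k \<noteq> c (Suc k)}"
proof (induction n)
  case (Suc n)
  let ?A = "\<lambda>n. {k. Suc k < n \<and> c k \<noteq> c (Suc k)}"
  have fA: "finite (?A n)" for n by (rule finite_subset[of _ "{..<n}"]) auto
  have im: "c ` {..<Suc n} = insert (c n) (c ` {..<n})" by (auto simp: lessThan_Suc)
  show ?case
  proof (cases "n = 0 \<or> c n \<in> c ` {..<n}")
    case True
    have "?A n \<subseteq> ?A (Suc n)" by auto
    then have "card (?A n) \<le> card (?A (Suc n))" using fA card_mono by blast
    then show ?thesis using Suc True by (auto simp: im insert_absorb)
  next
    case False
    then obtain m where m: "n = Suc m" by (cases n) auto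
    have "c m \<noteq> c n" using False m by (metis image_eqI lessI lessThan_iff)
    then have "?A (Suc n) = insert m (?A n)" using m by (auto simp: less_Suc_eq)
    moreover have "m \<notin> ?A n" using m by auto
    ultimately have "card (?A (Suc n)) = Suc (card (?A n))" using fA[of n] by simp
    then show ?thesis using Suc False by (simp add: im card_insert_if)
  qed
qed auto

lemma nearest_mono: assumes "x \<in> nearest (insert z S) u" "x \<noteq> z" shows "x \<in> nearest S u"
  using assms by (auto simp: nearest_def)

text \<open>A selection of one nearest point of \<open>S\<close> per direction takes at most one
  value more than it has changes, and every uniquely nearest point other than \<open>z\<close> is
  selected. The \<open>2\<close> stands for the first value and for \<open>z\<close>. Counting an
  index as soon as some pair \<open>x \<noteq> y\<close> exists covers every selection.\<close>

lemma unique_nearest_card: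
  assumes ne: "\<And>k. nearest S (grid n k) \<noteq> {}"
  shows "card {x \<in> insert z S. \<exists>k<n. nearest (insert z S) (grid n k) = {x}}
     \<le> 2 + card {k. k < n \<and> (\<exists>x\<in>nearest S (grid n k). \<exists>y\<in>nearest S (grid n (Suc k)). x \<noteq> y)}"
proof -
  define f where "f k = (SOME x. x \<in> nearest S (grid n k))" for k
  have f: "f k \<in> nearest S (grid n k)" for k using ne[of k] unfolding f_def by (simp add: some_in_eq)
  have sub: "{x \<in> insert z S. \<exists>k<n. nearest (insert z S) (grid n k) = {x}} \<subseteq> insert z (f ` {..<n})"
  proof clarify
    fix x k assume k: "k < n" "nearest (insert z S) (grid n k) = {x}" "x \<notin> f ` {..<n}"
    show "x = z"
    proof (rule ccontr)
      assume xz: "x \<noteq> z"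
      have x: "nearness y (grid n k) \<le> nearness x (grid n k)" if "y \<in> insert z S" for y
        using k that by (auto simp: nearest_def)
      have "x \<in> insert z S" using k by (auto simp: nearest_def)
      then have "nearness (f k) (grid n k) \<ge> nearness x (grid n k)" using f[of k] xz by (auto simp: nearest_def)
      moreover have "f k \<in> S" using f[of k] by (auto simp: nearest_def)
      ultimately have "f k \<in> nearest (insert z S) (grid n k)"
        using x unfolding nearest_def by (auto intro: order_trans)
      then have "f k = x" using k by auto
      then show False using k by auto
    qed
  qed
  have "card {x \<in> insert z S. \<exists>k<n. nearest (insert z S) (grid n k) = {x}} \<le> card (insert z (f ` {..<n}))"
    by (intro card_mono sub) auto
  also have "\<dots> \<le> 1 + card (f ` {..<n})" by (simp add: card_insert_if)
  also have "\<dots> \<le> 2 + card {k. Suc k < n \<and> f k \<noteq> f (Suc k)}" using card_image_le_changes[of f n] by simp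
  also have "card {k. Suc k < n \<and> f k \<noteq> f (Suc k)}
    \<le> card {k. k < n \<and> (\<exists>x\<in>nearest S (grid n k). \<exists>y\<in>nearest S (grid n (Suc k)). x \<noteq> y)}"
    by (intro card_mono) (use f in \<open>auto intro: Suc_lessD\<close>)
  finally show ?thesis by simp
qed

subsection \<open>Parabolic coordinates\<close>

lemma measurable_vector2: "(\<lambda>(a, b). vector [a, b] :: real ^ 2) \<in> borel_measurable (lborel \<Otimes>\<^sub>M lborel)"
proof -
  have "(\<lambda>(a, b). vector [a, b] :: real ^ 2) = (\<lambda>z. fst z *\<^sub>R axis 1 1 + snd z *\<^sub>R axis 2 1)"
    by (auto simp: fun_eq_iff vec_eq_iff forall_2 axis_def)
  then show ?thesis by simp
qed

lemma lborel_vec2: "(lborel :: (real ^ 2) measure) = distr (lborel \<Otimes>\<^sub>M lborel) borel (\<lambda>(a, b). vector [a, b])"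
proof (rule lborel_eqI)
  fix l u :: "real ^ 2" assume lu: "\<And>b. b \<in> Basis \<Longrightarrow> l \<bullet> b \<le> u \<bullet> b"
  have le: "l $ i \<le> u $ i" for i using lu[of "axis i 1"] by (auto simp: Basis_vec_def inner_axis)
  have "emeasure (distr (lborel \<Otimes>\<^sub>M lborel) borel (\<lambda>(a, b). vector [a, b])) (box l u)
      = emeasure (lborel \<Otimes>\<^sub>M lborel) ({l $ 1<..<u $ 1} \<times> {l $ 2<..<u $ 2})"
    by (subst emeasure_distr[OF measurable_vector2])
       (auto simp: space_pair_measure mem_box_cart forall_2 intro!: arg_cong[where f = "emeasure _"])
  also have "\<dots> = emeasure lborel {l $ 1<..<u $ 1} * emeasure lborel {l $ 2<..<u $ 2}"
    by (rule lborel.emeasure_pair_measure_Times) auto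
  also have "\<dots> = ennreal ((u $ 1 - l $ 1) * (u $ 2 - l $ 2))"
    using le by (simp add: ennreal_mult)
  also have "(u $ 1 - l $ 1) * (u $ 2 - l $ 2) = (\<Prod>b\<in>Basis. (u - l) \<bullet> b)"
  proof -
    have B: "(Basis :: (real ^ 2) set) = {axis 1 1, axis 2 1}"
      by (auto simp: Basis_vec_def UNIV_2)
    have "axis 1 (1::real) \<noteq> (axis 2 1 :: real ^ 2)" by (simp add: axis_eq_axis)
    then show ?thesis unfolding B by (simp add: inner_axis)
  qed
  finally show "emeasure (distr (lborel \<Otimes>\<^sub>M lborel) borel (\<lambda>(a, b). vector [a, b])) (box l u)
      = ennreal (\<Prod>b\<in>Basis. (u - l) \<bullet> b)" .
qed simp

definition rot :: "real \<Rightarrow> real ^ 2 \<Rightarrow> real ^ 2" where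
  "rot t x = x $ 1 *\<^sub>R dirv t + x $ 2 *\<^sub>R dirv (t + pi / 2)"

lemma linear_rot: "linear (rot t)"
  by (rule linearI) (simp_all add: rot_def algebra_simps)

lemma inner_dirv_dirv: "dirv a \<bullet> dirv b = cos (a - b)"
  by (simp add: inner_dirv cos_diff)

lemma orthogonal_rot: "orthogonal_transformation (rot t)"
  unfolding orthogonal_transformation_def
proof (intro conjI allI linear_rot)
  fix v w :: "real ^ 2"
  have "dirv t \<bullet> dirv (t + pi / 2) = 0" "dirv (t + pi / 2) \<bullet> dirv t = 0" "dirv t \<bullet> dirv t = 1" "dirv (t + pi / 2) \<bullet> dirv (t + pi / 2) = 1"
    by (simp_all add: inner_dirv_dirv)
  then show "rot t v \<bullet> rot t w = v \<bullet> w"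
    unfolding rot_def by (simp add: inner_add_left inner_add_right) (simp add: inner_vec_def sum_2)
qed

text \<open>Boxes determine the measure, and the preimage of a box is its image under the inverse
  map, again orthogonal, for which invariance of the Lebesgue measure is known.\<close>

lemma lborel_orthogonal:
  assumes T: "orthogonal_transformation (T :: real ^ 2 \<Rightarrow> real ^ 2)"
  shows "lborel = distr lborel borel T"
proof (rule lborel_eqI)
  have m: "T \<in> borel_measurable borel"
    using orthogonal_transformation_linear[OF T] linear_conv_bounded_linear
    by (intro borel_measurable_continuous_onI linear_continuous_on) blast
  obtain U where U: "orthogonal_transformation U" "\<And>x. U (T x) = x" "\<And>x. T (U x) = x"
    using T orthogonal_transformation_bij orthogonal_transformation_inv
    by (metis bij_inv_eq_iff)
  fix l u :: "real ^ 2" assume le: "\<And>b. b \<in> Basis \<Longrightarrow> l \<bullet> b \<le> u \<bullet> b"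
  have pre: "T -` box l u = U ` box l u" using U by (auto simp: image_iff) metis+
  have bx: "box l u \<in> lmeasurable" by simp
  have b: "T -` box l u \<in> sets borel" using measurable_sets[OF m, of "box l u"] by simp
  have "emeasure (distr lborel borel T) (box l u) = emeasure lebesgue (U ` box l u)"
    using m b by (subst emeasure_distr) (auto simp: pre)
  also have "\<dots> = measure lebesgue (U ` box l u)"
    using measurable_orthogonal_image[OF U(1) bx] by (simp add: emeasure_eq_measure2)
  also have "\<dots> = measure lebesgue (box l u)"
    using measure_orthogonal_image[OF U(1) bx] by simp
  also have "\<dots> = ennreal (\<Prod>b\<in>Basis. (u - l) \<bullet> b)"
    using le by (simp add: measure_lborel_box_eq)
  finally show "emeasure (distr lborel borel T) (box l u) = ennreal (\<Prod>b\<in>Basis. (u - l) \<bullet> b)" .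
qed simp

lemma lborel_frame:
  "(lborel :: (real ^ 2) measure) = distr (lborel \<Otimes>\<^sub>M lborel) borel (\<lambda>(a, b). a *\<^sub>R dirv t + b *\<^sub>R dirv (t + pi / 2))"
proof -
  have m2: "rot t \<in> borel_measurable borel"
    by (intro borel_measurable_continuous_onI linear_continuous_on)
       (simp add: linear_rot linear_conv_bounded_linear[symmetric])
  have "lborel = distr (distr (lborel \<Otimes>\<^sub>M lborel) borel (\<lambda>(a, b). vector [a, b])) borel (rot t)"
    using lborel_orthogonal[OF orthogonal_rot[of t]] lborel_vec2 by simp
  also have "\<dots> = distr (lborel \<Otimes>\<^sub>M lborel) borel (rot t \<circ> (\<lambda>(a, b). vector [a, b]))"
    using measurable_vector2 m2 by (intro distr_distr) auto
  also have "rot t \<circ> (\<lambda>(a, b). vector [a, b]) = (\<lambda>(a, b). a *\<^sub>R dirv t + b *\<^sub>R dirv (t + pi / 2))"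
    by (auto simp: fun_eq_iff rot_def)
  finally show ?thesis .
qed

section \<open>The parabolic chart and its exact intensity\<close>

definition angle_scale :: "real \<Rightarrow> real" where "angle_scale r = r powr (- 2 / 3)"

text \<open>The second identity fixes the exponent: at distance about \<open>2 * r\<close>, a region
  of relative height \<open>s\<^sup>2\<close> and angular width \<open>s\<close> has area of order
  \<open>r\<^sup>2 * s ^ 3\<close>, so it contains a number of points of order one.\<close>

lemma angle_scale: assumes "r > 0" shows "angle_scale r > 0" "angle_scale r ^ 3 * r\<^sup>2 = 1"
proof -
  show "angle_scale r > 0" using assms by (simp add: angle_scale_def)
  have "angle_scale r ^ 3 = r powr (- 2)" using assms by (simp add: angle_scale_def powr_power)
  also have "\<dots> = 1 / r\<^sup>2" using assms by (simp add: powr_minus divide_inverse)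
  finally show "angle_scale r ^ 3 * r\<^sup>2 = 1" using assms by simp
qed

text \<open>Coordinates in the frame of the direction \<open>dirv t\<close>. They are chosen such that \<open>2 * r < norm x\<close>
  becomes \<open>w\<^sup>2 < q\<close> exactly, and such that \<open>nearness x (dirv t)\<close> is a decreasing function of \<open>q\<close>
  alone. The rescaling by \<open>angle_scale r\<close> makes the intensity tend to \<open>2\<close>.\<close>

definition height_coord :: "real \<Rightarrow> real \<Rightarrow> real ^ 2 \<Rightarrow> real" where
  "height_coord r t x = ((x \<bullet> x)\<^sup>2 / (4 * (x \<bullet> dirv t)\<^sup>2 * r\<^sup>2) - 1) / (angle_scale r)\<^sup>2"

definition width_coord :: "real \<Rightarrow> real \<Rightarrow> real ^ 2 \<Rightarrow> real" where
  "width_coord r t x = (x \<bullet> dirv (t + pi / 2)) / (x \<bullet> dirv t) / angle_scale r"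

definition chart :: "real \<Rightarrow> real \<Rightarrow> (real \<times> real) set \<Rightarrow> (real ^ 2) set" where
  "chart r t E = {x. x \<bullet> dirv t > 0 \<and> (height_coord r t x, width_coord r t x) \<in> E}"

definition parabola :: "(real \<times> real) set" where "parabola = {(q, w). w\<^sup>2 < q}"

text \<open>This is the intensity seen through the chart exactly, for every \<open>r\<close>. Its
  density never exceeds the limit \<open>2\<close>, so upper estimates of masses carry no error;
  lower estimates need a bound on the width.\<close>

definition chart_measure :: "real \<Rightarrow> (real \<times> real) measure" where
  "chart_measure r = density lborel (\<lambda>z. ennreal (2 / (1 + (angle_scale r)\<^sup>2 * (snd z)\<^sup>2)\<^sup>2) * indicator parabola z)"

lemma parabola_borel [measurable]: "parabola \<in> sets borel"
proof -
  have "parabola = {z. (snd z)\<^sup>2 < fst z}" by (auto simp: parabola_def)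
  also have "\<dots> \<in> sets borel" by (intro borel_open open_Collect_less continuous_intros)
  finally show ?thesis .
qed

lemma chart_borel: assumes [measurable]: "E \<in> sets borel" shows "chart r t E \<in> sets borel"
proof -
  have [measurable]: "height_coord r t \<in> borel_measurable borel" "width_coord r t \<in> borel_measurable borel"
    unfolding height_coord_def width_coord_def by measurable
  have [measurable]: "(\<lambda>x. (height_coord r t x, width_coord r t x)) \<in> borel_measurable borel" by measurable
  show ?thesis unfolding chart_def by measurable
qed

lemma measurable_fst_borel [measurable]: "fst \<in> borel_measurable (borel :: (real \<times> real) measure)"
  and measurable_snd_borel [measurable]: "snd \<in> borel_measurable (borel :: (real \<times> real) measure)"
  by (auto intro!: borel_measurable_continuous_onI continuous_intros)

text \<open>Substitute first \<open>b = a s w\<close> for the transversal coordinate and then \<open>q\<close>, a quadratic polynomial in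
  the radial coordinate \<open>a\<close> for fixed \<open>w\<close>.\<close>

lemma emeasure_chart:
  assumes r: "r > 0" and E[measurable]: "E \<in> sets borel" and bd: "bounded E"
  shows "emeasure (density lborel (indicator (- cball 0 (2 * r)))) (chart r t E) = emeasure (chart_measure r) E"
proof -
  define s where "s = angle_scale r"
  have s: "s > 0" "s ^ 3 * r\<^sup>2 = 1" using angle_scale[OF r] by (auto simp: s_def)
  define g :: "real \<Rightarrow> real \<Rightarrow> ennreal" where "g q w = indicator (E \<inter> parabola) (q, w)" for q w
  have gm: "(\<lambda>z. g (fst z) (snd z)) \<in> borel_measurable (borel :: (real \<times> real) measure)"
    unfolding g_def prod.collapse by (intro borel_measurable_indicator) auto
  have gm': "case_prod g \<in> borel_measurable (borel \<Otimes>\<^sub>M borel)" using gm by (simp add: borel_prod split_beta')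
  have gc[measurable]: "(\<lambda>x. g (f x) (h x)) \<in> borel_measurable M" if "f \<in> borel_measurable M" "h \<in> borel_measurable M" for f h and M :: "'z measure"
    using measurable_compose[OF measurable_Pair[OF that] gm'] by simp
  obtain B where B: "B > 0" "\<And>z. z \<in> E \<Longrightarrow> norm z \<le> B" using bd by (auto simp: bounded_pos)
  have gB: "g q w = 0" if "q > B" for q w
  proof -
    have "(q, w) \<notin> E" using B(2)[of "(q, w)"] norm_fst_le[of q w] that by auto
    then show ?thesis by (simp add: g_def)
  qed
  have g0: "g q w = 0" if "q \<le> 0" for q w
  proof -
    have "(q, w) \<notin> parabola" using order_trans[OF that zero_le_power2[of w]] by (simp add: parabola_def not_less)
    then show ?thesis by (simp add: g_def)
  qed
  define Q where "Q a w = (a\<^sup>2 * (1 + s\<^sup>2 * w\<^sup>2)\<^sup>2 / (4 * r\<^sup>2) - 1) / s\<^sup>2" for a w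
  define cc where "cc w = 2 / (1 + s\<^sup>2 * w\<^sup>2)\<^sup>2" for w
  have [measurable]: "cc \<in> borel_measurable borel" unfolding cc_def by measurable
  define G where "G a b = (if a > 0 then g (((a\<^sup>2 + b\<^sup>2)\<^sup>2 / (4 * a\<^sup>2 * r\<^sup>2) - 1) / s\<^sup>2) (b / a / s) else 0)" for a b
  have Gm[measurable]: "case_prod G \<in> borel_measurable (lborel \<Otimes>\<^sub>M lborel)" unfolding G_def by measurable
  let ?f = "\<lambda>(a, b). a *\<^sub>R dirv t + b *\<^sub>R dirv (t + pi / 2)"
  have fm: "?f \<in> borel_measurable (lborel \<Otimes>\<^sub>M lborel)" by (simp add: split_beta')
  have orth: "dirv t \<bullet> dirv (t + pi / 2) = 0" "dirv (t + pi / 2) \<bullet> dirv t = 0" "dirv t \<bullet> dirv t = 1" "dirv (t + pi / 2) \<bullet> dirv (t + pi / 2) = 1"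
    by (simp_all add: inner_dirv_dirv)
  have ind: "indicator (- cball 0 (2 * r)) (?f (a, b)) * indicator (chart r t E) (?f (a, b)) = G a b" for a b
  proof (cases "a > 0")
    case True
    define x where "x = ?f (a, b)"
    have x: "x \<bullet> dirv t = a" "x \<bullet> dirv (t + pi / 2) = b" "x \<bullet> x = a\<^sup>2 + b\<^sup>2"
      using orth by (auto simp: x_def inner_add_left inner_add_right power2_eq_square)
    have q: "height_coord r t x = ((a\<^sup>2 + b\<^sup>2)\<^sup>2 / (4 * a\<^sup>2 * r\<^sup>2) - 1) / s\<^sup>2" "width_coord r t x = b / a / s"
      by (simp_all add: height_coord_def width_coord_def x s_def)
    have ab: "a\<^sup>2 + b\<^sup>2 > 0" using True by (simp add: add_pos_nonneg)
    have "x \<notin> cball 0 (2 * r) \<longleftrightarrow> (2 * r)\<^sup>2 < x \<bullet> x"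
      using r norm_ge_zero[of x] power2_less_imp_less[of "2 * r" "norm x"] power_strict_mono[of "2 * r" "norm x" 2]
      by (auto simp: dot_square_norm not_le)
    also have "\<dots> \<longleftrightarrow> 4 * r\<^sup>2 < a\<^sup>2 + b\<^sup>2" by (simp add: x power_mult_distrib)
    also have "\<dots> \<longleftrightarrow> (height_coord r t x, width_coord r t x) \<in> parabola"
    proof -
      have e1: "s\<^sup>2 * (b / a / s)\<^sup>2 = b\<^sup>2 / a\<^sup>2" using s by (simp add: power_divide power_mult_distrib)
      have "(b / a / s)\<^sup>2 < height_coord r t x \<longleftrightarrow> s\<^sup>2 * (b / a / s)\<^sup>2 < s\<^sup>2 * height_coord r t x" using s by simp
      also have "\<dots> \<longleftrightarrow> b\<^sup>2 / a\<^sup>2 + 1 < (a\<^sup>2 + b\<^sup>2)\<^sup>2 / (4 * a\<^sup>2 * r\<^sup>2)" using s unfolding e1 q by auto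
      also have "b\<^sup>2 / a\<^sup>2 + 1 = (a\<^sup>2 + b\<^sup>2) * (4 * r\<^sup>2) / (4 * a\<^sup>2 * r\<^sup>2)" using True r by (simp add: field_simps)
      also have "\<dots> < (a\<^sup>2 + b\<^sup>2)\<^sup>2 / (4 * a\<^sup>2 * r\<^sup>2) \<longleftrightarrow> (a\<^sup>2 + b\<^sup>2) * (4 * r\<^sup>2) < (a\<^sup>2 + b\<^sup>2)\<^sup>2"
      proof -
        have p0: "4 * a\<^sup>2 * r\<^sup>2 > 0" using True r by simp
        show ?thesis using p0 unfolding divide_less_cancel by (metis order.asym less_irrefl)
      qed
      also have "\<dots> \<longleftrightarrow> 4 * r\<^sup>2 < a\<^sup>2 + b\<^sup>2" using ab unfolding power2_eq_square[of "a\<^sup>2 + b\<^sup>2"] by simp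
      finally show ?thesis by (simp add: parabola_def q)
    qed
    finally have "x \<notin> cball 0 (2 * r) \<longleftrightarrow> (height_coord r t x, width_coord r t x) \<in> parabola" .
    then show ?thesis unfolding x_def[symmetric] G_def g_def using True
      by (auto simp: indicator_def chart_def x q)
  next
    case False
    then have "?f (a, b) \<notin> chart r t E" using orth by (simp add: chart_def inner_add_left)
    then show ?thesis using False by (simp add: G_def)
  qed
  have [measurable]: "chart r t E \<in> sets borel" by (rule chart_borel) fact
  have [measurable]: "- cball 0 (2 * r) \<in> sets (borel :: (real ^ 2) measure)" by (intro borel_comp borel_closed closed_cball)
  have "emeasure (density lborel (indicator (- cball 0 (2 * r)))) (chart r t E)
      = (\<integral>\<^sup>+x. indicator (- cball 0 (2 * r)) x * indicator (chart r t E) x \<partial>lborel)"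
    by (subst emeasure_density) (auto simp: chart_borel)
  also have "\<dots> = (\<integral>\<^sup>+z. indicator (- cball 0 (2 * r)) (?f z) * indicator (chart r t E) (?f z) \<partial>(lborel \<Otimes>\<^sub>M lborel))"
    by (subst lborel_frame[of t], subst nn_integral_distr[OF fm]) measurable
  also have "\<dots> = (\<integral>\<^sup>+z. case_prod G z \<partial>(lborel \<Otimes>\<^sub>M lborel))"
    using ind by (intro nn_integral_cong) (auto simp: split_beta')
  also have "\<dots> = (\<integral>\<^sup>+a. \<integral>\<^sup>+b. G a b \<partial>lborel \<partial>lborel)"
    by (subst lborel.nn_integral_fst[symmetric]) auto
  also have "\<dots> = (\<integral>\<^sup>+a. \<integral>\<^sup>+w. indicator {0<..} a * ennreal (a * s) * g (Q a w) w \<partial>lborel \<partial>lborel)"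
  proof (rule nn_integral_cong)
    fix a :: real
    show "(\<integral>\<^sup>+b. G a b \<partial>lborel) = (\<integral>\<^sup>+w. indicator {0<..} a * ennreal (a * s) * g (Q a w) w \<partial>lborel)"
    proof (cases "a > 0")
      case True
      have Gb: "G a \<in> borel_measurable borel" unfolding G_def by measurable
      have eq: "G a (0 + a * s * w) = g (Q a w) w" for w
      proof -
        have "(a\<^sup>2 + (a * s * w)\<^sup>2)\<^sup>2 / (4 * a\<^sup>2 * r\<^sup>2) = a\<^sup>2 * (1 + s\<^sup>2 * w\<^sup>2)\<^sup>2 / (4 * r\<^sup>2)"
          using True r by (simp add: power2_eq_square field_simps)
        then show ?thesis using True s by (simp add: G_def Q_def)
      qed
      have "(\<integral>\<^sup>+b. G a b \<partial>lborel) = ennreal \<bar>a * s\<bar> * (\<integral>\<^sup>+w. G a (0 + a * s * w) \<partial>lborel)"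
        using True s Gb by (intro nn_integral_real_affine) auto
      also have "\<dots> = (\<integral>\<^sup>+w. ennreal (a * s) * g (Q a w) w \<partial>lborel)"
        using True s unfolding eq by (subst nn_integral_cmult) (auto simp: Q_def)
      finally show ?thesis using True by simp
    qed (simp add: G_def)
  qed
  also have "\<dots> = (\<integral>\<^sup>+w. \<integral>\<^sup>+a. indicator {0<..} a * ennreal (a * s) * g (Q a w) w \<partial>lborel \<partial>lborel)"
    by (rule lborel_pair.Fubini'[symmetric]) (simp add: Q_def split_beta')
  also have "\<dots> = (\<integral>\<^sup>+w. \<integral>\<^sup>+q. ennreal (cc w) * g q w \<partial>lborel \<partial>lborel)"
  proof (rule nn_integral_cong)
    fix w :: real
    \<comment> \<open>From \<open>M\<close> on the height exceeds \<open>B\<close> and the integrand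
      vanishes, so the compact interval \<open>{0..M}\<close> required by the substitution rule
      carries the whole integral.\<close>
    define M where "M = 2 * r * (1 + s\<^sup>2 * B)"
    define d where "d = 1 + s\<^sup>2 * w\<^sup>2"
    have d: "d \<ge> 1" by (simp add: d_def)
    have M: "M > 0" using r B by (simp add: M_def add_pos_nonneg)
    have QM: "Q a w > B" if "a \<ge> M" for a
    proof -
      have sB: "s\<^sup>2 * B > 0" using s B by simp
      have "(1 + s\<^sup>2 * B) * 1 < (1 + s\<^sup>2 * B) * (1 + s\<^sup>2 * B)" using sB by (intro mult_strict_left_mono) auto
      then have "1 + s\<^sup>2 * B < (1 + s\<^sup>2 * B)\<^sup>2" by (simp add: power2_eq_square)
      also have "\<dots> = M\<^sup>2 / (4 * r\<^sup>2)" using r by (simp add: M_def power2_eq_square)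
      also have "\<dots> \<le> a\<^sup>2 / (4 * r\<^sup>2)" using that M by (intro divide_right_mono power_mono) auto
      also have "\<dots> = a\<^sup>2 * 1 / (4 * r\<^sup>2)" by simp
      also have "\<dots> \<le> a\<^sup>2 * d\<^sup>2 / (4 * r\<^sup>2)" using d by (intro divide_right_mono mult_left_mono) (auto simp: one_le_power)
      finally show ?thesis using s by (simp add: Q_def d_def field_simps)
    qed
    have der: "((\<lambda>a. Q a w) has_real_derivative (a * d\<^sup>2 / (2 * r\<^sup>2 * s\<^sup>2))) (at a)" for a
      unfolding Q_def d_def[symmetric] using r s by (auto intro!: derivative_eq_intros simp: field_simps power2_eq_square)
    have "(\<integral>\<^sup>+a. indicator {0<..} a * ennreal (a * s) * g (Q a w) w \<partial>lborel)
      = (\<integral>\<^sup>+a. ennreal (cc w) * (g (Q a w) w * ennreal (a * d\<^sup>2 / (2 * r\<^sup>2 * s\<^sup>2)) * indicator {0..M} a) \<partial>lborel)"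
    proof (rule nn_integral_cong)
      fix a :: real
      \<comment> \<open>Here \<open>s ^ 3 * r\<^sup>2 = 1\<close> enters: the factor
        \<open>a * s\<close> from the first substitution divided by the derivative of the height in
        \<open>a\<close> is the density \<open>cc w\<close>, free of \<open>a\<close> and
        \<open>r\<close>.\<close>
      have "cc w * (a * d\<^sup>2 / (2 * r\<^sup>2 * s\<^sup>2)) = a * s"
      proof -
        have "cc w * (a * d\<^sup>2 / (2 * r\<^sup>2 * s\<^sup>2)) = a / (r\<^sup>2 * s\<^sup>2)" using d by (simp add: cc_def d_def[symmetric])
        also have "\<dots> = a * s" using r s(1) arg_cong[OF s(2), of "\<lambda>y. a * y"]
          by (simp add: divide_eq_eq power2_eq_square power3_eq_cube mult_ac)
        finally show ?thesis .
      qed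
      moreover have "cc w \<ge> 0" by (simp add: cc_def)
      ultimately have e: "ennreal (cc w) * ennreal (a * d\<^sup>2 / (2 * r\<^sup>2 * s\<^sup>2)) = ennreal (a * s)" if "a \<ge> 0"
        using that by (simp add: ennreal_mult'[symmetric])
      consider "a < 0" | "a = 0" | "a > M" | "0 < a" "a \<le> M" by linarith
      then show "indicator {0<..} a * ennreal (a * s) * g (Q a w) w
        = ennreal (cc w) * (g (Q a w) w * ennreal (a * d\<^sup>2 / (2 * r\<^sup>2 * s\<^sup>2)) * indicator {0..M} a)"
      proof cases
        case 3 then show ?thesis using gB[OF QM[of a]] by simp
      next
        case 4
        then have "indicator {0<..} a = (1::ennreal)" "indicator {0..M} a = (1::ennreal)" by auto
        moreover have "ennreal (a * s) = ennreal (cc w) * ennreal (a * d\<^sup>2 / (2 * r\<^sup>2 * s\<^sup>2))" using e 4 by simp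
        ultimately show ?thesis by (simp only: mult_1_left mult_1_right mult_ac)
      qed (use M in auto)
    qed
    also have "\<dots> = ennreal (cc w) * (\<integral>\<^sup>+a. g (Q a w) w * ennreal (a * d\<^sup>2 / (2 * r\<^sup>2 * s\<^sup>2)) * indicator {0..M} a \<partial>lborel)"
      by (rule nn_integral_cmult) (simp add: Q_def)
    also have "(\<integral>\<^sup>+a. g (Q a w) w * ennreal (a * d\<^sup>2 / (2 * r\<^sup>2 * s\<^sup>2)) * indicator {0..M} a \<partial>lborel)
       = (\<integral>\<^sup>+q. g q w * indicator {Q 0 w..Q M w} q \<partial>lborel)"
      by (rule nn_integral_substitution_aux[symmetric, where g = "\<lambda>a. Q a w"])
         (use der M r s in \<open>auto intro!: continuous_intros\<close>)
    also have "\<dots> = (\<integral>\<^sup>+q. g q w \<partial>lborel)"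
    proof (rule nn_integral_cong)
      fix q
      have Q0: "Q 0 w \<le> 0" using s by (simp add: Q_def)
      show "g q w * indicator {Q 0 w..Q M w} q = g q w"
        using gB[of q w] g0[of q w] QM[of M] Q0 by (cases "q \<le> 0"; cases "q > B") (auto simp: indicator_def)
    qed
    also have "ennreal (cc w) * \<dots> = (\<integral>\<^sup>+q. ennreal (cc w) * g q w \<partial>lborel)"
      by (rule nn_integral_cmult[symmetric]) simp
    finally show "(\<integral>\<^sup>+a. indicator {0<..} a * ennreal (a * s) * g (Q a w) w \<partial>lborel) = (\<integral>\<^sup>+q. ennreal (cc w) * g q w \<partial>lborel)" .
  qed
  also have "\<dots> = (\<integral>\<^sup>+z. ennreal (cc (snd z)) * g (fst z) (snd z) \<partial>(lborel \<Otimes>\<^sub>M lborel))"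
    by (subst lborel_pair.nn_integral_snd[symmetric]) auto
  also have "\<dots> = (\<integral>\<^sup>+z. ennreal (cc (snd z)) * indicator parabola z * indicator E z \<partial>lborel)"
    unfolding lborel_prod by (intro nn_integral_cong) (auto simp: g_def indicator_def)
  also have "\<dots> = emeasure (chart_measure r) E"
    unfolding chart_measure_def cc_def s_def by (subst emeasure_density) auto
  finally show ?thesis .
qed

subsection \<open>Void probabilities\<close>

lemma dirv_add: "x \<bullet> dirv (t + d) = (x \<bullet> dirv t) * cos d + (x \<bullet> dirv (t + pi / 2)) * sin d"
  by (simp add: inner_dirv cos_add sin_add algebra_simps)

lemma inner_self_frame: "x \<bullet> x = (x \<bullet> dirv t)\<^sup>2 + (x \<bullet> dirv (t + pi / 2))\<^sup>2"
proof -
  have "(x \<bullet> dirv t)\<^sup>2 + (x \<bullet> dirv (t + pi / 2))\<^sup>2 = ((x $ 1)\<^sup>2 + (x $ 2)\<^sup>2) * ((cos t)\<^sup>2 + (sin t)\<^sup>2)"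
    unfolding inner_dirv cos_add sin_add cos_pi_half sin_pi_half by algebra
  then show ?thesis by (simp add: inner_vec_def sum_2 power2_eq_square)
qed

lemma one_plus_height_coord:
  assumes "r > 0" shows "1 + (angle_scale r)\<^sup>2 * height_coord r t x = (x \<bullet> x)\<^sup>2 / (4 * (x \<bullet> dirv t)\<^sup>2 * r\<^sup>2)"
  using angle_scale(1)[OF assms] by (simp add: height_coord_def)

lemma nearness_chart:
  assumes r: "r > 0" and a: "x \<bullet> dirv t > 0"
  shows "1 + (angle_scale r)\<^sup>2 * height_coord r t x > 0"
    and "nearness x (dirv t) = 1 / (2 * r * sqrt (1 + (angle_scale r)\<^sup>2 * height_coord r t x))"
proof -
  have x0: "x \<bullet> x > 0" using a by auto
  have eq: "1 + (angle_scale r)\<^sup>2 * height_coord r t x = ((x \<bullet> x) / (2 * (x \<bullet> dirv t) * r))\<^sup>2"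
    unfolding one_plus_height_coord[OF r] by (simp add: power_divide power_mult_distrib)
  show "1 + (angle_scale r)\<^sup>2 * height_coord r t x > 0" unfolding eq using x0 a r by simp
  have "sqrt (1 + (angle_scale r)\<^sup>2 * height_coord r t x) = (x \<bullet> x) / (2 * (x \<bullet> dirv t) * r)"
    unfolding eq real_sqrt_abs using x0 a r by simp
  then show "nearness x (dirv t) = 1 / (2 * r * sqrt (1 + (angle_scale r)\<^sup>2 * height_coord r t x))"
    using x0 a r by (simp add: nearness_def)
qed

lemma nearness_rotate:
  assumes r: "r > 0" and a: "x \<bullet> dirv t > 0"
  shows "nearness x (dirv (t + d)) = (cos d + angle_scale r * width_coord r t x * sin d) * nearness x (dirv t)"
  unfolding nearness_def dirv_add[of x t d] width_coord_def using a angle_scale(1)[OF r]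
  by (simp add: distrib_right distrib_left mult.commute add_divide_distrib)

lemma chart_Un: "chart r t (E \<union> E') = chart r t E \<union> chart r t E'"
  and chart_empty [simp]: "chart r t {} = {}"
  and chart_mono: "E \<subseteq> E' \<Longrightarrow> chart r t E \<subseteq> chart r t E'"
  by (auto simp: chart_def)

text \<open>A bound on the height suffices: it gives
  \<open>(x \<bullet> x)\<^sup>2 \<le> 4 * L * r\<^sup>2 * a\<^sup>2\<close>, and
  \<open>a\<^sup>2 \<le> x \<bullet> x\<close>.\<close>

lemma bounded_chart:
  assumes r: "r > 0" and E: "bounded E" shows "bounded (chart r t E)"
proof -
  obtain B where B: "B > 0" "\<And>z. z \<in> E \<Longrightarrow> norm z \<le> B" using E by (auto simp: bounded_pos)
  have s: "angle_scale r > 0" using angle_scale[OF r] by simp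
  define L where "L = 1 + (angle_scale r)\<^sup>2 * B"
  have L: "L > 0" using B s by (simp add: L_def add_pos_pos)
  have "x \<bullet> x \<le> 4 * L * r\<^sup>2" if x: "x \<in> chart r t E" for x
  proof -
    define a b where "a = x \<bullet> dirv t" and "b = x \<bullet> dirv (t + pi / 2)"
    have a: "a > 0" using x by (simp add: chart_def a_def)
    have xx: "x \<bullet> x = a\<^sup>2 + b\<^sup>2" using inner_self_frame[of x t] by (simp add: a_def b_def)
    have "height_coord r t x \<le> B" using x B(2)[of "(height_coord r t x, width_coord r t x)"] norm_fst_le[of "height_coord r t x" "width_coord r t x"] by (auto simp: chart_def)
    then have "(x \<bullet> x)\<^sup>2 / (4 * a\<^sup>2 * r\<^sup>2) \<le> L"
      unfolding L_def a_def one_plus_height_coord[OF r, symmetric] by (intro add_left_mono mult_left_mono) auto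
    then have "(x \<bullet> x)\<^sup>2 \<le> L * (4 * a\<^sup>2 * r\<^sup>2)" using a r by (simp add: field_simps)
    also have "\<dots> \<le> L * (4 * (x \<bullet> x) * r\<^sup>2)"
      using L xx by (intro mult_left_mono mult_right_mono) auto
    finally have "(x \<bullet> x) * (x \<bullet> x) \<le> (4 * L * r\<^sup>2) * (x \<bullet> x)" by (simp add: power2_eq_square mult_ac)
    moreover have "x \<bullet> x > 0" using a by (auto simp: a_def)
    ultimately show ?thesis by simp
  qed
  then have "norm x \<le> sqrt (4 * L * r\<^sup>2)" if "x \<in> chart r t E" for x
    using that by (simp add: norm_eq_sqrt_inner)
  then show ?thesis unfolding bounded_iff by blast
qed

definition chart_mass :: "real \<Rightarrow> (real \<times> real) set \<Rightarrow> real" where "chart_mass r E = measure (chart_measure r) E"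

lemma sets_chart_measure [simp, measurable_cong]: "sets (chart_measure r) = sets borel" by (simp add: chart_measure_def)

lemma emeasure_chart_measure_le: assumes [measurable]: "E \<in> sets borel" shows "emeasure (chart_measure r) E \<le> 2 * emeasure lborel E"
proof -
  have "emeasure (chart_measure r) E = (\<integral>\<^sup>+z. ennreal (2 / (1 + (angle_scale r)\<^sup>2 * (snd z)\<^sup>2)\<^sup>2) * indicator parabola z * indicator E z \<partial>lborel)"
    unfolding chart_measure_def by (subst emeasure_density) auto
  also have "\<dots> \<le> (\<integral>\<^sup>+z. 2 * indicator E z \<partial>lborel)"
  proof (intro nn_integral_mono)
    fix z :: "real \<times> real"
    have "1 \<le> (1 + (angle_scale r)\<^sup>2 * (snd z)\<^sup>2)\<^sup>2" by (simp add: one_le_power)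
    then have "2 / (1 + (angle_scale r)\<^sup>2 * (snd z)\<^sup>2)\<^sup>2 \<le> 2 / 1" by (intro divide_left_mono mult_pos_pos) linarith+
    then have "ennreal (2 / (1 + (angle_scale r)\<^sup>2 * (snd z)\<^sup>2)\<^sup>2) \<le> ennreal 2" by (intro ennreal_leI) simp
    then show "ennreal (2 / (1 + (angle_scale r)\<^sup>2 * (snd z)\<^sup>2)\<^sup>2) * indicator parabola z * indicator E z \<le> 2 * indicator E z"
      by (auto simp: indicator_def)
  qed
  also have "\<dots> = 2 * emeasure lborel E" by (simp add: nn_integral_cmult)
  finally show ?thesis .
qed

lemma chart_mass_finite: assumes "E \<in> sets borel" "bounded E" shows "emeasure (chart_measure r) E < \<infinity>"
proof -
  have "emeasure (chart_measure r) E \<le> 2 * emeasure lborel E" by (rule emeasure_chart_measure_le[OF assms(1)])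
  also have "\<dots> < \<infinity>" using emeasure_bounded_finite[OF assms(2)] by (simp add: ennreal_mult_less_top)
  finally show ?thesis .
qed

lemma chart_mass_le: assumes "E \<in> sets borel" "bounded E" shows "chart_mass r E \<le> 2 * measure lborel E"
proof -
  have f: "emeasure lborel E < \<infinity>" using emeasure_bounded_finite[OF assms(2)] .
  have "enn2real (emeasure (chart_measure r) E) \<le> enn2real (2 * emeasure lborel E)"
    using emeasure_chart_measure_le[OF assms(1)] f by (intro enn2real_mono) (auto simp: ennreal_mult_less_top)
  then show ?thesis by (simp add: chart_mass_def measure_def enn2real_mult)
qed

lemma chart_mass_ge:
  assumes E[measurable]: "E \<in> sets borel" and "bounded E" "E \<subseteq> parabola" and V: "\<And>q w. (q, w) \<in> E \<Longrightarrow> \<bar>w\<bar> \<le> V"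
  shows "chart_mass r E \<ge> 2 / (1 + (angle_scale r)\<^sup>2 * V\<^sup>2)\<^sup>2 * measure lborel E"
proof -
  let ?c = "2 / (1 + (angle_scale r)\<^sup>2 * V\<^sup>2)\<^sup>2"
  have "ennreal ?c * emeasure lborel E = (\<integral>\<^sup>+z. ennreal ?c * indicator E z \<partial>lborel)"
    by (simp add: nn_integral_cmult)
  also have "\<dots> \<le> (\<integral>\<^sup>+z. ennreal (2 / (1 + (angle_scale r)\<^sup>2 * (snd z)\<^sup>2)\<^sup>2) * indicator parabola z * indicator E z \<partial>lborel)"
  proof (intro nn_integral_mono)
    fix z :: "real \<times> real"
    show "ennreal ?c * indicator E z \<le> ennreal (2 / (1 + (angle_scale r)\<^sup>2 * (snd z)\<^sup>2)\<^sup>2) * indicator parabola z * indicator E z"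
    proof (cases "z \<in> E")
      case True
      then have "\<bar>snd z\<bar> \<le> V" using V[of "fst z" "snd z"] by simp
      then have "(snd z)\<^sup>2 \<le> V\<^sup>2" by (metis abs_ge_zero power2_abs power_mono)
      then have "(1 + (angle_scale r)\<^sup>2 * (snd z)\<^sup>2)\<^sup>2 \<le> (1 + (angle_scale r)\<^sup>2 * V\<^sup>2)\<^sup>2"
        using mult_left_mono[of "(snd z)\<^sup>2" "V\<^sup>2" "(angle_scale r)\<^sup>2"] by (intro power_mono) auto
      moreover have "0 < 1 + (angle_scale r)\<^sup>2 * (snd z)\<^sup>2" by (simp add: add_pos_nonneg)
      ultimately have "?c \<le> 2 / (1 + (angle_scale r)\<^sup>2 * (snd z)\<^sup>2)\<^sup>2"
        by (intro divide_left_mono mult_pos_pos) (auto intro: order_less_le_trans)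
      moreover have "z \<in> parabola" using True assms(3) by auto
      ultimately show ?thesis using True by (simp add: ennreal_leI)
    qed simp
  qed
  also have "\<dots> = emeasure (chart_measure r) E"
    unfolding chart_measure_def by (subst emeasure_density) auto
  finally have le: "ennreal ?c * emeasure lborel E \<le> emeasure (chart_measure r) E" .
  have "enn2real (ennreal ?c * emeasure lborel E) \<le> enn2real (emeasure (chart_measure r) E)"
    using le chart_mass_finite[OF assms(1,2)] by (intro enn2real_mono) auto
  then show ?thesis by (simp add: chart_mass_def measure_def enn2real_mult)
qed

lemma chart_mass_nonneg [simp]: "chart_mass r E \<ge> 0" by (simp add: chart_mass_def)

lemma chart_mass_mono: assumes "E \<subseteq> E'" "E \<in> sets borel" "E' \<in> sets borel" "bounded E'" shows "chart_mass r E \<le> chart_mass r E'"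
  unfolding chart_mass_def
  by (rule measure_mono_fmeasurable) (use assms chart_mass_finite[OF assms(3,4)] in \<open>auto intro!: fmeasurableI\<close>)

lemma chart_mass_subadd:
  assumes "E \<in> sets borel" "E' \<in> sets borel" "bounded E" "bounded E'"
  shows "chart_mass r (E \<union> E') \<le> chart_mass r E + chart_mass r E'"
  unfolding chart_mass_def
  by (rule measure_Un_le) (use assms in auto)

lemma chart_mass_Un:
  assumes "E \<in> sets borel" "E' \<in> sets borel" "bounded E" "bounded E'" "E \<inter> E' = {}"
  shows "chart_mass r (E \<union> E') = chart_mass r E + chart_mass r E'"
  unfolding chart_mass_def
  using chart_mass_finite[of E r] chart_mass_finite[of E' r] assms by (intro measure_Union) auto

locale poisson_outside =
  fixes M :: "'w measure" and r :: real and \<Phi> :: "'w \<Rightarrow> (real ^ 2) set"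
  assumes r: "r > 0"
    and P: "poisson_process M (density lborel (indicator (- cball 0 (2 * r)))) \<Phi>"
begin

sublocale prob_space M using P by (simp add: poisson_process_def)

abbreviation "\<mu> \<equiv> density lborel (indicator (- cball 0 (2 * r))) :: (real ^ 2) measure"

definition void where "void A = {\<omega> \<in> space M. \<Phi> \<omega> \<inter> A = {}}"

lemma locally_finite: "\<omega> \<in> space M \<Longrightarrow> locally_finite_set (\<Phi> \<omega>)"
proof -
  assume w: "\<omega> \<in> space M"
  have Phi: "\<Phi> \<in> measurable M config_space" using P by (simp add: poisson_process_def)
  have "space (config_space :: (real ^ 2) set measure) = {S. locally_finite_set S}"
    unfolding config_space_def by (rule space_measure_of) auto
  then show ?thesis using measurable_space[OF Phi w] by auto
qed

lemma finite_points: "\<omega> \<in> space M \<Longrightarrow> bounded A \<Longrightarrow> finite (\<Phi> \<omega> \<inter> A)"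
  using locally_finite by (auto simp: locally_finite_set_def)

lemma count_event:
  assumes A: "A \<in> sets borel" "bounded A" shows "{\<omega> \<in> space M. card (\<Phi> \<omega> \<inter> A) = k} \<in> events"
proof -
  have Phi: "\<Phi> \<in> measurable M config_space" using P by (simp add: poisson_process_def)
  have "{S. locally_finite_set S \<and> card (S \<inter> A) = k} \<in> sets config_space"
    unfolding config_space_def by (rule in_measure_of) (use A in auto)
  from measurable_sets[OF Phi this] show ?thesis
    by (rule back_subst[of "\<lambda>x. x \<in> events"]) (use locally_finite in auto)
qed

lemma count_prob:
  assumes A: "A \<in> sets borel" "bounded A"
  shows "prob {\<omega> \<in> space M. card (\<Phi> \<omega> \<inter> A) = k} = exp (- measure \<mu> A) * measure \<mu> A ^ k / fact k"
  using P A unfolding poisson_process_def by blast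

lemma void_count: "bounded A \<Longrightarrow> void A = {\<omega> \<in> space M. card (\<Phi> \<omega> \<inter> A) = 0}"
  using finite_points by (auto simp: void_def)

lemma void_event [measurable]: "A \<in> sets borel \<Longrightarrow> bounded A \<Longrightarrow> void A \<in> events"
  using count_event[of A 0] by (simp add: void_count)

lemma void_prob: "A \<in> sets borel \<Longrightarrow> bounded A \<Longrightarrow> prob (void A) = exp (- measure \<mu> A)"
  using count_prob[of A 0] by (simp add: void_count)

lemma void_Un: "void (A \<union> B) = void A \<inter> void B" by (auto simp: void_def)

lemma measure_chart: "E \<in> sets borel \<Longrightarrow> bounded E \<Longrightarrow> measure \<mu> (chart r t E) = chart_mass r E"
  using emeasure_chart[OF r, of E t] by (simp add: measure_def chart_mass_def)

lemma void_chart_event: "E \<in> sets borel \<Longrightarrow> bounded E \<Longrightarrow> void (chart r t E) \<in> events"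
  by (intro void_event chart_borel bounded_chart r)

lemma void_chart_prob: "E \<in> sets borel \<Longrightarrow> bounded E \<Longrightarrow> prob (void (chart r t E)) = exp (- chart_mass r E)"
  using void_prob[OF chart_borel bounded_chart[OF r]] measure_chart by simp

lemma two_points_event: "A \<in> sets borel \<Longrightarrow> bounded A \<Longrightarrow> {\<omega> \<in> space M. card (\<Phi> \<omega> \<inter> A) \<ge> 2} \<in> events"
proof -
  assume A: "A \<in> sets borel" "bounded A"
  have "{\<omega> \<in> space M. card (\<Phi> \<omega> \<inter> A) \<ge> 2} = space M - {\<omega> \<in> space M. card (\<Phi> \<omega> \<inter> A) = 0} - {\<omega> \<in> space M. card (\<Phi> \<omega> \<inter> A) = 1}"
    by auto
  then show ?thesis using count_event[OF A] by auto
qed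

lemma two_points_prob:
  assumes A: "A \<in> sets borel" "bounded A"
  shows "prob {\<omega> \<in> space M. card (\<Phi> \<omega> \<inter> A) \<ge> 2} \<le> (measure \<mu> A)\<^sup>2"
proof -
  let ?m = "measure \<mu> A"
  let ?E = "\<lambda>k. {\<omega> \<in> space M. card (\<Phi> \<omega> \<inter> A) = k}"
  have "{\<omega> \<in> space M. card (\<Phi> \<omega> \<inter> A) \<ge> 2} = space M - (?E 0 \<union> ?E 1)" by auto
  then have "prob {\<omega> \<in> space M. card (\<Phi> \<omega> \<inter> A) \<ge> 2} = 1 - prob (?E 0 \<union> ?E 1)"
    using count_event[OF A] prob_compl[of "?E 0 \<union> ?E 1"] by auto
  also have "prob (?E 0 \<union> ?E 1) = prob (?E 0) + prob (?E 1)"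
    using count_event[OF A] by (intro finite_measure_Union) auto
  also have "\<dots> = exp (- ?m) * (1 + ?m)" by (simp only: count_prob[OF A]) (simp add: algebra_simps)
  also have "1 - exp (- ?m) * (1 + ?m) \<le> 1 - (1 - ?m) * (1 + ?m)"
    using exp_ge_add_one_self[of "- ?m"] by (intro diff_left_mono mult_right_mono) auto
  finally show ?thesis by (simp add: power2_eq_square algebra_simps)
qed

text \<open>A difference of two void probabilities. Subadditivity of the mass takes the place of
  additivity, so \<open>D\<close> and \<open>Q\<close> may overlap.\<close>

lemma cell_prob2:
  assumes D: "D \<in> sets borel" "bounded D" and Q: "Q \<in> sets borel" "bounded Q"
  shows "prob (void (chart r t D) - void (chart r t Q)) \<le> exp (- chart_mass r D) * chart_mass r Q"
proof -
  have ev: "void (chart r t D) \<in> events" "void (chart r t Q) \<in> events" "void (chart r t (D \<union> Q)) \<in> events"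
    using D Q by (auto intro!: void_chart_event)
  have "void (chart r t D) - void (chart r t Q) = void (chart r t D) - void (chart r t (D \<union> Q))"
    by (auto simp: chart_Un void_Un)
  then have "prob (void (chart r t D) - void (chart r t Q)) = prob (void (chart r t D)) - prob (void (chart r t (D \<union> Q)))"
    using ev by (auto simp: chart_Un void_Un intro!: finite_measure_Diff)
  also have "\<dots> = exp (- chart_mass r D) - exp (- chart_mass r (D \<union> Q))"
    using D Q by (simp add: void_chart_prob)
  also have "\<dots> \<le> exp (- chart_mass r D) - exp (- (chart_mass r D + chart_mass r Q))"
    using chart_mass_subadd[OF D(1) Q(1) D(2) Q(2), of r] by auto
  also have "\<dots> = exp (- chart_mass r D) * (1 - exp (- chart_mass r Q))" by (simp add: exp_add[symmetric] algebra_simps)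
  also have "\<dots> \<le> exp (- chart_mass r D) * chart_mass r Q"
    using exp_ge_add_one_self[of "- chart_mass r Q"] by (intro mult_left_mono) auto
  finally show ?thesis .
qed

text \<open>The finite counterpart of the Mecke formula for a pair of points. Inclusion-exclusion
  over void events factors the probability into
  \<open>exp (- D) * (1 - exp (- Q)) * (1 - exp (- W))\<close>, written with masses, and each
  occupied set contributes at most its mass.\<close>

lemma cell_prob3:
  assumes D: "D \<in> sets borel" "bounded D" and Q: "Q \<in> sets borel" "bounded Q"
    and W: "W \<in> sets borel" "bounded W"
    and disj: "D \<inter> Q = {}" "D \<inter> W = {}" "Q \<inter> W = {}"
  shows "prob (void (chart r t D) - void (chart r t Q) - void (chart r t W)) \<le> exp (- chart_mass r D) * chart_mass r Q * chart_mass r W"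
proof -
  let ?v = "\<lambda>E. void (chart r t E)"
  have ev: "?v D \<in> events" "?v Q \<in> events" "?v W \<in> events"
    using D Q W by (auto intro!: void_chart_event)
  have DQW: "D \<union> Q \<in> sets borel" "D \<union> W \<in> sets borel" "D \<union> Q \<union> W \<in> sets borel"
     "bounded (D \<union> Q)" "bounded (D \<union> W)" "bounded (D \<union> Q \<union> W)" using D Q W by auto
  have "?v D - ?v Q - ?v W = ?v D - (?v (D \<union> Q) \<union> ?v (D \<union> W))" by (auto simp: chart_Un void_Un)
  then have "prob (?v D - ?v Q - ?v W) = prob (?v D) - prob (?v (D \<union> Q) \<union> ?v (D \<union> W))"
    using ev by (auto simp: chart_Un void_Un intro!: finite_measure_Diff)
  also have "prob (?v (D \<union> Q) \<union> ?v (D \<union> W)) = prob (?v (D \<union> Q)) + prob (?v (D \<union> W)) - prob (?v (D \<union> Q) \<inter> ?v (D \<union> W))"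
    using ev by (intro measure_Un3) (auto simp: chart_Un void_Un fmeasurable_eq_sets)
  also have "?v (D \<union> Q) \<inter> ?v (D \<union> W) = ?v (D \<union> Q \<union> W)" by (auto simp: chart_Un void_Un)
  also have "prob (?v D) - (prob (?v (D \<union> Q)) + prob (?v (D \<union> W)) - prob (?v (D \<union> Q \<union> W)))
    = exp (- chart_mass r D) * (1 - exp (- chart_mass r Q)) * (1 - exp (- chart_mass r W))"
  proof -
    have k: "chart_mass r (D \<union> Q) = chart_mass r D + chart_mass r Q" "chart_mass r (D \<union> W) = chart_mass r D + chart_mass r W"
      "chart_mass r (D \<union> Q \<union> W) = chart_mass r D + chart_mass r Q + chart_mass r W"
      using D Q W disj by (auto simp: chart_mass_Un Int_Un_distrib2)
    show ?thesis using D Q W DQW by (simp only: void_chart_prob k) (simp add: exp_add exp_minus exp_diff field_simps)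
  qed
  also have "\<dots> \<le> exp (- chart_mass r D) * chart_mass r Q * chart_mass r W"
    using exp_ge_add_one_self[of "- chart_mass r Q"] exp_ge_add_one_self[of "- chart_mass r W"]
    by (intro mult_mono) auto
  finally show ?thesis .
qed

lemma AE_outside: "AE \<omega> in M. \<forall>x\<in>\<Phi> \<omega>. 2 * r < norm x"
proof -
  have "measure \<mu> (cball 0 (2 * r) :: (real ^ 2) set) = 0"
  proof -
    have "(\<integral>\<^sup>+x. indicator (- cball 0 (2 * r)) x * indicator (cball 0 (2 * r)) x \<partial>(lborel :: (real ^ 2) measure)) = (\<integral>\<^sup>+x. 0 \<partial>(lborel :: (real ^ 2) measure))"
      by (intro nn_integral_cong) (auto simp: indicator_def)
    then show ?thesis by (simp add: measure_def emeasure_density)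
  qed
  then have "prob (void (cball 0 (2 * r))) = 1" using void_prob[of "cball 0 (2 * r)"] by simp
  then have "AE \<omega> in M. \<omega> \<in> void (cball 0 (2 * r))"
    using prob_Collect_eq_1[of "\<lambda>\<omega>. \<omega> \<in> void (cball 0 (2 * r))"] void_event[of "cball 0 (2 * r)"]
    by (simp add: AE_prob_1)
  then show ?thesis by (auto elim!: eventually_mono simp: void_def disjoint_iff)
qed

end

subsection \<open>Areas and cells\<close>

lemma emeasure_slices:
  assumes A: "A \<in> sets (borel :: (real \<times> real) measure)"
  shows "emeasure lborel A = (\<integral>\<^sup>+w. emeasure lborel {q. (q, w) \<in> A} \<partial>lborel)"
proof -
  have A': "A \<in> sets (lborel \<Otimes>\<^sub>M lborel)" using A by (metis lborel_prod sets_lborel)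
  have "emeasure lborel A = emeasure (lborel \<Otimes>\<^sub>M lborel) A" by (simp add: lborel_prod)
  also have "\<dots> = (\<integral>\<^sup>+w. emeasure lborel ((\<lambda>q. (q, w)) -` A) \<partial>lborel)"
    by (rule lborel_pair.emeasure_pair_measure_alt2[OF A'])
  finally show ?thesis by (simp add: vimage_def)
qed

lemma area_le:
  fixes f g F :: "real \<Rightarrow> real"
  assumes A: "A \<in> sets borel" "A \<subseteq> {(q, w). a \<le> w \<and> w \<le> b \<and> f w \<le> q \<and> q \<le> g w}" and ab: "a \<le> b"
    and m: "(\<lambda>w. g w - f w) \<in> borel_measurable borel"
    and le: "\<And>w. a \<le> w \<Longrightarrow> w \<le> b \<Longrightarrow> f w \<le> g w"
    and F: "\<And>w. a \<le> w \<Longrightarrow> w \<le> b \<Longrightarrow> (F has_real_derivative (g w - f w)) (at w)"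
  shows "measure lborel A \<le> F b - F a"
proof -
  have "emeasure lborel A \<le> (\<integral>\<^sup>+w. ennreal (g w - f w) * indicator {a..b} w \<partial>lborel)"
    unfolding emeasure_slices[OF A(1)]
  proof (rule nn_integral_mono)
    fix w
    show "emeasure lborel {q. (q, w) \<in> A} \<le> ennreal (g w - f w) * indicator {a..b} w"
    proof (cases "w \<in> {a..b}")
      case True
      have "emeasure lborel {q. (q, w) \<in> A} \<le> emeasure lborel {f w..g w}"
        using A(2) by (intro emeasure_mono) auto
      then show ?thesis using True le[of w] by simp
    next
      case False
      then have "{q. (q, w) \<in> A} = {}" using A(2) by auto
      then show ?thesis by simp
    qed
  qed
  also have "\<dots> = ennreal (F b - F a)"
    by (rule nn_integral_FTC_Icc) (use m F le ab in auto)
  finally have "emeasure lborel A \<le> ennreal (F b - F a)" .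
  moreover have "F b - F a \<ge> 0"
    using DERIV_nonneg_imp_nondecreasing[OF ab, of F] F le by fastforce
  ultimately show ?thesis by (simp add: measure_def enn2real_leI)
qed

lemma area_ge:
  fixes f g F :: "real \<Rightarrow> real"
  assumes A: "A \<in> sets borel" "{(q, w). a \<le> w \<and> w < b \<and> f w < q \<and> q < g w} \<subseteq> A" "bounded A" and ab: "a \<le> b"
    and m: "(\<lambda>w. g w - f w) \<in> borel_measurable borel"
    and le: "\<And>w. a \<le> w \<Longrightarrow> w \<le> b \<Longrightarrow> f w \<le> g w"
    and F: "\<And>w. a \<le> w \<Longrightarrow> w \<le> b \<Longrightarrow> (F has_real_derivative (g w - f w)) (at w)"
  shows "F b - F a \<le> measure lborel A"
proof -
  have "ennreal (F b - F a) = (\<integral>\<^sup>+w. ennreal (g w - f w) * indicator {a..b} w \<partial>lborel)"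
    by (rule nn_integral_FTC_Icc[symmetric]) (use m F le ab in auto)
  also have "\<dots> \<le> (\<integral>\<^sup>+w. emeasure lborel {q. (q, w) \<in> A} \<partial>lborel)"
  proof (rule nn_integral_mono_AE)
    have sec: "{q. (q, w) \<in> A} \<in> sets lborel" for w
    proof -
      have "A \<in> sets (borel \<Otimes>\<^sub>M borel)" using A(1) by (metis borel_prod)
      from sets_Pair2[OF this, of w] show ?thesis by (simp add: vimage_def)
    qed
    have "AE w in lborel. w \<noteq> b" by (rule AE_lborel_singleton)
    then show "AE w in lborel. ennreal (g w - f w) * indicator {a..b} w \<le> emeasure lborel {q. (q, w) \<in> A}"
    proof eventually_elim
      case (elim w)
      show ?case
      proof (cases "w \<in> {a..b}")
        case True
        then have "emeasure lborel {f w<..<g w} \<le> emeasure lborel {q. (q, w) \<in> A}"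
          using A(2) elim sec by (intro emeasure_mono) auto
        then show ?thesis using True le[of w] by simp
      qed simp
    qed
  qed
  also have "\<dots> = emeasure lborel A" using emeasure_slices[OF A(1)] by simp
  finally have "ennreal (F b - F a) \<le> emeasure lborel A" .
  moreover have "emeasure lborel A < \<infinity>" using emeasure_bounded_finite[OF A(3)] .
  ultimately show ?thesis
    by (metis emeasure_eq_ennreal_measure ennreal_le_iff infinity_ennreal_def measure_nonneg order_less_irrefl)
qed

section \<open>Caps of the parabola\<close>

definition below :: "real \<Rightarrow> (real \<times> real) set" where "below T = parabola \<inter> {z. fst z < T}"

lemma below_iff: "(q, w) \<in> below T \<longleftrightarrow> w\<^sup>2 < q \<and> q < T" by (auto simp: below_def parabola_def)

lemma below_borel [measurable]: "below T \<in> sets borel"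
proof -
  have "{z :: real \<times> real. fst z < T} \<in> sets borel"
    by (intro borel_open open_Collect_less continuous_intros)
  then show ?thesis unfolding below_def by simp
qed

lemma below_w: assumes "(q, w) \<in> below T" shows "\<bar>w\<bar> < sqrt q" "sqrt q < sqrt T" "0 < q" "q < T"
proof -
  have a: "w\<^sup>2 < q" "q < T" using assms by (auto simp: below_iff)
  show "\<bar>w\<bar> < sqrt q" using a by (simp add: real_less_rsqrt)
  show "sqrt q < sqrt T" "q < T" using a by auto
  show "0 < q" using a by (meson order_le_less_trans zero_le_power2)
qed

lemma below_bounded: "bounded (below T)"
proof -
  have "below T \<subseteq> cbox (0, - sqrt T) (T, sqrt T)"
  proof (rule subsetI, rule prod.exhaust)
    fix z q w assume "z \<in> below T" and z: "z = (q, w)"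
    then have "(q, w) \<in> below T" by simp
    from below_w[OF this] have "\<bar>w\<bar> \<le> sqrt T" "0 \<le> q" "q \<le> T" by linarith+
    then show "z \<in> cbox (0, - sqrt T) (T, sqrt T)" unfolding z by (auto simp: cbox_Pair_eq)
  qed
  then show ?thesis using bounded_cbox bounded_subset by blast
qed

lemma bounded_below_subset: "E \<subseteq> below T \<Longrightarrow> bounded E"
  using below_bounded bounded_subset by blast

lemma below_mono: "q \<le> q' \<Longrightarrow> below q \<subseteq> below q'" by (auto simp: below_def)

lemma area_below_ge:
  assumes q: "q \<ge> 0" and V: "0 \<le> V" "V \<le> sqrt q" and E: "E = {z \<in> below q. \<bar>snd z\<bar> < V}"
  shows "2 * V * q - 2 / 3 * V ^ 3 \<le> measure lborel E" "E \<in> sets borel"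
proof -
  show Eb: "E \<in> sets borel"
  proof -
    have "{z :: real \<times> real. \<bar>snd z\<bar> < V} \<in> sets borel"
      by (intro borel_open open_Collect_less continuous_intros)
    moreover have "E = below q \<inter> {z. \<bar>snd z\<bar> < V}" by (auto simp: E)
    ultimately show ?thesis by simp
  qed
  have VV: "w\<^sup>2 \<le> q" if "\<bar>w\<bar> \<le> V" for w :: real
  proof -
    have "\<bar>w\<bar>\<^sup>2 \<le> (sqrt q)\<^sup>2" using that V by (intro power_mono) auto
    then show ?thesis using q by simp
  qed
  define F :: "real \<Rightarrow> real" where "F w = q * w - w ^ 3 / 3" for w
  have sub: "{(q', w). - V \<le> w \<and> w < V \<and> w\<^sup>2 < q' \<and> q' < q} - {z. snd z = - V} \<subseteq> E"
    by (auto simp: E below_iff)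
  \<comment> \<open>\<open>area_ge\<close> includes the left end \<open>w = - V\<close>, which
    \<open>E\<close> omits; a segment of measure zero is added and subtracted again.\<close>
  define E' where "E' = E \<union> {z. snd z = - V \<and> 0 \<le> fst z \<and> fst z \<le> q}"
  have line: "{z::real\<times>real. snd z = - V \<and> 0 \<le> fst z \<and> fst z \<le> q} = cbox (0, -V) (q, -V)"
    by (auto simp: cbox_Pair_eq)
  have "F V - F (- V) \<le> measure lborel E'"
  proof (rule area_ge[where f = "\<lambda>w. w\<^sup>2" and g = "\<lambda>w. q" and F = F and a = "- V" and b = V])
    show "E' \<in> sets borel" unfolding E'_def line using Eb by simp
    show "{(q', w). - V \<le> w \<and> w < V \<and> w\<^sup>2 < q' \<and> q' < q} \<subseteq> E'"
      using sub order_le_less_trans[OF zero_le_power2] by (fastforce simp: E'_def)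
    show "bounded E'" unfolding E'_def line using bounded_below_subset[of E q] by (auto simp: E)
  qed (use V in \<open>auto simp: F_def[abs_def] VV intro!: derivative_eq_intros\<close>)
  also have "measure lborel E' \<le> measure lborel E + measure lborel (cbox (0, -V) (q, -V))"
    unfolding E'_def line using Eb by (intro measure_Un_le) auto
  also have "measure lborel (cbox (0::real, -V) (q, -V)) = 0"
    using q by (simp add: measure_lborel_cbox_eq Basis_prod_def)
  finally show "2 * V * q - 2 / 3 * V ^ 3 \<le> measure lborel E" by (simp add: F_def power3_eq_cube)
qed

definition cap_mass :: "real \<Rightarrow> real \<Rightarrow> real" where "cap_mass r q = chart_mass r (below q)"

text \<open>The area \<open>4 / 3 * (q * sqrt q)\<close> of the parabolic segment times the least
  density on it, since widths stay below \<open>sqrt q\<close>. For fixed \<open>q\<close> the bound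
  becomes sharp as \<open>angle_scale r\<close> tends to \<open>0\<close>.\<close>

lemma cap_mass_ge:
  assumes q: "q \<ge> 0" shows "8 / 3 * (q * sqrt q) / (1 + (angle_scale r)\<^sup>2 * q)\<^sup>2 \<le> cap_mass r q"
proof -
  define E where "E = {z \<in> below q. \<bar>snd z\<bar> < sqrt q}"
  have bw: "\<bar>w\<bar> < sqrt q" if "(q', w) \<in> below q" for q' w using below_w(1,2)[OF that] by linarith
  then have EE: "E = below q" by (auto simp: E_def)
  have "2 * sqrt q * q - 2 / 3 * sqrt q ^ 3 \<le> measure lborel E"
    by (rule area_below_ge(1)) (use q E_def in auto)
  then have a: "4 / 3 * (q * sqrt q) \<le> measure lborel (below q)" using q by (simp add: EE power3_eq_cube)
  have "2 / (1 + (angle_scale r)\<^sup>2 * (sqrt q)\<^sup>2)\<^sup>2 * measure lborel (below q) \<le> cap_mass r q"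
    unfolding cap_mass_def
    by (rule chart_mass_ge) (use below_bounded bw in \<open>auto simp: below_def intro: less_imp_le\<close>)
  then have "2 / (1 + (angle_scale r)\<^sup>2 * q)\<^sup>2 * measure lborel (below q) \<le> cap_mass r q" using q by simp
  moreover have "2 / (1 + (angle_scale r)\<^sup>2 * q)\<^sup>2 * (4 / 3 * (q * sqrt q)) \<le> 2 / (1 + (angle_scale r)\<^sup>2 * q)\<^sup>2 * measure lborel (below q)"
    by (intro mult_left_mono a) auto
  ultimately show ?thesis by simp
qed

lemma cap_mass_nonneg: "cap_mass r q \<ge> 0" by (simp add: cap_mass_def)

text \<open>\<open>cap_mass_ge\<close> degenerates when \<open>q\<close> is large compared with the
  inverse square of \<open>angle_scale r\<close>, so it yields no majorant uniform in
  \<open>r\<close>. The strip of widths below \<open>1\<close> has density at least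
  \<open>1 / 2\<close> and area at least \<open>2 * q - 2 / 3\<close>, which gives linear growth of
  the mass; the additive \<open>2 / 3\<close> makes the claim trivial for
  \<open>q < 1\<close>.\<close>

lemma cap_mass_tail:
  assumes r: "r \<ge> 1" and q: "q \<ge> 0" shows "exp (- cap_mass r q) \<le> exp (2 / 3 - 2 / 3 * q)"
proof (cases "q \<ge> 1")
  case True
  have s: "0 < angle_scale r" "angle_scale r \<le> 1" using r powr_mono[of "- 2 / 3" 0 r] by (auto simp: angle_scale_def)
  define E where "E = {z \<in> below q. \<bar>snd z\<bar> < 1}"
  have E: "2 * 1 * q - 2 / 3 * 1 ^ 3 \<le> measure lborel E" "E \<in> sets borel"
    using area_below_ge[of q 1 E] True E_def by auto
  have Eb: "bounded E" by (rule bounded_below_subset[of _ q]) (auto simp: E_def)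
  have "2 / (1 + (angle_scale r)\<^sup>2 * 1\<^sup>2)\<^sup>2 * measure lborel E \<le> chart_mass r E"
    by (rule chart_mass_ge) (use E Eb in \<open>auto simp: E_def below_def\<close>)
  also have "\<dots> \<le> cap_mass r q" unfolding cap_mass_def
    by (rule chart_mass_mono) (use E below_bounded in \<open>auto simp: E_def\<close>)
  finally have "2 / (1 + (angle_scale r)\<^sup>2)\<^sup>2 * measure lborel E \<le> cap_mass r q" by simp
  moreover have "1 / 2 \<le> 2 / (1 + (angle_scale r)\<^sup>2)\<^sup>2"
  proof -
    have "(angle_scale r)\<^sup>2 \<le> 1" using s by (simp add: power_le_one)
    then have "(1 + (angle_scale r)\<^sup>2)\<^sup>2 \<le> 2\<^sup>2" by (intro power_mono) auto
    moreover have "0 < 1 + (angle_scale r)\<^sup>2" by (simp add: add_pos_nonneg)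
    ultimately show ?thesis by (simp add: field_simps)
  qed
  then have "1 / 2 * measure lborel E \<le> 2 / (1 + (angle_scale r)\<^sup>2)\<^sup>2 * measure lborel E"
    by (intro mult_right_mono) auto
  ultimately have "1 / 2 * (2 * q - 2 / 3) \<le> cap_mass r q" using E(1) by simp
  then have "2 / 3 * q \<le> cap_mass r q" using True by simp
  then show ?thesis by simp
next
  case False
  then have "exp (- cap_mass r q) \<le> 1" "1 \<le> exp (2 / 3 - 2 / 3 * q)" using cap_mass_nonneg[of r q] by auto
  then show ?thesis by linarith
qed

text \<open>The location of the lowest point is recorded only up to one of these squares of side
  \<open>h\<close>; this discretisation makes it expressible by void events.\<close>

definition cell :: "real \<Rightarrow> real \<Rightarrow> int \<times> int \<Rightarrow> (real \<times> real) set" where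
  "cell h T c = {z \<in> below T. \<lfloor>fst z / h\<rfloor> = fst c \<and> \<lfloor>snd z / h\<rfloor> = snd c}"

definition cell_index :: "real \<Rightarrow> real \<Rightarrow> (int \<times> int) set" where
  "cell_index h T = {0..\<lfloor>T / h\<rfloor>} \<times> {\<lfloor>- sqrt T / h\<rfloor>..\<lfloor>sqrt T / h\<rfloor>}"

lemma finite_cell_index [simp]: "finite (cell_index h T)" by (simp add: cell_index_def)

lemma cell_borel [measurable]: "cell h T c \<in> sets borel"
proof -
  have "cell h T c = below T \<inter> {z. \<lfloor>fst z / h\<rfloor> = fst c} \<inter> {z. \<lfloor>snd z / h\<rfloor> = snd c}"
    by (auto simp: cell_def)
  also have "\<dots> \<in> sets borel"
  proof (intro sets.Int below_borel)
    show "{z :: real \<times> real. \<lfloor>fst z / h\<rfloor> = fst c} \<in> sets borel" "{z :: real \<times> real. \<lfloor>snd z / h\<rfloor> = snd c} \<in> sets borel"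
      by measurable
  qed
  finally show ?thesis .
qed

lemma cell_below: "cell h T c \<subseteq> below T" by (auto simp: cell_def)

lemma cell_bounded: "bounded (cell h T c)" using bounded_below_subset[OF cell_below] .

lemma cell_bounds:
  assumes h: "h > 0" and z: "(q, w) \<in> cell h T (i, j)"
  shows "i * h \<le> q" "q < i * h + h" "j * h \<le> w" "w < j * h + h"
proof -
  have "real_of_int i \<le> q / h" "q / h < i + 1" "real_of_int j \<le> w / h" "w / h < j + 1"
    using z by (auto simp: cell_def)
  then show "i * h \<le> q" "q < i * h + h" "j * h \<le> w" "w < j * h + h"
    using h by (auto simp: field_simps)
qed

lemma in_cell:
  assumes h: "h > 0" and z: "z \<in> below T" shows "\<exists>c\<in>cell_index h T. z \<in> cell h T c"
proof
  obtain q w where qw: "z = (q, w)" by (cases z)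
  have b: "- sqrt T \<le> w" "w \<le> sqrt T" "0 \<le> q" "q \<le> T" using below_w[OF z[unfolded qw]] by linarith+
  show "z \<in> cell h T (\<lfloor>fst z / h\<rfloor>, \<lfloor>snd z / h\<rfloor>)" using z by (simp add: cell_def)
  have "0 \<le> q / h" "q / h \<le> T / h" "- sqrt T / h \<le> w / h" "w / h \<le> sqrt T / h"
    using h by (intro divide_nonneg_pos divide_right_mono b; simp)+
  then have "\<lfloor>q / h\<rfloor> \<le> \<lfloor>T / h\<rfloor>" "\<lfloor>- sqrt T / h\<rfloor> \<le> \<lfloor>w / h\<rfloor>" "\<lfloor>w / h\<rfloor> \<le> \<lfloor>sqrt T / h\<rfloor>" "0 \<le> \<lfloor>q / h\<rfloor>"
    by (auto intro: floor_mono)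
  then show "(\<lfloor>fst z / h\<rfloor>, \<lfloor>snd z / h\<rfloor>) \<in> cell_index h T" by (simp add: cell_index_def qw)
qed

text \<open>A step function that stays below \<open>f\<close> on every square integrates to at most
  the integral of \<open>f\<close>. The factor \<open>2\<close> is the bound on the chart density,
  which turns masses into areas.\<close>

lemma cell_sum_le:
  assumes f: "integrable lborel (\<lambda>z. f z * indicator (below T) z)"
    and c0: "\<And>c. 0 \<le> k c"
    and kf: "\<And>c z. z \<in> cell h T c \<Longrightarrow> k c \<le> f z"
    and f0: "\<And>z. z \<in> below T \<Longrightarrow> 0 \<le> f z"
  shows "(\<Sum>c\<in>cell_index h T. k c * chart_mass r (cell h T c)) \<le> 2 * (\<integral>z. f z * indicator (below T) z \<partial>lborel)"
proof -
  have fin: "emeasure lborel (cell h T c) < \<infinity>" for c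
    using emeasure_bounded_finite[OF cell_bounded] .
  have "(\<Sum>c\<in>cell_index h T. k c * chart_mass r (cell h T c)) \<le> (\<Sum>c\<in>cell_index h T. k c * (2 * measure lborel (cell h T c)))"
    by (intro sum_mono mult_left_mono chart_mass_le c0) (auto simp: cell_bounded)
  also have "\<dots> = 2 * (\<Sum>c\<in>cell_index h T. k c * measure lborel (cell h T c))"
    by (simp add: sum_distrib_left mult_ac)
  also have "(\<Sum>c\<in>cell_index h T. k c * measure lborel (cell h T c)) = (\<integral>z. (\<Sum>c\<in>cell_index h T. k c * indicator (cell h T c) z) \<partial>lborel)"
    using fin by (subst Bochner_Integration.integral_sum) auto
  also have "\<dots> \<le> (\<integral>z. f z * indicator (below T) z \<partial>lborel)"
  proof (rule integral_mono)
    show "integrable lborel (\<lambda>z. \<Sum>c\<in>cell_index h T. k c * indicator (cell h T c) z)"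
      using fin by (intro Bochner_Integration.integrable_sum integrable_mult_right integrable_real_indicator) auto
    fix z
    show "(\<Sum>c\<in>cell_index h T. k c * indicator (cell h T c) z) \<le> f z * indicator (below T) z"
    proof (cases "\<exists>c\<in>cell_index h T. z \<in> cell h T c")
      case True
      then obtain c where c: "c \<in> cell_index h T" "z \<in> cell h T c" by auto
      have "(\<Sum>c'\<in>cell_index h T. k c' * indicator (cell h T c') z) = (\<Sum>c'\<in>{c}. k c' * indicator (cell h T c') z)"
        using c by (intro sum.mono_neutral_right) (auto simp: cell_def indicator_def prod_eq_iff)
      also have "\<dots> \<le> f z" using c kf by simp
      finally show ?thesis using c cell_below by fastforce
    next
      case False
      then have "(\<Sum>c\<in>cell_index h T. k c * indicator (cell h T c) z) = 0" by (intro sum.neutral) auto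
      then show ?thesis using f0[of z] by (auto simp: indicator_def)
    qed
  qed (fact f)
  finally show ?thesis by simp
qed

text \<open>Squaring \<open>better\<close> bounds \<open>1 + s\<^sup>2 * q'\<close> by
  \<open>1 + s\<^sup>2 * q\<close> times the square of \<open>(1 + y') / (1 + y)\<close>, where
  \<open>y\<close> and \<open>y'\<close> have modulus at most \<open>m \<le> 1 / 2\<close>. To first
  order this square is \<open>1 + 2 * (y' - y)\<close>, and \<open>y' - y\<close> is
  \<open>s\<^sup>2 * \<sigma> * (w' - w)\<close>.\<close>

lemma tilt_upper:
  fixes s \<sigma> q q' w w' T :: real
  assumes T: "0 \<le> T" "\<bar>w\<bar> \<le> sqrt T" "\<bar>w'\<bar> \<le> sqrt T" and q: "0 \<le> q" "0 \<le> q'" and \<sigma>: "0 \<le> \<sigma>" and s: "s > 0"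
    and small: "s\<^sup>2 * \<sigma> * sqrt T \<le> 1 / 2"
    and better: "sqrt (1 + s\<^sup>2 * q') * (1 + s\<^sup>2 * \<sigma> * w) \<le> sqrt (1 + s\<^sup>2 * q) * (1 + s\<^sup>2 * \<sigma> * w')"
  shows "q' \<le> q + (1 + s\<^sup>2 * q) * (2 * \<sigma> * (w' - w) + 40 * s\<^sup>2 * \<sigma>\<^sup>2 * T)"
proof -
  define m y y' where "m = s\<^sup>2 * \<sigma> * sqrt T" and "y = s\<^sup>2 * \<sigma> * w" and "y' = s\<^sup>2 * \<sigma> * w'"
  have m: "0 \<le> m" "m \<le> 1 / 2" using small \<sigma> T by (auto simp: m_def)
  have s\<sigma>: "0 \<le> s\<^sup>2 * \<sigma>" using \<sigma> by simp
  have y: "\<bar>y\<bar> \<le> m" "\<bar>y'\<bar> \<le> m"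
    using T mult_left_mono[OF T(2) s\<sigma>] mult_left_mono[OF T(3) s\<sigma>] s\<sigma>
\<sigma>
    by (auto simp: y_def y'_def m_def abs_mult)
  have p: "1 + y \<ge> 1 / 2" "1 + y' \<ge> 1 / 2" using y m by linarith+
  have b: "(sqrt (1 + s\<^sup>2 * q') * (1 + y))\<^sup>2 \<le> (sqrt (1 + s\<^sup>2 * q) * (1 + y'))\<^sup>2"
    using better p q by (intro power_mono) (auto simp: y_def y'_def)
  then have b: "(1 + s\<^sup>2 * q') * (1 + y)\<^sup>2 \<le> (1 + s\<^sup>2 * q) * (1 + y')\<^sup>2"
    using q by (simp add: power_mult_distrib)
  define e where "e = y' - y"
  have e: "\<bar>e\<bar> \<le> 2 * m" using y by (auto simp: e_def)
  \<comment> \<open>The quadratic remainder is at most \<open>10 * m\<^sup>2\<close>; since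
    \<open>(1 + y)\<^sup>2 \<ge> 1 / 4\<close>, factoring this square out quadruples the
    constant.\<close>
  have "(1 + y')\<^sup>2 \<le> (1 + 2 * e + 40 * m\<^sup>2) * (1 + y)\<^sup>2"
  proof -
    have "(1 + y')\<^sup>2 = (1 + y)\<^sup>2 + 2 * e * (1 + y) + e\<^sup>2" by (simp add: e_def power2_eq_square algebra_simps)
    also have "2 * e * (1 + y) = 2 * e * (1 + y)\<^sup>2 - 2 * (e * y) * (1 + y)" by (simp add: power2_eq_square algebra_simps)
    finally have eq: "(1 + y')\<^sup>2 = (1 + 2 * e) * (1 + y)\<^sup>2 - 2 * (e * y) * (1 + y) + e\<^sup>2" by (simp add: algebra_simps)
    have ey: "\<bar>e * y\<bar> \<le> 2 * m * m" unfolding abs_mult by (rule mult_mono) (use e y m in auto)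
    have "- 2 * (e * y) * (1 + y) \<le> 2 * (2 * m * m) * (3 / 2)"
    proof -
      have "- 2 * (e * y) * (1 + y) \<le> (2 * \<bar>e * y\<bar>) * (1 + y)" using p by (intro mult_right_mono) auto
      also have "\<dots> \<le> (2 * (2 * m * m)) * (3 / 2)" using ey y m p by (intro mult_mono) auto
      finally show ?thesis by simp
    qed
    moreover have "e\<^sup>2 \<le> 4 * m\<^sup>2" using power_mono[OF e, of 2] by (simp add: power_mult_distrib)
    ultimately have "(1 + y')\<^sup>2 \<le> (1 + 2 * e) * (1 + y)\<^sup>2 + 10 * m\<^sup>2" using eq by (simp add: power2_eq_square)
    moreover have "10 * m\<^sup>2 \<le> 40 * m\<^sup>2 * (1 + y)\<^sup>2"
    proof -
      have "(1 / 2)\<^sup>2 \<le> (1 + y)\<^sup>2" using p by (intro power_mono) auto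
      then have "40 * m\<^sup>2 * (1 / 2)\<^sup>2 \<le> 40 * m\<^sup>2 * (1 + y)\<^sup>2" by (intro mult_left_mono) auto
      then show ?thesis by (simp add: power2_eq_square)
    qed
    ultimately show ?thesis by (simp add: distrib_right)
  qed
  then have "(1 + s\<^sup>2 * q) * (1 + y')\<^sup>2 \<le> (1 + s\<^sup>2 * q) * ((1 + 2 * e + 40 * m\<^sup>2) * (1 + y)\<^sup>2)"
    using q by (intro mult_left_mono) auto
  with b have "(1 + s\<^sup>2 * q') * (1 + y)\<^sup>2 \<le> ((1 + s\<^sup>2 * q) * (1 + 2 * e + 40 * m\<^sup>2)) * (1 + y)\<^sup>2" by (simp add: mult_ac)
  moreover have "(1 + y)\<^sup>2 > 0" using p by simp
  ultimately have "1 + s\<^sup>2 * q' \<le> (1 + s\<^sup>2 * q) * (1 + 2 * e + 40 * m\<^sup>2)" by simp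
  then have "s\<^sup>2 * q' \<le> s\<^sup>2 * q + (1 + s\<^sup>2 * q) * (2 * e + 40 * m\<^sup>2)" by (simp add: algebra_simps)
  also have "2 * e + 40 * m\<^sup>2 = s\<^sup>2 * (2 * \<sigma> * (w' - w) + 40 * s\<^sup>2 * \<sigma>\<^sup>2 * T)"
    using T(1) by (simp add: e_def y_def y'_def m_def power2_eq_square algebra_simps)
  finally have "s\<^sup>2 * q' \<le> s\<^sup>2 * (q + (1 + s\<^sup>2 * q) * (2 * \<sigma> * (w' - w) + 40 * s\<^sup>2 * \<sigma>\<^sup>2 * T))"
    by (simp add: algebra_simps)
  then show ?thesis using s by simp
qed

subsection \<open>Change of the nearest point: upper bound\<close>

lemma chart_parabola_iff:
  assumes r: "r > 0" and a: "x \<bullet> dirv t > 0"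
  shows "(height_coord r t x, width_coord r t x) \<in> parabola \<longleftrightarrow> 2 * r < norm x"
proof -
  define s A b where "s = angle_scale r" and "A = x \<bullet> dirv t" and "b = x \<bullet> dirv (t + pi / 2)"
  have s: "s > 0" using angle_scale(1)[OF r] by (simp add: s_def)
  have xx: "x \<bullet> x = A\<^sup>2 + b\<^sup>2" using inner_self_frame[of x t] by (simp add: A_def b_def)
  have x0: "x \<bullet> x > 0" using a by auto
  have A: "A > 0" using a by (simp add: A_def)
  have e: "s\<^sup>2 * (width_coord r t x)\<^sup>2 = (x \<bullet> x) / A\<^sup>2 - 1"
  proof -
    have "width_coord r t x = b / A / s" by (simp only: width_coord_def A_def b_def s_def)
    then have "s * width_coord r t x = b / A" using s by simp
    then have "s\<^sup>2 * (width_coord r t x)\<^sup>2 = (b / A)\<^sup>2" by (simp flip: power_mult_distrib)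
    also have "\<dots> = (x \<bullet> x) / A\<^sup>2 - 1" using A by (simp add: xx power_divide field_simps)
    finally show ?thesis .
  qed
  have "(width_coord r t x)\<^sup>2 < height_coord r t x \<longleftrightarrow> s\<^sup>2 * (width_coord r t x)\<^sup>2 < s\<^sup>2 * height_coord r t x" using s by simp
  also have "s\<^sup>2 * height_coord r t x = (x \<bullet> x)\<^sup>2 / (4 * A\<^sup>2 * r\<^sup>2) - 1" using one_plus_height_coord[OF r, of t x] by (simp add: s_def A_def)
  also have "s\<^sup>2 * (width_coord r t x)\<^sup>2 < \<dots> \<longleftrightarrow> (x \<bullet> x) / A\<^sup>2 < (x \<bullet> x)\<^sup>2 / (4 * A\<^sup>2 * r\<^sup>2)" unfolding e by simp
  also have "\<dots> \<longleftrightarrow> (x \<bullet> x) * (4 * r\<^sup>2) < (x \<bullet> x) * (x \<bullet> x)"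
    using A r by (simp add: divide_simps power2_eq_square mult_ac)
  also have "\<dots> \<longleftrightarrow> 4 * r\<^sup>2 < x \<bullet> x" using x0 by (simp only: mult_less_cancel_left_pos)
  also have "\<dots> \<longleftrightarrow> (2 * r)\<^sup>2 < (norm x)\<^sup>2" by (simp add: power_mult_distrib dot_square_norm)
  also have "\<dots> \<longleftrightarrow> 2 * r < norm x"
    using r norm_ge_zero[of x] power2_less_imp_less[of "2 * r" "norm x"] power_strict_mono[of "2 * r" "norm x" 2] by auto
  finally show ?thesis by (simp add: parabola_def)
qed

lemma cap_mass_mono: "q \<le> q' \<Longrightarrow> cap_mass r q \<le> cap_mass r q'"
  unfolding cap_mass_def by (intro chart_mass_mono below_mono below_borel below_bounded)

lemma cap_mass_measurable [measurable]: "cap_mass r \<in> borel_measurable borel"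
  by (intro borel_measurable_mono monoI cap_mass_mono)

text \<open>The layer between the two heights lies over an interval of length
  \<open>2 * sqrt T\<close> and has density at most \<open>2\<close>.\<close>

lemma cap_mass_increment:
  assumes "q \<le> q'" "0 \<le> T" "q' \<le> T" shows "cap_mass r q' \<le> cap_mass r q + 4 * sqrt T * (q' - q)"
proof -
  define E where "E = below q' - below q"
  have E: "E \<in> sets borel" "bounded E" using below_bounded[of q'] by (auto simp: E_def intro: bounded_subset)
  have "below q' = below q \<union> E" using below_mono[OF assms(1)] by (auto simp: E_def)
  then have "cap_mass r q' \<le> cap_mass r q + chart_mass r E"
    unfolding cap_mass_def using chart_mass_subadd[of "below q" E r] E below_bounded by auto
  also have "chart_mass r E \<le> 2 * measure lborel E" by (rule chart_mass_le[OF E])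
  also have "measure lborel E \<le> (\<lambda>w. (q' - q) * w) (sqrt T) - (\<lambda>w. (q' - q) * w) (- sqrt T)"
  proof (rule area_le[where f = "\<lambda>w. q" and g = "\<lambda>w. q'" and F = "\<lambda>w. (q' - q) * w"])
    show "E \<subseteq> {(qa, w). - sqrt T \<le> w \<and> w \<le> sqrt T \<and> q \<le> qa \<and> qa \<le> q'}"
    proof (rule subsetI)
      fix z assume z: "z \<in> E"
      obtain a w where zz: "z = (a, w)" by (cases z)
      have aw: "(a, w) \<in> below q'" "\<not> (a, w) \<in> below q" using z by (auto simp: E_def zz)
      have "\<bar>w\<bar> < sqrt T" using below_w[OF aw(1)] assms(3) by (meson le_less_trans less_le_trans less_imp_le real_sqrt_le_mono order_less_trans)
      then show "z \<in> {(qa, w). - sqrt T \<le> w \<and> w \<le> sqrt T \<and> q \<le> qa \<and> qa \<le> q'}"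
        using aw by (auto simp: zz below_iff)
    qed
  qed (use E assms in \<open>auto intro!: derivative_eq_intros\<close>)
  finally show ?thesis by (simp add: algebra_simps)
qed

text \<open>The rate of change per unit of \<open>\<sigma>\<close>, given a lowest point
  \<open>(q, w)\<close>. With \<open>s\<close> for \<open>angle_scale r\<close>, the wedge is a
  triangle of slope \<open>2 * \<sigma> * (1 + s\<^sup>2 * q)\<close> over an interval of length
  about \<open>sqrt q - w\<close>, and the intensity doubles its area; the exponential is the
  probability that nothing lies below. The intensity of the lowest point itself enters as the factor
  \<open>2\<close> of \<open>upper_rate\<close>.\<close>

definition upper_integrand :: "real \<Rightarrow> real \<times> real \<Rightarrow> real" where
  "upper_integrand r z = 2 * (1 + (angle_scale r)\<^sup>2 * fst z) * (sqrt (fst z) - snd z)\<^sup>2 * exp (- cap_mass r (fst z))"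

lemma below_gap: assumes "(q, w) \<in> below T" shows "0 \<le> sqrt q - w" "sqrt q - w \<le> 2 * sqrt T" "(sqrt q - w)\<^sup>2 \<le> 4 * T" "T > 0"
proof -
  note b = below_w[OF assms]
  show g: "0 \<le> sqrt q - w" "sqrt q - w \<le> 2 * sqrt T" using b(1,2) by linarith+
  show "T > 0" using b by linarith
  then show "(sqrt q - w)\<^sup>2 \<le> 4 * T" using power_mono[OF g(2,1), of 2] by (simp add: power_mult_distrib)
qed

lemma upper_integrand_bound: assumes "z \<in> below T" shows "0 \<le> upper_integrand r z" "upper_integrand r z \<le> 8 * (1 + (angle_scale r)\<^sup>2 * T) * T"
proof -
  obtain q w where z: "z = (q, w)" by (cases z)
  note b = below_w[OF assms[unfolded z]] and g = below_gap[OF assms[unfolded z]]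
  have sq: "(angle_scale r)\<^sup>2 * q \<ge> 0" using b by simp
  show "0 \<le> upper_integrand r z" using sq by (simp add: upper_integrand_def z)
  have "upper_integrand r z \<le> 2 * (1 + (angle_scale r)\<^sup>2 * T) * (4 * T) * 1"
    unfolding upper_integrand_def z fst_conv snd_conv
    using b g sq cap_mass_nonneg[of r q] by (intro mult_mono add_left_mono mult_left_mono) auto
  then show "upper_integrand r z \<le> 8 * (1 + (angle_scale r)\<^sup>2 * T) * T" by (simp add: algebra_simps)
qed

lemma upper_integrand_integrable: "integrable lborel (\<lambda>z. upper_integrand r z * indicator (below T) z)"
proof (rule Bochner_Integration.integrable_bound[where f = "\<lambda>z. (8 * (1 + (angle_scale r)\<^sup>2 * T) * T) * indicator (below T) z"])
  show "integrable lborel (\<lambda>z::real \<times> real. (8 * (1 + (angle_scale r)\<^sup>2 * T) * T) * indicator (below T) z)"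
    by (intro integrable_mult_right integrable_real_indicator) (use emeasure_bounded_finite[OF below_bounded] in auto)
  show "(\<lambda>z. upper_integrand r z * indicator (below T) z) \<in> borel_measurable lborel" unfolding upper_integrand_def by measurable
  show "AE z in lborel. norm (upper_integrand r z * indicator (below T) z) \<le> norm ((8 * (1 + (angle_scale r)\<^sup>2 * T) * T) * indicator (below T) z)"
  proof (rule AE_I2)
    fix z
    show "norm (upper_integrand r z * indicator (below T) z) \<le> norm ((8 * (1 + (angle_scale r)\<^sup>2 * T) * T) * indicator (below T) z)"
    proof (cases "z \<in> below T")
      case True
      show ?thesis using upper_integrand_bound[OF True, of r] True by auto
    qed simp
  qed
qed

lemma exp_diff_bound: assumes "0 \<le> a" "a \<le> b" shows "exp (- a) \<le> exp (- b) + (b - a :: real)"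
proof -
  have "exp (- b) = exp (- a) * exp (- (b - a))" by (simp add: exp_add[symmetric])
  moreover have "exp (- (b - a)) \<ge> 1 - (b - a)" using exp_ge_add_one_self[of "- (b - a)"] by linarith
  then have "exp (- a) * exp (- (b - a)) \<ge> exp (- a) * (1 - (b - a))" by (intro mult_left_mono) auto
  moreover have "exp (- a) * (b - a) \<le> 1 * (b - a)" using assms by (intro mult_right_mono) auto
  ultimately show ?thesis by (simp add: algebra_simps)
qed

text \<open>With \<open>\<kappa>\<close> of the order of the angle, this contains the points that can replace a nearest point close
  to \<open>(qc, wc)\<close> when the direction is turned; \<open>\<eta>\<close> absorbs the errors of second order.\<close>

definition wedge :: "real \<Rightarrow> real \<Rightarrow> real \<Rightarrow> real \<Rightarrow> real \<Rightarrow> (real \<times> real) set" where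
  "wedge T qc wc \<kappa> \<eta> = {z \<in> below T. qc \<le> fst z \<and> fst z \<le> qc + \<kappa> * max 0 (snd z - wc) + \<eta>}"

lemma wedge_borel [measurable]: "wedge T qc wc \<kappa> \<eta> \<in> sets borel"
proof -
  have "wedge T qc wc \<kappa> \<eta> = below T \<inter> {z. qc \<le> fst z} \<inter> {z. fst z \<le> qc + \<kappa> * max 0 (snd z - wc) + \<eta>}"
    by (auto simp: wedge_def)
  moreover have "{z :: real \<times> real. qc \<le> fst z} \<in> sets borel" "{z :: real \<times> real. fst z \<le> qc + \<kappa> * max 0 (snd z - wc) + \<eta>} \<in> sets borel"
    by (intro borel_closed closed_Collect_le continuous_intros)+
  ultimately show ?thesis by auto
qed

lemma wedge_below: "wedge T qc wc \<kappa> \<eta> \<subseteq> below T" by (auto simp: wedge_def)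

text \<open>To the right of \<open>wc\<close> lies a triangle of base \<open>R - wc\<close> and
  slope \<open>\<kappa>\<close>, and over the whole width \<open>2 * R\<close> a layer of height
  \<open>\<eta>\<close>.\<close>

lemma wedge_area:
  assumes \<kappa>: "\<kappa> \<ge> 0" and \<eta>: "\<eta> \<ge> 0" and R: "\<bar>wc\<bar> \<le> R"
    and wR: "\<And>q w. (q, w) \<in> wedge T qc wc \<kappa> \<eta> \<Longrightarrow> \<bar>w\<bar> \<le> R"
  shows "measure lborel (wedge T qc wc \<kappa> \<eta>) \<le> \<kappa> * (R - wc)\<^sup>2 / 2 + 2 * R * \<eta>"
proof -
  let ?W = "wedge T qc wc \<kappa> \<eta>"
  define W1 W2 where "W1 = ?W \<inter> {z. snd z \<le> wc}" and "W2 = ?W \<inter> {z. wc \<le> snd z}"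
  have "{z :: real \<times> real. snd z \<le> wc} \<in> sets borel" "{z :: real \<times> real. wc \<le> snd z} \<in> sets borel"
    by (intro borel_closed closed_Collect_le continuous_intros)+
  then have b: "W1 \<in> sets borel" "W2 \<in> sets borel" by (auto simp: W1_def W2_def)
  have un: "?W = W1 \<union> W2" by (auto simp: W1_def W2_def)
  have "measure lborel ?W \<le> measure lborel W1 + measure lborel W2"
    unfolding un using b by (intro measure_Un_le) auto
  also have "measure lborel W1 \<le> (\<lambda>w. \<eta> * w) wc - (\<lambda>w. \<eta> * w) (- R)"
  proof (rule area_le[where f = "\<lambda>w. qc" and g = "\<lambda>w. qc + \<eta>" and F = "\<lambda>w. \<eta> * w"])
    show "W1 \<subseteq> {(q, w). - R \<le> w \<and> w \<le> wc \<and> qc \<le> q \<and> q \<le> qc + \<eta>}"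
      using wR by (fastforce simp: W1_def wedge_def abs_le_iff)
  qed (use b R \<eta> in \<open>auto intro!: derivative_eq_intros\<close>)
  also have "measure lborel W2 \<le> (\<lambda>w. \<kappa> * (w - wc)\<^sup>2 / 2 + \<eta> * w) R - (\<lambda>w. \<kappa> * (w - wc)\<^sup>2 / 2 + \<eta> * w) wc"
  proof (rule area_le[where f = "\<lambda>w. qc" and g = "\<lambda>w. qc + \<kappa> * (w - wc) + \<eta>" and F = "\<lambda>w. \<kappa> * (w - wc)\<^sup>2 / 2 + \<eta> * w"])
    show "W2 \<subseteq> {(q, w). wc \<le> w \<and> w \<le> R \<and> qc \<le> q \<and> q \<le> qc + \<kappa> * (w - wc) + \<eta>}"
      using wR by (fastforce simp: W2_def wedge_def abs_le_iff)
  qed (use b R \<eta> \<kappa> in \<open>auto intro!: derivative_eq_intros simp: power2_eq_square\<close>)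
  finally show ?thesis by (simp add: algebra_simps)
qed

context poisson_outside
begin

abbreviation "s \<equiv> angle_scale r"

text \<open>The last conjunct compares the nearness of \<open>x\<close> and \<open>y\<close> in the
  direction turned by an angle \<open>d\<close> with \<open>tan d / s = \<sigma>\<close>, after
  clearing denominators and common factors.\<close>

definition tilted :: "real \<Rightarrow> real \<Rightarrow> real \<Rightarrow> real ^ 2 \<Rightarrow> real ^ 2 \<Rightarrow> bool" where
  "tilted t \<sigma> T x y \<longleftrightarrow> x \<bullet> dirv t > 0 \<and> y \<bullet> dirv t > 0 \<and> height_coord r t x < T \<and> height_coord r t y < T \<and> height_coord r t x \<le> height_coord r t y \<and>
     sqrt (1 + s\<^sup>2 * height_coord r t y) * (1 + s\<^sup>2 * \<sigma> * width_coord r t x) \<le> sqrt (1 + s\<^sup>2 * height_coord r t x) * (1 + s\<^sup>2 * \<sigma> * width_coord r t y)"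

definition upper_rate :: "real \<Rightarrow> real" where
  "upper_rate T = 2 * (\<integral>z. upper_integrand r z * indicator (below T) z \<partial>lborel)"

text \<open>If the nearest point \<open>x\<close> is replaced by \<open>y\<close>, then the cell of \<open>x\<close> is occupied, nothing lies below it,
  and either its wedge or the cell itself contains a second point. The mesh \<open>\<sigma>\<^sup>2\<close> makes the second
  alternative negligible.\<close>

lemma frame_upper:
  assumes T: "T > 0"
  shows "\<exists>C\<ge>0. \<exists>\<sigma>0>0. \<forall>\<sigma>. 0 < \<sigma> \<longrightarrow> \<sigma> \<le> \<sigma>0 \<longrightarrow> (\<forall>t. \<exists>G\<in>events. prob G \<le> \<sigma> * upper_rate T + C * (\<sigma> * sqrt \<sigma>) \<and>
    (\<forall>\<omega>\<in>space M. (\<forall>z\<in>\<Phi> \<omega>. 2 * r < norm z) \<longrightarrow>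
      (\<exists>x\<in>\<Phi> \<omega>. \<exists>y\<in>\<Phi> \<omega>. x \<noteq> y \<and> (\<forall>z\<in>\<Phi> \<omega>. z \<bullet> dirv t > 0 \<longrightarrow> height_coord r t x \<le> height_coord r t z) \<and> tilted t \<sigma> T x y) \<longrightarrow> \<omega> \<in> G))"
proof -
  have s: "s > 0" using angle_scale[OF r] by simp
  define L where "L = 1 + s\<^sup>2 * T"
  define P where "P = 2 * sqrt T + 1"
  define C1 where "C1 = 1 + 2 * s\<^sup>2 * P + 40 * L * s\<^sup>2 * T"
  define C2 where "C2 = 2 * L * P + C1"
  define c3 where "c3 = sqrt C2 + 3"
  define C4 where "C4 = 4 * sqrt T * c3 + c3\<^sup>2"
  define C5 where "C5 = 2 * L * C4 + 4 * (sqrt T + c3) * C1"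
  define C7 where "C7 = C5 + 32 * sqrt T * T * L + 2"
  define C8 where "C8 = 2 * C7 * measure lborel (below T)"
  have L: "L \<ge> 1" using T by (simp add: L_def)
  have P: "P \<ge> 1" using T by (simp add: P_def)
  have C1: "C1 \<ge> 0" using L P T by (simp add: C1_def)
  have C2: "C2 \<ge> 0" using L P T C1 by (simp add: C2_def)
  have c3: "c3 \<ge> 0" using C2 by (simp add: c3_def)
  have C4: "C4 \<ge> 0" using c3 T by (simp add: C4_def)
  have C5: "C5 \<ge> 0" using C4 C1 c3 L T by (simp add: C5_def)
  have C7: "C7 \<ge> 0" using C5 T L by (simp add: C7_def)
  have C8: "C8 \<ge> 0" using C7 by (simp add: C8_def)
  \<comment> \<open>The second entry is the smallness required by \<open>tilt_upper\<close>.\<close>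
  define \<sigma>0 where "\<sigma>0 = min 1 (1 / (2 * s\<^sup>2 * sqrt T))"
  have \<sigma>0: "\<sigma>0 > 0" using s T by (simp add: \<sigma>0_def)
  show ?thesis
  proof (rule exI[of _ C8], intro conjI C8, rule exI[of _ \<sigma>0], intro conjI allI impI \<sigma>0)
    fix \<sigma> t :: real assume \<sigma>: "0 < \<sigma>" "\<sigma> \<le> \<sigma>0"
    have \<sigma>1: "\<sigma> \<le> 1" and small: "s\<^sup>2 * \<sigma> * sqrt T \<le> 1 / 2"
      using \<sigma> s T by (auto simp: \<sigma>0_def field_simps)
    define e where "e = sqrt \<sigma>"
    have e: "0 < e" "e \<le> 1" "e * e = \<sigma>" using \<sigma> \<sigma>1 by (auto simp: e_def)
    then have e': "\<sigma> \<le> e" using mult_left_mono[of e 1 e] by simp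
    note e = e e'
    define h where "h = \<sigma>\<^sup>2"
    have h: "h > 0" "h \<le> \<sigma>" using \<sigma> \<sigma>1 by (auto simp: h_def power2_eq_square mult_left_le)
    then have "h \<le> 1" using \<sigma>1 by linarith
    note h = h this
    define qc wc where "qc c = real_of_int (fst c) * h" and "wc c = real_of_int (snd c) * h" for c :: "int \<times> int"
    define \<kappa> where "\<kappa> c = 2 * \<sigma> * (1 + s\<^sup>2 * qc c)" for c
    define W where "W c = wedge T (qc c) (wc c) (\<kappa> c) (C1 * \<sigma>\<^sup>2)" for c
    define k where "k c = exp (- cap_mass r (qc c)) * chart_mass r (W c) + chart_mass r (cell h T c)" for c
    define V where "V c = (void (chart r t (below (qc c))) - void (chart r t (cell h T c)) - void (chart r t (W c - cell h T c)))" for c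
    define D where "D c = {\<omega> \<in> space M. card (\<Phi> \<omega> \<inter> chart r t (cell h T c)) \<ge> 2}" for c
    define G where "G = (\<Union>c\<in>cell_index h T. V c \<union> D c)"
    have Wb: "W c \<in> sets borel" "bounded (W c)" for c
      using bounded_below_subset[OF wedge_below] by (auto simp: W_def)
    have WQb: "W c - cell h T c \<in> sets borel" "bounded (W c - cell h T c)" for c
      using Wb[of c] by (auto intro: bounded_subset)
    have Vev: "V c \<in> events" for c unfolding V_def
      by (intro sets.Diff void_chart_event WQb below_bounded cell_bounded below_borel cell_borel)
    have Dev: "D c \<in> events" for c unfolding D_def
      by (intro two_points_event chart_borel bounded_chart r cell_borel cell_bounded)
    have Gev: "G \<in> events" unfolding G_def using Vev Dev by (intro sets.finite_UN) auto
    have cellb: "qc c \<le> q" "q < qc c + h" "wc c \<le> w" "w < wc c + h" if "(q, w) \<in> cell h T c" for c q w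
      using cell_bounds[OF h(1), of q w T "fst c" "snd c"] that by (auto simp: qc_def wc_def)
    have probV: "prob (V c) \<le> exp (- cap_mass r (qc c)) * chart_mass r (W c) * chart_mass r (cell h T c)" for c
    proof -
      have "prob (V c) \<le> exp (- chart_mass r (below (qc c))) * chart_mass r (cell h T c) * chart_mass r (W c - cell h T c)"
        unfolding V_def
      proof (rule cell_prob3)
        show "below (qc c) \<inter> cell h T c = {}" 
        proof (rule ccontr)
          assume "\<not> ?thesis"
          then obtain a b where "(a, b) \<in> below (qc c)" "(a, b) \<in> cell h T c" by auto
          then show False using cellb(1)[of a b c] by (simp add: below_def)
        qed
        show "below (qc c) \<inter> (W c - cell h T c) = {}" by (auto simp: W_def wedge_def below_def)
      qed (use WQb below_bounded cell_bounded in auto)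
      also have "\<dots> \<le> exp (- chart_mass r (below (qc c))) * chart_mass r (cell h T c) * chart_mass r (W c)"
        using Wb WQb by (intro mult_left_mono chart_mass_mono) auto
      finally show ?thesis by (simp add: cap_mass_def mult_ac)
    qed
    have probD: "prob (D c) \<le> chart_mass r (cell h T c) * chart_mass r (cell h T c)" for c
      using two_points_prob[OF chart_borel[OF cell_borel] bounded_chart[OF r cell_bounded]]
      unfolding D_def by (simp add: measure_chart cell_bounded power2_eq_square)
    have "prob G \<le> (\<Sum>c\<in>cell_index h T. prob (V c \<union> D c))"
      unfolding G_def using Vev Dev by (intro finite_measure_subadditive_finite) auto
    also have "\<dots> \<le> (\<Sum>c\<in>cell_index h T. prob (V c) + prob (D c))"
      using Vev Dev by (intro sum_mono measure_Un_le) auto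
    also have "\<dots> \<le> (\<Sum>c\<in>cell_index h T. k c * chart_mass r (cell h T c))"
      using probV probD by (intro sum_mono) (simp add: k_def distrib_right add_mono)
    also have "\<dots> \<le> 2 * (\<integral>z. (\<sigma> * upper_integrand r z + C7 * (\<sigma> * e)) * indicator (below T) z \<partial>lborel)"
    proof (rule cell_sum_le)
      have fin: "integrable lborel (\<lambda>z. (C7 * (\<sigma> * e)) * indicator (below T) z)"
        by (intro integrable_mult_right integrable_real_indicator) (use emeasure_bounded_finite[OF below_bounded] in auto)
      show "integrable lborel (\<lambda>z. (\<sigma> * upper_integrand r z + C7 * (\<sigma> * e)) * indicator (below T) z)"
        using Bochner_Integration.integrable_add[OF integrable_mult_right[OF upper_integrand_integrable, of \<sigma> r T] fin] by (simp add: algebra_simps)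
      show "0 \<le> k c" for c by (simp add: k_def)
      show "0 \<le> \<sigma> * upper_integrand r z + C7 * (\<sigma> * e)" if "z \<in> below T" for z
        using upper_integrand_bound(1)[OF that] \<sigma> C7 e by simp
      fix c z assume z: "z \<in> cell h T c"
      obtain q w where zz: "z = (q, w)" by (cases z)
      have zb: "(q, w) \<in> below T" using z by (simp add: cell_def zz)
      note cb = cellb[OF z[unfolded zz]] and bw = below_w[OF zb] and gap = below_gap[OF zb]
      have q: "0 \<le> q" "q \<le> T" "\<bar>w\<bar> \<le> sqrt q" "sqrt q \<le> sqrt T" using bw by auto
      have qc0: "0 \<le> qc c"
      proof -
        have "fst c = \<lfloor>q / h\<rfloor>" using z by (simp add: cell_def zz)
        then show ?thesis using q h by (simp add: qc_def)
      qed
      have sq: "0 \<le> s\<^sup>2 * qc c" "s\<^sup>2 * qc c \<le> s\<^sup>2 * q" "s\<^sup>2 * q \<le> s\<^sup>2 * T" using qc0 cb q by (auto intro: mult_left_mono)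
      have \<kappa>: "0 \<le> \<kappa> c" "\<kappa> c \<le> 2 * \<sigma> * (1 + s\<^sup>2 * q)" "\<kappa> c \<le> 2 * \<sigma> * L"
        using \<sigma> sq by (auto simp: \<kappa>_def L_def)
      have sqrt_e: "\<sigma> * e = e * e * e" using e by simp
      \<comment> \<open>Heights in the wedge stay below \<open>qc c + C2 * \<sigma>\<close>, so
        their roots exceed \<open>sqrt (qc c)\<close> by at most \<open>sqrt C2 * e\<close>. Near
        height \<open>0\<close> the root is only Hoelder continuous of order \<open>1 / 2\<close>,
        hence an error of order \<open>\<sigma> * sqrt \<sigma>\<close>. The additional
        \<open>2 * e\<close> covers \<open>\<bar>wc c\<bar>\<close>.\<close>
      define R where "R = sqrt (qc c) + (sqrt C2 + 2) * e"
      have sqc: "sqrt q \<le> sqrt (qc c) + e"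
      proof -
        have "sqrt q \<le> sqrt (qc c + h)" using cb by simp
        also have "\<dots> \<le> sqrt (qc c) + sqrt h" using qc0 h by (intro sqrt_add_le_add_sqrt) auto
        also have "sqrt h = \<sigma>" using \<sigma> by (simp add: h_def)
        finally show ?thesis using e by simp
      qed
      have hbe: "h \<le> e" using h e by linarith
      have R: "\<bar>wc c\<bar> \<le> R"
      proof -
        have "\<bar>wc c\<bar> \<le> \<bar>w\<bar> + h" using cb h by linarith
        also have "\<dots> \<le> sqrt (qc c) + e + e" using q sqc hbe by linarith
        also have "\<dots> \<le> R" using C2 e by (simp add: R_def algebra_simps)
        finally show ?thesis .
      qed
      have area: "measure lborel (W c) \<le> \<kappa> c * (R - wc c)\<^sup>2 / 2 + 2 * R * (C1 * \<sigma>\<^sup>2)"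
        unfolding W_def
      proof (rule wedge_area)
        fix q' w' assume a: "(q', w') \<in> wedge T (qc c) (wc c) (\<kappa> c) (C1 * \<sigma>\<^sup>2)"
        then have b': "(q', w') \<in> below T" and le: "q' \<le> qc c + \<kappa> c * max 0 (w' - wc c) + C1 * \<sigma>\<^sup>2"
          by (auto simp: wedge_def)
        note bw' = below_w[OF b']
        have "w' - wc c \<le> P" unfolding P_def using bw'(1,2) cb(4) h(3) q(3,4) by linarith
        then have "max 0 (w' - wc c) \<le> P" using P by simp
        then have "\<kappa> c * max 0 (w' - wc c) \<le> 2 * \<sigma> * L * P" using \<kappa> \<sigma> L by (intro mult_mono) auto
        moreover have "C1 * \<sigma>\<^sup>2 \<le> C1 * \<sigma>" using \<sigma> \<sigma>1 C1 by (intro mult_left_mono) (auto simp: power2_eq_square)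
        ultimately have "q' \<le> qc c + C2 * \<sigma>" using le by (simp add: C2_def algebra_simps)
        then have "sqrt q' \<le> sqrt (qc c + C2 * \<sigma>)" by simp
        also have "\<dots> \<le> sqrt (qc c) + sqrt (C2 * \<sigma>)" using qc0 C2 \<sigma> by (intro sqrt_add_le_add_sqrt) auto
        also have "\<dots> \<le> R" using e by (simp add: R_def real_sqrt_mult e_def[symmetric] algebra_simps)
        finally show "\<bar>w'\<bar> \<le> R" using bw'(1) by linarith
      qed (use \<kappa> C1 R in auto)
      have Rw: "0 \<le> R - wc c" "R - wc c \<le> (sqrt q - w) + c3 * e"
      proof -
        show "0 \<le> R - wc c" using R by linarith
        have "sqrt (qc c) \<le> sqrt q" using cb by simp
        then have "R - wc c \<le> sqrt q + (sqrt C2 + 2) * e - w + e" unfolding R_def using cb hbe by linarith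
        then show "R - wc c \<le> (sqrt q - w) + c3 * e" by (simp add: c3_def algebra_simps)
      qed
      have R2: "(R - wc c)\<^sup>2 \<le> (sqrt q - w)\<^sup>2 + C4 * e"
      proof -
        have "(R - wc c)\<^sup>2 \<le> ((sqrt q - w) + c3 * e)\<^sup>2" using Rw by (intro power_mono) auto
        also have "\<dots> = (sqrt q - w)\<^sup>2 + 2 * (sqrt q - w) * (c3 * e) + c3\<^sup>2 * (e * e)" by (simp add: power2_eq_square algebra_simps)
        also have "\<dots> \<le> (sqrt q - w)\<^sup>2 + 2 * (2 * sqrt T) * (c3 * e) + c3\<^sup>2 * (e * 1)"
          using gap c3 e by (intro add_mono mult_right_mono mult_left_mono) auto
        finally show ?thesis by (simp add: C4_def algebra_simps)
      qed
      have RT: "R \<le> sqrt T + c3"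
      proof -
        have "sqrt (qc c) \<le> sqrt T" using cb q by simp
        moreover have "(sqrt C2 + 2) * e \<le> (sqrt C2 + 2) * 1" using C2 e by (intro mult_left_mono) auto
        ultimately have "R \<le> sqrt T + (sqrt C2 + 2) * 1" unfolding R_def by (rule add_mono)
        then show ?thesis by (simp add: c3_def)
      qed
      have KW: "chart_mass r (W c) \<le> 2 * \<sigma> * (1 + s\<^sup>2 * q) * (sqrt q - w)\<^sup>2 + C5 * (\<sigma> * e)"
      proof -
        have "chart_mass r (W c) \<le> 2 * measure lborel (W c)" by (rule chart_mass_le[OF Wb])
        also have "\<dots> \<le> \<kappa> c * (R - wc c)\<^sup>2 + 4 * R * C1 * \<sigma>\<^sup>2" using area by simp
        also have "\<dots> \<le> \<kappa> c * ((sqrt q - w)\<^sup>2 + C4 * e) + 4 * (sqrt T + c3) * C1 * (\<sigma> * e)"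
          using R2 RT \<kappa> C1 \<sigma> e T c3 by (intro add_mono mult_left_mono mult_right_mono mult_mono) (auto simp: power2_eq_square)
        also have "\<dots> \<le> 2 * \<sigma> * (1 + s\<^sup>2 * q) * (sqrt q - w)\<^sup>2 + 2 * \<sigma> * L * (C4 * e) + 4 * (sqrt T + c3) * C1 * (\<sigma> * e)"
          using \<kappa> C4 e by (simp add: distrib_left add_mono mult_right_mono)
        finally show ?thesis by (simp add: C5_def algebra_simps)
      qed
      have Kc: "chart_mass r (cell h T c) \<le> 2 * (\<sigma> * e)"
      proof -
        have "measure lborel (cell h T c) \<le> (\<lambda>w. h * w) (wc c + h) - (\<lambda>w. h * w) (wc c)"
        proof (rule area_le[where f = "\<lambda>w. qc c" and g = "\<lambda>w. qc c + h" and F = "\<lambda>w. h * w"])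
          show "cell h T c \<subseteq> {(q, w). wc c \<le> w \<and> w \<le> wc c + h \<and> qc c \<le> q \<and> q \<le> qc c + h}"
            by (rule subsetI) (use cellb[of _ _ c] in \<open>auto intro: less_imp_le\<close>)
        qed (use h in \<open>auto intro!: derivative_eq_intros\<close>)
        then have "measure lborel (cell h T c) \<le> h * h" by (simp add: algebra_simps)
        also have "\<dots> \<le> \<sigma> * e" using h e hbe \<sigma> by (intro mult_mono) auto
        finally show ?thesis using chart_mass_le[OF cell_borel cell_bounded, of r h T c] by simp
      qed
      have ex: "exp (- cap_mass r (qc c)) \<le> exp (- cap_mass r q) + 4 * sqrt T * h"
      proof -
        have "exp (- cap_mass r (qc c)) \<le> exp (- cap_mass r q) + (cap_mass r q - cap_mass r (qc c))"
          using cap_mass_mono[OF cb(1)] cap_mass_nonneg by (intro exp_diff_bound) auto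
        moreover have "cap_mass r q - cap_mass r (qc c) \<le> 4 * sqrt T * (q - qc c)"
          using cap_mass_increment[OF cb(1), of T r] q T by simp
        moreover have "4 * sqrt T * (q - qc c) \<le> 4 * sqrt T * h" using cb T by (intro mult_left_mono) auto
        ultimately show ?thesis by linarith
      qed
      define X where "X = 2 * \<sigma> * (1 + s\<^sup>2 * q) * (sqrt q - w)\<^sup>2"
      have X: "0 \<le> X" "X \<le> 2 * \<sigma> * L * (4 * T)"
      proof -
        have "0 \<le> s\<^sup>2 * q" "1 + s\<^sup>2 * q \<le> L" using sq by (auto simp: L_def)
        then show "0 \<le> X" "X \<le> 2 * \<sigma> * L * (4 * T)"
          unfolding X_def using \<sigma> gap L by (intro mult_nonneg_nonneg mult_mono mult_left_mono; simp)+
      qed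
      have "exp (- cap_mass r (qc c)) * chart_mass r (W c) \<le> exp (- cap_mass r (qc c)) * X + 1 * (C5 * (\<sigma> * e))"
      proof -
        have "exp (- cap_mass r (qc c)) * chart_mass r (W c) \<le> exp (- cap_mass r (qc c)) * (X + C5 * (\<sigma> * e))"
          using KW by (intro mult_left_mono) (auto simp: X_def)
        also have "\<dots> \<le> exp (- cap_mass r (qc c)) * X + 1 * (C5 * (\<sigma> * e))"
          unfolding distrib_left using cap_mass_nonneg[of r "qc c"] C5 \<sigma> e by (intro add_left_mono mult_right_mono) auto
        finally show ?thesis .
      qed
      also have "exp (- cap_mass r (qc c)) * X \<le> (exp (- cap_mass r q) + 4 * sqrt T * h) * X"
        using ex X by (intro mult_right_mono) auto
      also have "\<dots> \<le> exp (- cap_mass r q) * X + 4 * sqrt T * h * (2 * \<sigma> * L * (4 * T))"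
        unfolding distrib_right using X T h by (intro add_left_mono mult_left_mono) auto
      also have "4 * sqrt T * h * (2 * \<sigma> * L * (4 * T)) \<le> 4 * sqrt T * e * (2 * \<sigma> * L * (4 * T))"
        using hbe T \<sigma> L by (intro mult_right_mono mult_left_mono) auto
      finally have "exp (- cap_mass r (qc c)) * chart_mass r (W c) \<le> exp (- cap_mass r q) * X + (32 * sqrt T * T * L + C5) * (\<sigma> * e)"
        by (simp add: algebra_simps)
      then have "k c \<le> exp (- cap_mass r q) * X + C7 * (\<sigma> * e)"
        using Kc by (simp add: k_def C7_def algebra_simps)
      then show "k c \<le> \<sigma> * upper_integrand r z + C7 * (\<sigma> * e)" by (simp add: X_def upper_integrand_def zz mult_ac)
    qed
    also have "\<dots> = \<sigma> * upper_rate T + C8 * (\<sigma> * e)"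
    proof -
      have fin: "integrable lborel (\<lambda>z. (C7 * (\<sigma> * e)) * indicator (below T) z)"
        by (intro integrable_mult_right integrable_real_indicator) (use emeasure_bounded_finite[OF below_bounded] in auto)
      have "(\<integral>z. (\<sigma> * upper_integrand r z + C7 * (\<sigma> * e)) * indicator (below T) z \<partial>lborel)
        = (\<integral>z. \<sigma> * (upper_integrand r z * indicator (below T) z) + (C7 * (\<sigma> * e)) * indicator (below T) z \<partial>lborel)"
        by (intro Bochner_Integration.integral_cong) (auto simp: algebra_simps)
      also have "\<dots> = \<sigma> * (\<integral>z. upper_integrand r z * indicator (below T) z \<partial>lborel) + (C7 * (\<sigma> * e)) * measure lborel (below T)"
        using integrable_mult_right[OF upper_integrand_integrable, of \<sigma> r T] fin by (subst Bochner_Integration.integral_add) auto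
      finally show ?thesis by (simp add: upper_rate_def C8_def algebra_simps)
    qed
    finally have pG: "prob G \<le> \<sigma> * upper_rate T + C8 * (\<sigma> * sqrt \<sigma>)" by (simp add: e_def)
    have incl: "\<omega> \<in> G" if w: "\<omega> \<in> space M" and out: "\<forall>z\<in>\<Phi> \<omega>. 2 * r < norm z"
      and x: "x \<in> \<Phi> \<omega>" and y: "y \<in> \<Phi> \<omega>" and xy: "x \<noteq> y"
      and first: "\<forall>z\<in>\<Phi> \<omega>. z \<bullet> dirv t > 0 \<longrightarrow> height_coord r t x \<le> height_coord r t z" and tl: "tilted t \<sigma> T x y" for \<omega> x y
    proof -
      let ?q = "height_coord r t x" and ?w = "width_coord r t x" and ?q' = "height_coord r t y" and ?w' = "width_coord r t y"
      have xb: "(?q, ?w) \<in> below T" and yb: "(?q', ?w') \<in> below T"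
        using chart_parabola_iff[OF r, of x t] chart_parabola_iff[OF r, of y t] out x y tl
        by (auto simp: tilted_def below_def)
      obtain c where c: "c \<in> cell_index h T" "(?q, ?w) \<in> cell h T c" using in_cell[OF h(1) xb] by auto
      note cb = cellb[OF c(2)] and bx = below_w[OF xb] and by' = below_w[OF yb]
      have xc: "x \<in> chart r t (cell h T c)" using c tl by (simp add: chart_def tilted_def)
      show "\<omega> \<in> G"
      proof (cases "y \<in> chart r t (cell h T c)")
        case True
        have "card {x, y} \<le> card (\<Phi> \<omega> \<inter> chart r t (cell h T c))"
          using x y xc True finite_points[OF w bounded_chart[OF r cell_bounded]] by (intro card_mono) auto
        then have "\<omega> \<in> D c" using xy w by (simp add: D_def)
        then show ?thesis using c by (auto simp: G_def)
      next
        case False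
        have "\<omega> \<in> void (chart r t (below (qc c)))"
          using w first cb by (fastforce simp: void_def chart_def below_def)
        moreover have "\<omega> \<notin> void (chart r t (cell h T c))" using x xc by (auto simp: void_def)
        moreover have "y \<in> chart r t (W c - cell h T c)"
        proof -
          have qc0: "0 \<le> qc c"
          proof -
            have "fst c = \<lfloor>?q / h\<rfloor>" using c by (simp add: cell_def)
            then show ?thesis using bx h by (simp add: qc_def)
          qed
          have wT: "\<bar>?w\<bar> \<le> sqrt T" "\<bar>?w'\<bar> \<le> sqrt T" using bx(1,2) by'(1,2) by linarith+
          have "?q' \<le> ?q + (1 + s\<^sup>2 * ?q) * (2 * \<sigma> * (?w' - ?w) + 40 * s\<^sup>2 * \<sigma>\<^sup>2 * T)"
            by (rule tilt_upper[OF _ wT]) (use bx by' tl \<sigma> s small T in \<open>auto simp: tilted_def\<close>)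
          define p where "p = max 0 (?w' - wc c)"
          have "?w' - wc c \<le> P" unfolding P_def using by'(1,2) bx(1,2) cb(4) h(3) by linarith
          then have p: "0 \<le> p" "?w' - ?w \<le> p" "p \<le> P" using cb(3) P by (auto simp: p_def)
          have sq: "0 \<le> s\<^sup>2 * qc c" "0 \<le> s\<^sup>2 * ?q" "s\<^sup>2 * ?q \<le> s\<^sup>2 * T" "s\<^sup>2 * ?q \<le> s\<^sup>2 * qc c + s\<^sup>2 * h"
            using qc0 cb bx mult_left_mono[of ?q "qc c + h" "s\<^sup>2"] mult_left_mono[of ?q T "s\<^sup>2"] by (auto simp: distrib_left)
          define Y where "Y = 40 * s\<^sup>2 * \<sigma>\<^sup>2 * T"
          have h1: "(1 + s\<^sup>2 * ?q) * (2 * \<sigma> * (?w' - ?w)) \<le> (1 + s\<^sup>2 * ?q) * (2 * \<sigma> * p)"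
            using sq p \<sigma> by (intro mult_left_mono) auto
          have h2: "(1 + s\<^sup>2 * ?q) * Y \<le> L * Y"
            using sq T by (intro mult_right_mono) (auto simp: L_def Y_def)
          have h3: "(1 + s\<^sup>2 * ?q) * (2 * \<sigma> * p) \<le> (1 + (s\<^sup>2 * qc c + s\<^sup>2 * h)) * (2 * \<sigma> * p)"
            using sq p \<sigma> by (intro mult_right_mono) auto
          have h4: "(1 + (s\<^sup>2 * qc c + s\<^sup>2 * h)) * (2 * \<sigma> * p) = \<kappa> c * p + s\<^sup>2 * (2 * \<sigma> * h * p)" by (simp add: \<kappa>_def algebra_simps)
          have h5: "s\<^sup>2 * (2 * \<sigma> * h * p) \<le> s\<^sup>2 * (2 * 1 * h * P)"
            using p \<sigma> \<sigma>1 h by (intro mult_left_mono mult_mono) auto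
          have h6: "?q' \<le> ?q + ((1 + s\<^sup>2 * ?q) * (2 * \<sigma> * (?w' - ?w)) + (1 + s\<^sup>2 * ?q) * Y)"
            using \<open>?q' \<le> ?q + (1 + s\<^sup>2 * ?q) * (2 * \<sigma> * (?w' - ?w) + 40 * s\<^sup>2 * \<sigma>\<^sup>2 * T)\<close>
            by (simp add: Y_def distrib_left)
          \<comment> \<open>The three summands of \<open>C1\<close> are the height of a square, the
            variation of the slope inside the square, and the remainder of
            \<open>tilt_upper\<close>.\<close>
          have h7: "C1 * \<sigma>\<^sup>2 = h + s\<^sup>2 * (2 * 1 * h * P) + L * Y" by (simp add: C1_def h_def Y_def algebra_simps)
          have "?q' \<le> qc c + \<kappa> c * p + C1 * \<sigma>\<^sup>2" using h1 h2 h3 h4 h5 h6 h7 cb(2) by linarith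
          moreover have "qc c \<le> ?q'" using cb tl by (auto simp: tilted_def)
          ultimately have "(?q', ?w') \<in> W c" using yb by (simp add: W_def wedge_def p_def)
          then show ?thesis using False tl by (auto simp: chart_def tilted_def)
        qed
        then have "\<omega> \<notin> void (chart r t (W c - cell h T c))" using y by (auto simp: void_def)
        ultimately have "\<omega> \<in> V c" by (simp add: V_def)
        then show ?thesis using c by (auto simp: G_def)
      qed
    qed
    show "\<exists>G\<in>events. prob G \<le> \<sigma> * upper_rate T + C8 * (\<sigma> * sqrt \<sigma>) \<and>
      (\<forall>\<omega>\<in>space M. (\<forall>z\<in>\<Phi> \<omega>. 2 * r < norm z) \<longrightarrow>
      (\<exists>x\<in>\<Phi> \<omega>. \<exists>y\<in>\<Phi> \<omega>. x \<noteq> y \<and> (\<forall>z\<in>\<Phi> \<omega>. z \<bullet> dirv t > 0 \<longrightarrow> height_coord r t x \<le> height_coord r t z) \<and> tilted t \<sigma> T x y) \<longrightarrow> \<omega> \<in> G)"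
      using Gev pG incl by blast
  qed
qed

end

subsection \<open>Upper bound for the expectation\<close>

lemma surroundedI:
  assumes "locally_finite_set S" "0 < \<rho>" "\<And>x. x \<in> S \<Longrightarrow> \<rho> \<le> norm x" "0 < c"
    "\<And>u. norm u = 1 \<Longrightarrow> \<exists>x\<in>S. c \<le> nearness x u"
  shows "surrounded S c \<rho>"
  using assms by unfold_locales auto

lemma locally_finite_insert: "locally_finite_set S \<Longrightarrow> locally_finite_set (insert z S)"
  unfolding locally_finite_set_def
proof (intro allI impI)
  fix B :: "'a set" assume "\<forall>B. bounded B \<longrightarrow> finite (S \<inter> B)" "bounded B"
  then have "finite (insert z (S \<inter> B))" by blast
  then show "finite (insert z S \<inter> B)" by (rule rev_finite_subset) auto
qed

text \<open>One of the four axis directions makes an angle of at most \<open>pi / 4\<close> with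
  \<open>u\<close>, and \<open>2 / 3\<close> is a rational number below
  \<open>1 / sqrt 2\<close>.\<close>

lemma unit_quadrant:
  assumes "norm u = 1"
  shows "\<exists>j<4::nat. 2 / 3 \<le> u \<bullet> dirv (j * pi / 2) \<and> \<bar>u \<bullet> dirv (j * pi / 2 + pi / 2)\<bar> \<le> u \<bullet> dirv (j * pi / 2)"
proof -
  define c d where "c = u $ 1" and "d = u $ 2"
  have cd: "c\<^sup>2 + d\<^sup>2 = 1"
    using assms by (simp add: c_def d_def norm_eq_sqrt_inner inner_vec_def sum_2 power2_eq_square)
  have e: "u \<bullet> dirv t = c * cos t + d * sin t" for t by (simp add: inner_dirv c_def d_def)
  have trig: "cos (pi + pi / 2) = 0" "sin (pi + pi / 2) = -1" "cos (3 * pi / 2) = 0" "sin (3 * pi / 2) = -1"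
     "cos (3 * pi / 2 + pi / 2) = 1" "sin (3 * pi / 2 + pi / 2) = 0" "cos (pi / 2 + pi / 2) = -1" "sin (pi / 2 + pi / 2) = 0"
  proof -
    show 1: "cos (pi + pi / 2) = 0" "sin (pi + pi / 2) = -1" unfolding cos_add sin_add by simp_all
    have e1: "3 * pi / 2 = pi + pi / 2" by simp
    show "cos (3 * pi / 2) = 0" "sin (3 * pi / 2) = -1" unfolding e1 by (fact 1)+
    have e2: "3 * pi / 2 + pi / 2 = 2 * pi" by simp
    show "cos (3 * pi / 2 + pi / 2) = 1" "sin (3 * pi / 2 + pi / 2) = 0" unfolding e2 by simp_all
    show "cos (pi / 2 + pi / 2) = -1" "sin (pi / 2 + pi / 2) = 0" by simp_all
  qed
  have big: "2 / 3 \<le> \<bar>a\<bar>" if "a\<^sup>2 + b\<^sup>2 = 1" "\<bar>b\<bar> \<le> \<bar>a\<bar>" for a b :: real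
  proof -
    have "b\<^sup>2 \<le> a\<^sup>2" using that(2) by (simp add: abs_le_square_iff)
    then have "(2 / 3)\<^sup>2 \<le> \<bar>a\<bar>\<^sup>2" using that(1) by (simp add: power2_eq_square)
    then show ?thesis by (rule power2_le_imp_le) simp
  qed
  consider "\<bar>d\<bar> \<le> \<bar>c\<bar>" "c \<ge> 0" | "\<bar>d\<bar> \<le> \<bar>c\<bar>" "c < 0" | "\<bar>c\<bar> \<le> \<bar>d\<bar>" "d \<ge> 0" | "\<bar>c\<bar> \<le> \<bar>d\<bar>" "d < 0" by linarith
  then show ?thesis
  proof cases
    case 1 then show ?thesis using big[of c d] cd by (intro exI[of _ 0]) (simp add: e)
  next
    case 2 then show ?thesis using big[of c d] cd by (intro exI[of _ 2]) (simp add: e trig)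
  next
    case 3 then show ?thesis using big[of d c] cd by (intro exI[of _ 1]) (simp add: e trig)
  next
    case 4 then show ?thesis using big[of d c] cd by (intro exI[of _ 3]) (simp add: e trig)
  qed
qed

lemma angle_scale_le_1: "r \<ge> 1 \<Longrightarrow> angle_scale r \<le> 1"
  using powr_mono[of "- 2 / 3" 0 r] by (simp add: angle_scale_def)

text \<open>Width below \<open>1 / 2\<close> together with \<open>angle_scale r \<le> 1\<close>
  keeps the slope of a point against the axis below \<open>1 / 2\<close>, so that one point blocks a
  whole quarter of the directions.\<close>

definition strip :: "real \<Rightarrow> (real \<times> real) set" where "strip B = {z \<in> below B. \<bar>snd z\<bar> < 1 / 2}"

lemma lim_tan_angle: "(\<lambda>n. tan (2 * pi / real n)) \<longlonglongrightarrow> 0"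
  and lim_n_tan_angle: "(\<lambda>n. real n * tan (2 * pi / real n)) \<longlonglongrightarrow> 2 * pi"
  unfolding tan_def by real_asymp+

context poisson_outside
begin

definition around :: "real \<Rightarrow> 'w set" where
  "around B = space M - (\<Union>j\<in>{..<4::nat}. void (chart r (j * pi / 2) (strip B)))"

lemma strip_borel [measurable]: "strip B \<in> sets borel" and strip_bounded: "bounded (strip B)"
proof -
  have "{z :: real \<times> real. \<bar>snd z\<bar> < 1 / 2} \<in> sets borel"
    by (intro borel_open open_Collect_less continuous_intros)
  moreover have "strip B = below B \<inter> {z. \<bar>snd z\<bar> < 1 / 2}" by (auto simp: strip_def)
  ultimately show "strip B \<in> sets borel" by simp
  show "bounded (strip B)" by (rule bounded_below_subset[of _ B]) (auto simp: strip_def)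
qed

lemma around_event [measurable]: "around B \<in> events"
  unfolding around_def by (intro sets.Diff sets.top sets.finite_UN void_chart_event strip_borel strip_bounded) auto

text \<open>In the frame of the closest axis, \<open>x \<bullet> u = a * c + b * d\<close> with
  \<open>\<bar>b\<bar> \<le> a / 2\<close> and \<open>\<bar>d\<bar> \<le> c\<close>. At least
  \<open>a * c / 2 \<ge> a / 3\<close> remains, a third of the value in the axis direction.\<close>

lemma around_nearness:
  assumes r1: "r \<ge> 1" and B: "B > 0" and w: "\<omega> \<in> around B" and u: "norm u = 1"
  shows "\<exists>x\<in>\<Phi> \<omega>. 1 / (6 * r * sqrt (1 + s\<^sup>2 * B)) \<le> nearness x u"
proof -
  have s: "0 < s" "s \<le> 1" using angle_scale[OF r] angle_scale_le_1[OF r1] by auto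
  obtain j :: nat where j: "j < 4" "2 / 3 \<le> u \<bullet> dirv (j * pi / 2)"
      "\<bar>u \<bullet> dirv (j * pi / 2 + pi / 2)\<bar> \<le> u \<bullet> dirv (j * pi / 2)"
    using unit_quadrant[OF u] by blast
  define t where "t = real j * pi / 2"
  have "\<omega> \<in> space M" "\<omega> \<notin> void (chart r t (strip B))" using w j by (auto simp: around_def t_def)
  then obtain x where x: "x \<in> \<Phi> \<omega>" "x \<in> chart r t (strip B)" by (auto simp: void_def)
  define a b where "a = x \<bullet> dirv t" and "b = x \<bullet> dirv (t + pi / 2)"
  define c d where "c = u \<bullet> dirv t" and "d = u \<bullet> dirv (t + pi / 2)"
  have a: "a > 0" using x by (simp add: chart_def a_def)
  have q: "height_coord r t x \<le> B" "\<bar>width_coord r t x\<bar> \<le> 1 / 2" using x by (auto simp: chart_def strip_def below_def)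
  have b: "\<bar>b\<bar> \<le> a / 2"
  proof -
    have "b = a * (s * width_coord r t x)" using a s by (simp add: width_coord_def a_def b_def)
    moreover have "\<bar>s * width_coord r t x\<bar> \<le> 1 * (1 / 2)" unfolding abs_mult using s q by (intro mult_mono) auto
    then have "a * \<bar>s * width_coord r t x\<bar> \<le> a * (1 / 2)" using a by (intro mult_left_mono) auto
    ultimately show ?thesis using a by (simp add: abs_mult)
  qed
  have cd: "2 / 3 \<le> c" "\<bar>d\<bar> \<le> c" using j by (auto simp: c_def d_def t_def)
  have xu: "x \<bullet> u = a * c + b * d"
  proof -
    have "a * c + b * d = (x $ 1 * u $ 1 + x $ 2 * u $ 2) * ((cos t)\<^sup>2 + (sin t)\<^sup>2)"
      unfolding a_def b_def c_def d_def inner_dirv cos_add sin_add cos_pi_half sin_pi_half by algebra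
    then show ?thesis by (simp add: inner_vec_def sum_2)
  qed
  have "\<bar>b * d\<bar> \<le> a / 2 * c" unfolding abs_mult using b cd a by (intro mult_mono) auto
  then have "a * c / 2 \<le> x \<bullet> u" unfolding xu by (simp add: abs_le_iff)
  moreover have "a / 3 \<le> a * c / 2" using mult_left_mono[OF cd(1), of "a / 2"] a by simp
  ultimately have "a / 3 \<le> x \<bullet> u" by linarith
  then have "(a / 3) / (x \<bullet> x) \<le> nearness x u" unfolding nearness_def by (intro divide_right_mono) auto
  moreover have "(a / 3) / (x \<bullet> x) = nearness x (dirv t) / 3" by (simp add: nearness_def a_def)
  moreover have "nearness x (dirv t) / 3 = 1 / (6 * r * sqrt (1 + s\<^sup>2 * height_coord r t x))"
    using nearness_chart(2)[OF r, of x t] a by (simp add: a_def)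
  moreover have "1 / (6 * r * sqrt (1 + s\<^sup>2 * B)) \<le> 1 / (6 * r * sqrt (1 + s\<^sup>2 * height_coord r t x))"
  proof (rule divide_left_mono)
    show "6 * r * sqrt (1 + s\<^sup>2 * height_coord r t x) \<le> 6 * r * sqrt (1 + s\<^sup>2 * B)"
      using r q by (intro mult_left_mono real_sqrt_le_mono add_left_mono) auto
    show "0 < 6 * r * sqrt (1 + s\<^sup>2 * B) * (6 * r * sqrt (1 + s\<^sup>2 * height_coord r t x))"
      using r B nearness_chart(1)[OF r, of x t] a by (auto simp: a_def add_pos_nonneg)
  qed simp
  ultimately show ?thesis using x by (intro bexI[of _ x]) auto
qed

lemma strip_mono: "B \<le> B' \<Longrightarrow> strip B \<subseteq> strip B'" by (auto simp: strip_def below_def)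

lemma around_mono: "B \<le> B' \<Longrightarrow> around B \<subseteq> around B'"
  using chart_mono[OF strip_mono] by (fastforce simp: around_def void_def)

text \<open>The mass of \<open>strip (real m)\<close> is at least \<open>m - 1 / 12\<close>, so for
  a fixed direction almost surely not all strips are empty. The strips increase, hence one level
  serves all four directions.\<close>

lemma AE_around:
  assumes r1: "r \<ge> 1" shows "AE \<omega> in M. \<exists>m::nat. \<omega> \<in> around (real m)"
proof -
  have s: "0 < s" "s \<le> 1" using angle_scale[OF r] angle_scale_le_1[OF r1] by auto
  have K: "real m - 1 / 12 \<le> chart_mass r (strip (real m))" if "m \<ge> 1" for m :: nat
  proof -
    have "2 * (1 / 2) * real m - 2 / 3 * (1 / 2) ^ 3 \<le> measure lborel (strip (real m))"
    proof (rule area_below_ge(1))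
      have "(1 / 2)\<^sup>2 \<le> real m" using that by (simp add: power2_eq_square)
      then show "1 / 2 \<le> sqrt (real m)" by (rule real_le_rsqrt)
    qed (auto simp: strip_def)
    then have a: "real m - 1 / 12 \<le> measure lborel (strip (real m))" by (simp add: power3_eq_cube)
    have "1 * measure lborel (strip (real m)) \<le> 2 / (1 + s\<^sup>2 * (1 / 2)\<^sup>2)\<^sup>2 * measure lborel (strip (real m))"
    proof (rule mult_right_mono)
      have "s\<^sup>2 \<le> 1" using s by (simp add: power_le_one)
      then have "(1 + s\<^sup>2 * (1 / 2)\<^sup>2)\<^sup>2 \<le> (1 + 1 / 4)\<^sup>2" by (intro power_mono) (auto simp: power2_eq_square)
      then have "(1 + s\<^sup>2 * (1 / 2)\<^sup>2)\<^sup>2 \<le> 2" by (simp add: power2_eq_square)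
      moreover have "0 < (1 + s\<^sup>2 * (1 / 2)\<^sup>2)\<^sup>2" by (intro zero_less_power) (simp add: add_pos_nonneg)
      ultimately show "1 \<le> 2 / (1 + s\<^sup>2 * (1 / 2)\<^sup>2)\<^sup>2" by simp
    qed simp
    also have "\<dots> \<le> chart_mass r (strip (real m))"
      by (rule chart_mass_ge[OF strip_borel strip_bounded]) (auto simp: strip_def below_def)
    finally show ?thesis using a by simp
  qed
  have one: "AE \<omega> in M. \<exists>m::nat. \<omega> \<notin> void (chart r t (strip (real m)))" for t
  proof -
    define V where "V m = void (chart r t (strip (real m)))" for m
    have ev: "V m \<in> events" for m
      unfolding V_def by (intro void_chart_event strip_borel strip_bounded)
    have I: "(\<Inter>m. V m) \<in> events" using ev by auto
    have le: "prob (\<Inter>m. V m) \<le> exp (1 / 12 - real m)" if "m \<ge> 1" for m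
    proof -
      have "prob (\<Inter>m. V m) \<le> prob (V m)" using ev by (intro finite_measure_mono) auto
      also have "\<dots> = exp (- chart_mass r (strip (real m)))"
        unfolding V_def by (intro void_chart_prob strip_borel strip_bounded)
      also have "\<dots> \<le> exp (1 / 12 - real m)" using K[OF that] by simp
      finally show ?thesis .
    qed
    have "(\<lambda>m. exp (1 / 12 - real m)) \<longlonglongrightarrow> 0" by real_asymp
    then have "prob (\<Inter>m. V m) \<le> 0"
      by (rule LIMSEQ_le_const) (use le in auto)
    then have "prob (\<Inter>m. V m) = 0" using measure_nonneg[of M "\<Inter>m. V m"] by linarith
    then have "(\<Inter>m. V m) \<in> null_sets M" using I by (simp add: null_sets_def emeasure_eq_measure)
    then show ?thesis
      by (rule AE_I') (auto simp: V_def)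
  qed
  have "AE \<omega> in M. \<forall>j\<in>{..<4::nat}. \<exists>m::nat. \<omega> \<notin> void (chart r (j * pi / 2) (strip (real m)))"
    using one by (intro AE_finite_allI) auto
  then show ?thesis using AE_space
  proof eventually_elim
    case (elim \<omega>)
    then obtain m where m: "\<And>j. j < 4 \<Longrightarrow> \<omega> \<notin> void (chart r (real j * pi / 2) (strip (real (m j :: nat))))"
      by (metis lessThan_iff)
    define m' where "m' = m 0 + m 1 + m 2 + m 3"
    have le: "m j \<le> m'" if "j < 4" for j
    proof -
      have "j = 0 \<or> j = 1 \<or> j = 2 \<or> j = 3" using that by auto
      then show ?thesis by (auto simp: m'_def)
    qed
    have "\<omega> \<notin> void (chart r (real j * pi / 2) (strip (real m')))" if "j < 4" for j :: nat
      using m[OF that] chart_mono[OF strip_mono[of "real (m j)" "real m'"], of r "real j * pi / 2"] le[OF that]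
      by (fastforce simp: void_def)
    then have "\<omega> \<in> around (real m')" using elim by (auto simp: around_def)
    then show ?case by blast
  qed
qed

lemma around_surrounded:
  assumes r1: "r \<ge> 1" and B: "B > 0" and w: "\<omega> \<in> around B" and out: "\<forall>x\<in>\<Phi> \<omega>. 2 * r < norm x"
  shows "surrounded (\<Phi> \<omega>) (1 / (6 * r * sqrt (1 + s\<^sup>2 * B))) (2 * r)"
    and "norm z = 2 * r \<Longrightarrow> surrounded (insert z (\<Phi> \<omega>)) (1 / (6 * r * sqrt (1 + s\<^sup>2 * B))) (2 * r)"
proof -
  have sp: "\<omega> \<in> space M" using w by (auto simp: around_def)
  have c: "0 < 1 / (6 * r * sqrt (1 + s\<^sup>2 * B))" using r B by (simp add: add_pos_nonneg)
  show "surrounded (\<Phi> \<omega>) (1 / (6 * r * sqrt (1 + s\<^sup>2 * B))) (2 * r)"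
    using locally_finite[OF sp] r out c around_nearness[OF r1 B w] by (intro surroundedI) (auto intro: less_imp_le)
  assume z: "norm z = 2 * r"
  show "surrounded (insert z (\<Phi> \<omega>)) (1 / (6 * r * sqrt (1 + s\<^sup>2 * B))) (2 * r)"
    using locally_finite_insert[OF locally_finite[OF sp]] r out c z around_nearness[OF r1 B w]
    by (intro surroundedI) (auto intro: less_imp_le)
qed

text \<open>Extracting \<open>cos d\<close> leaves a factor common to all points, which cancels in
  comparisons; so \<open>tan d / s\<close> is the exact value of the parameter
  \<open>\<sigma>\<close>, without an approximation of the angle.\<close>

lemma nearness_rotate_eq:
  assumes "z \<bullet> dirv t > 0" "cos d > 0"
  shows "nearness z (dirv (t + d)) = cos d * (1 + s\<^sup>2 * (tan d / s) * width_coord r t z) / (2 * r * sqrt (1 + s\<^sup>2 * height_coord r t z))"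
proof -
  have s: "s > 0" using angle_scale[OF r] by simp
  have "cos d + s * width_coord r t z * sin d = cos d * (1 + s\<^sup>2 * (tan d / s) * width_coord r t z)"
    using assms s by (simp add: tan_def power2_eq_square field_simps)
  then show ?thesis using nearness_rotate[OF r assms(1), of d] nearness_chart(2)[OF r assms(1)] by simp
qed

text \<open>The delicate part concerns \<open>y\<close>, which is nearest only after the turn. As
  \<open>d \<le> r * c\<close>, the turn changes its nearness by at most \<open>c / 2\<close>, so at
  least \<open>c / 2\<close> was present before; this makes \<open>y \<bullet> dirv t\<close>
  positive and, by the choice of \<open>T\<close>, puts \<open>y\<close> below height
  \<open>T\<close>.\<close>

lemma nearest_tilted:
  assumes sur: "surrounded (\<Phi> \<omega>) c (2 * r)"
    and d: "0 < d" "d < pi / 2" "d \<le> r * c"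
    and T: "1 / (r * c) < sqrt (1 + s\<^sup>2 * T)" "T > 0"
    and x: "x \<in> nearest (\<Phi> \<omega>) (dirv t)" and y: "y \<in> nearest (\<Phi> \<omega>) (dirv (t + d))"
  shows "\<forall>z\<in>\<Phi> \<omega>. z \<bullet> dirv t > 0 \<longrightarrow> height_coord r t x \<le> height_coord r t z" "tilted t (tan d / s) T x y"
proof -
  interpret surrounded "\<Phi> \<omega>" c "2 * r" by (rule sur)
  have s: "s > 0" using angle_scale[OF r] by simp
  have nx: "nearness x (dirv t) \<ge> c" and ny: "nearness y (dirv (t + d)) \<ge> c" and xS: "x \<in> \<Phi> \<omega>" and yS: "y \<in> \<Phi> \<omega>"
    using nearest_ge[OF norm_dirv] x y by auto
  have pos: "z \<bullet> dirv t > 0" if "nearness z (dirv t) \<ge> c / 2" for z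
  proof -
    have "0 < nearness z (dirv t)" using that c by linarith
    then show ?thesis by (rule nearness_pos)
  qed
  have lt: "height_coord r t z < T" if zc: "nearness z (dirv t) \<ge> c / 2" for z
  proof (rule ccontr)
    assume "\<not> height_coord r t z < T"
    then have "sqrt (1 + s\<^sup>2 * T) \<le> sqrt (1 + s\<^sup>2 * height_coord r t z)" by (intro real_sqrt_le_mono add_left_mono mult_left_mono) auto
    with T have lt: "1 / (r * c) < sqrt (1 + s\<^sup>2 * height_coord r t z)" by linarith
    have "c / 2 \<le> 1 / (2 * r * sqrt (1 + s\<^sup>2 * height_coord r t z))" using zc nearness_chart(2)[OF r pos[OF zc]] by simp
    moreover have "0 < sqrt (1 + s\<^sup>2 * height_coord r t z)" using nearness_chart(1)[OF r pos[OF zc]] by simp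
    ultimately have "sqrt (1 + s\<^sup>2 * height_coord r t z) \<le> 1 / (r * c)" using r c by (simp add: field_simps)
    then show False using lt by simp
  qed
  have mono: "height_coord r t z \<le> height_coord r t z'" if "z \<bullet> dirv t > 0" "z' \<bullet> dirv t > 0" "nearness z' (dirv t) \<le> nearness z (dirv t)" for z z'
  proof -
    have p: "1 + s\<^sup>2 * height_coord r t z > 0" "1 + s\<^sup>2 * height_coord r t z' > 0" using nearness_chart(1)[OF r] that by auto
    have "1 / (2 * r * sqrt (1 + s\<^sup>2 * height_coord r t z')) \<le> 1 / (2 * r * sqrt (1 + s\<^sup>2 * height_coord r t z))"
      using that nearness_chart(2)[OF r] by simp
    then have "sqrt (1 + s\<^sup>2 * height_coord r t z) \<le> sqrt (1 + s\<^sup>2 * height_coord r t z')"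
      using p r by (simp add: field_simps)
    then show ?thesis using s by simp
  qed
  have xp: "x \<bullet> dirv t > 0" using pos nx c by simp
  show "\<forall>z\<in>\<Phi> \<omega>. z \<bullet> dirv t > 0 \<longrightarrow> height_coord r t x \<le> height_coord r t z"
    using mono xp x by (auto simp: nearest_def)
  have nyt: "nearness y (dirv t) \<ge> c / 2"
  proof -
    have "nearness y (dirv (t + d)) - nearness y (dirv t) \<le> norm (dirv (t + d) - dirv t) / (2 * r)"
      unfolding nearness_diff[symmetric] by (rule nearness_le_rho[OF yS])
    also have "\<dots> \<le> d / (2 * r)" using norm_dirv_diff_le[of "t + d" t] d r by (intro divide_right_mono) auto
    also have "\<dots> \<le> c / 2" using d r by (simp add: field_simps)
    finally show ?thesis using ny by linarith
  qed
  have yp: "y \<bullet> dirv t > 0" using pos nyt by simp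
  have xy: "height_coord r t x \<le> height_coord r t y" using mono[OF xp yp] x yS by (auto simp: nearest_def)
  have cd: "cos d > 0" using d by (intro cos_gt_zero_pi) auto
  have px: "sqrt (1 + s\<^sup>2 * height_coord r t x) > 0" and py: "sqrt (1 + s\<^sup>2 * height_coord r t y) > 0"
    using nearness_chart(1)[OF r xp] nearness_chart(1)[OF r yp] by auto
  have "nearness x (dirv (t + d)) \<le> nearness y (dirv (t + d))" using y xS by (auto simp: nearest_def)
  then have "cos d * (1 + s\<^sup>2 * (tan d / s) * width_coord r t x) / (2 * r * sqrt (1 + s\<^sup>2 * height_coord r t x))
    \<le> cos d * (1 + s\<^sup>2 * (tan d / s) * width_coord r t y) / (2 * r * sqrt (1 + s\<^sup>2 * height_coord r t y))"
    unfolding nearness_rotate_eq[OF xp cd] nearness_rotate_eq[OF yp cd] .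
  then have "(cos d * (1 + s\<^sup>2 * (tan d / s) * width_coord r t x)) * (2 * r * sqrt (1 + s\<^sup>2 * height_coord r t y))
    \<le> (cos d * (1 + s\<^sup>2 * (tan d / s) * width_coord r t y)) * (2 * r * sqrt (1 + s\<^sup>2 * height_coord r t x))"
    using px py r by (intro divide_le_cross) auto
  then have "(cos d * (2 * r)) * (sqrt (1 + s\<^sup>2 * height_coord r t y) * (1 + s\<^sup>2 * (tan d / s) * width_coord r t x))
    \<le> (cos d * (2 * r)) * (sqrt (1 + s\<^sup>2 * height_coord r t x) * (1 + s\<^sup>2 * (tan d / s) * width_coord r t y))"
    by (simp only: mult_ac)
  then have "sqrt (1 + s\<^sup>2 * height_coord r t y) * (1 + s\<^sup>2 * (tan d / s) * width_coord r t x)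
    \<le> sqrt (1 + s\<^sup>2 * height_coord r t x) * (1 + s\<^sup>2 * (tan d / s) * width_coord r t y)"
    using cd r mult_le_cancel_left_pos[of "cos d * (2 * r)"] by simp
  then show "tilted t (tan d / s) T x y" unfolding tilted_def using xp yp xy lt nx nyt c by auto
qed

text \<open>Fatou's lemma is applied twice: to finer and finer grids of directions for fixed \<open>B\<close>, and then to
  \<open>B\<close> tending to infinity.\<close>

lemma upper_expectation:
  assumes r1: "r \<ge> 1" and Y: "AE \<omega> in M. norm (Y \<omega>) = 2 * r"
    and num: "(\<lambda>\<omega>. num_sides (voronoi_cell (insert (Y \<omega>) (\<Phi> \<omega>)))) \<in> measurable M (count_space UNIV)"
    and K: "\<And>T. T > 0 \<Longrightarrow> upper_rate T \<le> K"
  shows "(\<integral>\<^sup>+\<omega>. ennreal (real (num_sides (voronoi_cell (insert (Y \<omega>) (\<Phi> \<omega>))))) \<partial>M) \<le> ennreal (2 + 2 * pi / s * K)"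
proof -
  have s: "s > 0" using angle_scale[OF r] by simp
  define nn where "nn \<omega> = ennreal (real (num_sides (voronoi_cell (insert (Y \<omega>) (\<Phi> \<omega>)))))" for \<omega>
  have nnm [measurable]: "nn \<in> borel_measurable M"
    unfolding nn_def using measurable_compose[OF num, of "\<lambda>k. ennreal (real k)" borel] by simp
  have step: "(\<integral>\<^sup>+\<omega>. nn \<omega> * indicator (around B) \<omega> \<partial>M) \<le> ennreal (2 + 2 * pi / s * K)" if B: "B > 0" for B
  proof -
    define c where "c = 1 / (6 * r * sqrt (1 + s\<^sup>2 * B))"
    have c: "c > 0" using r B by (simp add: c_def add_pos_nonneg)
    \<comment> \<open>At height \<open>T\<close> the nearness has dropped below
      \<open>c / 2\<close>, the level used in \<open>nearest_tilted\<close>.\<close>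
    define T where "T = (1 / (r * c))\<^sup>2 / s\<^sup>2"
    have T: "T > 0" using r c s by (simp add: T_def)
    have T': "1 / (r * c) < sqrt (1 + s\<^sup>2 * T)"
      using s r c by (intro real_less_rsqrt) (simp add: T_def)
    define cover where "cover C \<sigma> t G \<longleftrightarrow> (G\<in>events \<and> prob G \<le> \<sigma> * upper_rate T + C * (\<sigma> * sqrt \<sigma>) \<and>
      (\<forall>\<omega>\<in>space M. (\<forall>z\<in>\<Phi> \<omega>. 2 * r < norm z) \<longrightarrow>
      (\<exists>x\<in>\<Phi> \<omega>. \<exists>y\<in>\<Phi> \<omega>. x \<noteq> y \<and> (\<forall>z\<in>\<Phi> \<omega>. z \<bullet> dirv t > 0 \<longrightarrow> height_coord r t x \<le> height_coord r t z) \<and> tilted t \<sigma> T x y) \<longrightarrow> \<omega> \<in> G))" for C \<sigma> t G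
    have "\<exists>C\<ge>0. \<exists>\<sigma>0>0. \<forall>\<sigma>. 0 < \<sigma> \<longrightarrow> \<sigma> \<le> \<sigma>0 \<longrightarrow> (\<forall>t. \<exists>G. cover C \<sigma> t G)"
      using frame_upper[OF T] unfolding cover_def Bex_def[of events] .
    then obtain C \<sigma>0 where C: "C \<ge> 0" "\<sigma>0 > 0"
      and ex: "\<And>\<sigma> t. 0 < \<sigma> \<Longrightarrow> \<sigma> \<le> \<sigma>0 \<Longrightarrow> \<exists>G. cover C \<sigma> t G" by blast
    define G where "G \<sigma> t = (SOME G. cover C \<sigma> t G)" for \<sigma> t
    have "cover C \<sigma> t (G \<sigma> t)" if "0 < \<sigma>" "\<sigma> \<le> \<sigma>0" for \<sigma> t
      unfolding G_def by (rule someI_ex) (rule ex[OF that])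
    note G = this[unfolded cover_def]
    define dl where "dl n = 2 * pi / real n" for n :: nat
    define sg where "sg n = tan (dl n) / s" for n
    define H where "H n k = G (sg n) (2 * pi * real k / real n)" for n k :: nat
    define good where "good n \<longleftrightarrow> n > 0 \<and> 0 < dl n \<and> dl n < pi / 2 \<and> dl n \<le> r * c \<and> 0 < sg n \<and> sg n \<le> \<sigma>0" for n
    \<comment> \<open>The value \<open>0\<close> for grids that are still too coarse keeps
      \<open>u n\<close> measurable for all \<open>n\<close>; almost all \<open>n\<close> are good,
      so the lower limit is not affected.\<close>
    define u where "u n \<omega> = (if good n then 2 + (\<Sum>k<n. indicator (H n k) \<omega>) else (0::ennreal))" for n \<omega>
    have ev_good: "eventually good sequentially"
    proof -
      have d0: "dl \<longlonglongrightarrow> 0" unfolding dl_def by real_asymp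
      have "(\<lambda>n. tan (2 * pi / real n) / s) \<longlonglongrightarrow> 0 / s"
        by (intro tendsto_divide lim_tan_angle tendsto_const) (use s in auto)
      then have sg0: "sg \<longlonglongrightarrow> 0" by (simp add: sg_def[abs_def] dl_def)
      have e1: "eventually (\<lambda>n. dl n < pi / 2) sequentially" using order_tendstoD(2)[OF d0, of "pi / 2"] by simp
      have e2: "eventually (\<lambda>n. dl n < r * c) sequentially" using order_tendstoD(2)[OF d0, of "r * c"] r c by simp
      have e3: "eventually (\<lambda>n. sg n < \<sigma>0) sequentially" using order_tendstoD(2)[OF sg0, of \<sigma>0] C by simp
      have e4: "eventually (\<lambda>n::nat. n > 0) sequentially" by (rule eventually_gt_at_top)
      show ?thesis using e1 e2 e3 e4
      proof eventually_elim
        case (elim n)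
        then have "0 < dl n" by (simp add: dl_def)
        moreover have "0 < tan (dl n)" using \<open>0 < dl n\<close> elim by (intro tan_gt_zero) auto
        ultimately show ?case using elim s by (simp add: good_def sg_def)
      qed
    qed
    have Hev: "H n k \<in> events" if "good n" for n k using G that by (auto simp: H_def good_def)
    have um: "u n \<in> borel_measurable M" for n
      unfolding u_def using Hev by (cases "good n") auto
    have int_u: "(\<integral>\<^sup>+\<omega>. u n \<omega> \<partial>M) \<le> ennreal (2 + real n * (sg n * upper_rate T + C * (sg n * sqrt (sg n))))" if g: "good n" for n
    proof -
      have "(\<integral>\<^sup>+\<omega>. u n \<omega> \<partial>M) = 2 + (\<Sum>k<n. emeasure M (H n k))"
        using g Hev[OF g] by (simp add: u_def nn_integral_add nn_integral_sum emeasure_space_1)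
      also have "\<dots> = ennreal (2 + (\<Sum>k<n. prob (H n k)))"
        by (simp add: emeasure_eq_measure sum_ennreal ennreal_plus sum_nonneg)
      also have "\<dots> \<le> ennreal (2 + (\<Sum>k<n. sg n * upper_rate T + C * (sg n * sqrt (sg n))))"
        using G g by (intro ennreal_leI add_left_mono sum_mono) (auto simp: H_def good_def)
      finally show ?thesis by simp
    qed
    have ptw: "AE \<omega> in M. nn \<omega> * indicator (around B) \<omega> \<le> liminf (\<lambda>n. u n \<omega>)"
      using AE_outside Y AE_space
    proof eventually_elim
      case (elim \<omega>)
      show ?case
      proof (cases "\<omega> \<in> around B")
        case True
        note sur = around_surrounded[OF r1 B True elim(1), folded c_def]
        note sur2 = sur(2)[OF elim(2)]
        obtain n0 where n0: "\<And>n. n \<ge> n0 \<Longrightarrow> num_sides (voronoi_cell (insert (Y \<omega>) (\<Phi> \<omega>)))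
            \<le> card {x \<in> insert (Y \<omega>) (\<Phi> \<omega>). \<exists>k<n. nearest (insert (Y \<omega>) (\<Phi> \<omega>)) (grid n k) = {x}}"
          using surrounded.num_sides_le[OF sur2] by blast
        have "eventually (\<lambda>n. nn \<omega> \<le> u n \<omega>) sequentially"
          using ev_good eventually_ge_at_top[of n0]
        proof eventually_elim
          case g: (elim n)
          let ?A = "{k. k < n \<and> (\<exists>x\<in>nearest (\<Phi> \<omega>) (grid n k). \<exists>y\<in>nearest (\<Phi> \<omega>) (grid n (Suc k)). x \<noteq> y)}"
          have "?A \<subseteq> {k. k < n \<and> \<omega> \<in> H n k}"
          proof clarify
            fix k x y assume k: "k < n" and x: "x \<in> nearest (\<Phi> \<omega>) (grid n k)" and y: "y \<in> nearest (\<Phi> \<omega>) (grid n (Suc k))" and xy: "x \<noteq> y"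
            define t where "t = 2 * pi * real k / real n"
            have gr: "grid n k = dirv t" "grid n (Suc k) = dirv (t + dl n)"
              using g by (auto simp: grid_def t_def dl_def good_def add_divide_distrib algebra_simps)
            have gd: "0 < dl n" "dl n < pi / 2" "dl n \<le> r * c" using g by (auto simp: good_def)
            note tl = nearest_tilted[OF sur(1) gd T' T x[unfolded gr] y[unfolded gr], folded sg_def]
            have "x \<in> \<Phi> \<omega>" "y \<in> \<Phi> \<omega>" using x y by (auto simp: nearest_def)
            then have "\<omega> \<in> G (sg n) t" using G[of "sg n" t] g tl elim xy unfolding good_def by blast
            then show "\<omega> \<in> H n k" using k by (simp add: H_def t_def)
          qed
          then have cA: "card ?A \<le> card {k. k < n \<and> \<omega> \<in> H n k}" by (intro card_mono) auto
          have "num_sides (voronoi_cell (insert (Y \<omega>) (\<Phi> \<omega>))) \<le> 2 + card ?A"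
            using n0[OF g(2)] unique_nearest_card[of "\<Phi> \<omega>" n "Y \<omega>"] surrounded.nearest_nonempty[OF sur(1) norm_grid]
            by (meson order_trans)
          also have "\<dots> \<le> 2 + card {k. k < n \<and> \<omega> \<in> H n k}" using cA by simp
          finally have "real (num_sides (voronoi_cell (insert (Y \<omega>) (\<Phi> \<omega>)))) \<le> real (2 + card {k. k < n \<and> \<omega> \<in> H n k})"
            by simp
          then have "nn \<omega> \<le> ennreal (2 + real (card {k. k < n \<and> \<omega> \<in> H n k}))" unfolding nn_def by (intro ennreal_leI) simp
          also have "\<dots> = 2 + (\<Sum>k<n. indicator (H n k) \<omega>)"
          proof -
            have "(\<Sum>k<n. indicator (H n k) \<omega>) = (\<Sum>k\<in>{k. k < n \<and> \<omega> \<in> H n k}. (1::ennreal))"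
              by (intro sum.mono_neutral_cong_right) (auto simp: indicator_def)
            then show ?thesis by (simp add: ennreal_plus ennreal_of_nat_eq_real_of_nat)
          qed
          finally show ?case using g by (simp add: u_def)
        qed
        then show ?thesis using True by (simp add: Liminf_bounded)
      qed simp
    qed
    have "(\<integral>\<^sup>+\<omega>. nn \<omega> * indicator (around B) \<omega> \<partial>M) \<le> (\<integral>\<^sup>+\<omega>. liminf (\<lambda>n. u n \<omega>) \<partial>M)"
      by (rule nn_integral_mono_AE[OF ptw])
    also have "\<dots> \<le> liminf (\<lambda>n. \<integral>\<^sup>+\<omega>. u n \<omega> \<partial>M)" using um by (rule nn_integral_liminf)
    also have "\<dots> \<le> liminf (\<lambda>n. ennreal (2 + real n * (sg n * upper_rate T + C * (sg n * sqrt (sg n)))))"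
      by (rule Liminf_mono) (use ev_good int_u in \<open>auto elim: eventually_mono\<close>)
    \<comment> \<open>Since \<open>real n * sg n\<close> converges, the errors of order
      \<open>sg n * sqrt (sg n)\<close> vanish even after summation over all \<open>n\<close>
      directions.\<close>
    also have "\<dots> = ennreal (2 + 2 * pi / s * upper_rate T)"
    proof (rule lim_imp_Liminf)
      have l1: "(\<lambda>n. real n * sg n) \<longlonglongrightarrow> 2 * pi / s"
      proof -
        have "(\<lambda>n. real n * tan (2 * pi / real n) / s) \<longlonglongrightarrow> 2 * pi / s"
          by (intro tendsto_divide lim_n_tan_angle tendsto_const) (use s in auto)
        then show ?thesis by (simp add: sg_def dl_def)
      qed
      have l2: "(\<lambda>n. sqrt (sg n)) \<longlonglongrightarrow> 0"
      proof -
        have "(\<lambda>n. tan (2 * pi / real n) / s) \<longlonglongrightarrow> 0 / s"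
          by (intro tendsto_divide lim_tan_angle tendsto_const) (use s in auto)
        then have "(\<lambda>n. sqrt (tan (2 * pi / real n) / s)) \<longlonglongrightarrow> sqrt (0 / s)" by (rule tendsto_real_sqrt)
        then show ?thesis by (simp add: sg_def dl_def)
      qed
      have "(\<lambda>n. 2 + ((real n * sg n) * upper_rate T + C * ((real n * sg n) * sqrt (sg n)))) \<longlonglongrightarrow> 2 + ((2 * pi / s) * upper_rate T + C * ((2 * pi / s) * 0))"
        by (intro tendsto_intros l1 l2)
      then have "(\<lambda>n. 2 + real n * (sg n * upper_rate T + C * (sg n * sqrt (sg n)))) \<longlonglongrightarrow> 2 + 2 * pi / s * upper_rate T"
        by (simp add: algebra_simps)
      then show "((\<lambda>n. ennreal (2 + real n * (sg n * upper_rate T + C * (sg n * sqrt (sg n))))) \<longlongrightarrow> ennreal (2 + 2 * pi / s * upper_rate T)) sequentially"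
        by (intro tendsto_ennrealI)
    qed simp
    also have "\<dots> \<le> ennreal (2 + 2 * pi / s * K)" using K[OF T] s by (intro ennreal_leI add_left_mono mult_left_mono) auto
    finally show ?thesis .
  qed
  have "(\<integral>\<^sup>+\<omega>. nn \<omega> \<partial>M) \<le> (\<integral>\<^sup>+\<omega>. liminf (\<lambda>m::nat. nn \<omega> * indicator (around (real m)) \<omega>) \<partial>M)"
  proof (rule nn_integral_mono_AE)
    show "AE \<omega> in M. nn \<omega> \<le> liminf (\<lambda>m::nat. nn \<omega> * indicator (around (real m)) \<omega>)"
      using AE_around[OF r1]
    proof eventually_elim
      case (elim \<omega>)
      then obtain m0 :: nat where m0: "\<omega> \<in> around (real m0)" by auto
      show ?case
      proof (rule Liminf_bounded)
        show "eventually (\<lambda>m::nat. nn \<omega> \<le> nn \<omega> * indicator (around (real m)) \<omega>) sequentially"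
          using eventually_ge_at_top[of m0]
        proof eventually_elim
          case (elim m)
          then have "\<omega> \<in> around (real m)" using around_mono[of "real m0" "real m"] m0 by auto
          then show ?case by simp
        qed
      qed
    qed
  qed
  also have "\<dots> \<le> liminf (\<lambda>m::nat. \<integral>\<^sup>+\<omega>. nn \<omega> * indicator (around (real m)) \<omega> \<partial>M)"
    by (rule nn_integral_liminf) simp
  also have "\<dots> \<le> liminf (\<lambda>m::nat. ennreal (2 + 2 * pi / s * K))"
  proof (rule Liminf_mono)
    show "eventually (\<lambda>m::nat. (\<integral>\<^sup>+\<omega>. nn \<omega> * indicator (around (real m)) \<omega> \<partial>M) \<le> ennreal (2 + 2 * pi / s * K)) sequentially"
      using eventually_gt_at_top[of "0::nat"] by eventually_elim (rule step, simp)
  qed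
  also have "\<dots> = ennreal (2 + 2 * pi / s * K)" by (simp add: Liminf_const)
  finally show ?thesis by (simp add: nn_def)
qed

end

subsection \<open>Change of the nearest point: lower bound\<close>

text \<open>The expansion of \<open>tilt_upper\<close> read in the other direction. As
  \<open>w \<le> w'\<close> makes \<open>e\<close> nonnegative, both \<open>e\<^sup>2\<close> and
  the factor \<open>1 + s\<^sup>2 * q \<ge> 1\<close> of the linear gain may be dropped; the only
  loss is \<open>2 * (e * y) * (1 + y) \<le> 4 * m\<^sup>2 * (1 + y)\<^sup>2\<close>.\<close>

lemma tilt_lower:
  fixes s \<sigma> q q' w w' T :: real
  assumes T: "0 \<le> T" "\<bar>w\<bar> \<le> sqrt T" "\<bar>w'\<bar> \<le> sqrt T" and q: "0 \<le> q" "q \<le> T" "0 \<le> q'" and \<sigma>: "0 \<le> \<sigma>" and s: "s > 0"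
    and small: "s\<^sup>2 * \<sigma> * sqrt T \<le> 1 / 2" and ww: "w \<le> w'"
    and lt: "q' < q + 2 * \<sigma> * (w' - w) - 4 * s\<^sup>2 * \<sigma>\<^sup>2 * T * (1 + s\<^sup>2 * T)"
  shows "sqrt (1 + s\<^sup>2 * q') * (1 + s\<^sup>2 * \<sigma> * w) < sqrt (1 + s\<^sup>2 * q) * (1 + s\<^sup>2 * \<sigma> * w')"
proof -
  define m y y' where "m = s\<^sup>2 * \<sigma> * sqrt T" and "y = s\<^sup>2 * \<sigma> * w" and "y' = s\<^sup>2 * \<sigma> * w'"
  have m: "0 \<le> m" "m \<le> 1 / 2" using small \<sigma> T by (auto simp: m_def)
  have s\<sigma>: "0 \<le> s\<^sup>2 * \<sigma>" using \<sigma> by simp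
  have y: "\<bar>y\<bar> \<le> m" "\<bar>y'\<bar> \<le> m"
    using T mult_left_mono[OF T(2) s\<sigma>] mult_left_mono[OF T(3) s\<sigma>] s\<sigma> \<sigma>
    by (auto simp: y_def y'_def m_def abs_mult)
  have p: "1 + y \<ge> 1 / 2" "1 + y' \<ge> 1 / 2" using y m by linarith+
  define e where "e = y' - y"
  have e: "0 \<le> e" "e \<le> 2 * m" using y mult_left_mono[OF ww s\<sigma>] by (auto simp: e_def y_def y'_def)
  have mm: "m\<^sup>2 = s\<^sup>2 * (s\<^sup>2 * \<sigma>\<^sup>2 * T)" using T by (simp add: m_def power_mult_distrib power2_eq_square)
  have L: "1 \<le> 1 + s\<^sup>2 * q" "1 + s\<^sup>2 * q \<le> 1 + s\<^sup>2 * T" using q by (auto intro: mult_left_mono)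
  have ineq: "(1 + 2 * e - 4 * m\<^sup>2) * (1 + y)\<^sup>2 \<le> (1 + y')\<^sup>2"
  proof -
    have "(1 + y')\<^sup>2 = (1 + y)\<^sup>2 + 2 * e * (1 + y) + e\<^sup>2" by (simp add: e_def power2_eq_square algebra_simps)
    moreover have "2 * e * (1 + y) = 2 * e * (1 + y)\<^sup>2 - 2 * (e * y) * (1 + y)" by (simp add: power2_eq_square algebra_simps)
    moreover have "2 * (e * y) * (1 + y) \<le> 4 * m\<^sup>2 * (1 + y)\<^sup>2"
    proof (cases "y \<ge> 0")
      case True
      have "2 * (e * y) * (1 + y) \<le> 2 * ((2 * m) * m) * (1 + y)"
        using True y e m by (intro mult_right_mono mult_left_mono mult_mono) auto
      also have "\<dots> = 4 * m\<^sup>2 * ((1 + y) * 1)" by (simp add: power2_eq_square)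
      also have "\<dots> \<le> 4 * m\<^sup>2 * ((1 + y) * (1 + y))" using True by (intro mult_left_mono) auto
      finally show ?thesis by (simp add: power2_eq_square)
    next
      case False
      then have "e * y \<le> 0" using e by (simp add: mult_nonneg_nonpos)
      then have "2 * (e * y) * (1 + y) \<le> 0" using p by (simp add: mult_nonpos_nonneg)
      then show ?thesis by (rule order_trans) simp
    qed
    ultimately show ?thesis using zero_le_power2[of e] unfolding distrib_right left_diff_distrib by linarith
  qed
  have "1 + s\<^sup>2 * q' < (1 + s\<^sup>2 * q) + 2 * e - 4 * m\<^sup>2 * (1 + s\<^sup>2 * T)"
  proof -
    have "s\<^sup>2 * q' < s\<^sup>2 * (q + 2 * \<sigma> * (w' - w) - 4 * s\<^sup>2 * \<sigma>\<^sup>2 * T * (1 + s\<^sup>2 * T))" using lt s by simp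
    then show ?thesis unfolding mm by (simp add: e_def y_def y'_def algebra_simps)
  qed
  also have "\<dots> \<le> (1 + s\<^sup>2 * q) + (1 + s\<^sup>2 * q) * (2 * e) - (1 + s\<^sup>2 * q) * (4 * m\<^sup>2)"
    using mult_right_mono[OF L(1), of "2 * e"] mult_right_mono[OF L(2), of "4 * m\<^sup>2"] e by (simp add: mult_ac)
  also have "\<dots> = (1 + s\<^sup>2 * q) * (1 + 2 * e - 4 * m\<^sup>2)" by (simp add: algebra_simps)
  finally have "(1 + s\<^sup>2 * q') * (1 + y)\<^sup>2 < (1 + s\<^sup>2 * q) * (1 + 2 * e - 4 * m\<^sup>2) * (1 + y)\<^sup>2"
    using p by (intro mult_strict_right_mono) auto
  also have "\<dots> \<le> (1 + s\<^sup>2 * q) * (1 + y')\<^sup>2" using ineq L by (simp add: mult.assoc mult_left_mono)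
  finally have "(sqrt (1 + s\<^sup>2 * q') * (1 + y))\<^sup>2 < (sqrt (1 + s\<^sup>2 * q) * (1 + y'))\<^sup>2"
    using q by (simp add: power_mult_distrib)
  then show ?thesis unfolding y_def y'_def
    using p q by (intro power2_less_imp_less[of "_ * (1 + s\<^sup>2 * \<sigma> * w)"]) (auto simp: y'_def)
qed


text \<open>An upper bound for the probability that the region below \<open>(q, w)\<close> and the
  swept triangle are both empty: the second exponential is expanded by
  \<open>exp (- y) \<le> 1 - y + y\<^sup>2 / 2\<close>, and
  \<open>32 * e\<^sup>2 * T\<^sup>2\<close> is half the square of the largest possible
  \<open>y\<close>, namely \<open>8 * e * T\<close>. The second order is needed because the term
  linear in \<open>e\<close> carries the result.\<close>

definition lower_integrand :: "real \<Rightarrow> real \<Rightarrow> real \<times> real \<Rightarrow> real" where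
  "lower_integrand e T z = exp (- (8 / 3 * (fst z * sqrt (fst z)))) * (1 - 2 * e * (sqrt (fst z) - snd z)\<^sup>2 + 32 * e\<^sup>2 * T\<^sup>2)"

text \<open>Every point here beats any point of the square \<open>c\<close> in one of the two
  directions. Of the margin \<open>3 * e * h\<close>, a part \<open>2 * e * h\<close> pays for
  measuring the width from the corner of the square, and \<open>e * h\<close> for the quadratic
  error of \<open>tilt_lower\<close>. The bound on the height keeps the set bounded; the bound on
  the width keeps it inside one sector, for independence.\<close>

definition front :: "real \<Rightarrow> real \<Rightarrow> real \<Rightarrow> int \<times> int \<Rightarrow> (real \<times> real) set" where
  "front T e h c = {z \<in> below (T + 2 * e * (2 * sqrt T + 1)). \<bar>snd z\<bar> < sqrt T \<and>
     fst z < real_of_int (fst c) * h + 2 * e * max 0 (snd z - real_of_int (snd c) * h) - 3 * e * h}"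

lemma front_borel [measurable]: "front T e h c \<in> sets borel"
proof -
  have "front T e h c = below (T + 2 * e * (2 * sqrt T + 1)) \<inter> {z. \<bar>snd z\<bar> < sqrt T} \<inter>
     {z. fst z < real_of_int (fst c) * h + 2 * e * max 0 (snd z - real_of_int (snd c) * h) - 3 * e * h}"
    by (auto simp: front_def)
  moreover have "{z :: real \<times> real. \<bar>snd z\<bar> < sqrt T} \<in> sets borel"
    "{z :: real \<times> real. fst z < real_of_int (fst c) * h + 2 * e * max 0 (snd z - real_of_int (snd c) * h) - 3 * e * h} \<in> sets borel"
    by (intro borel_open open_Collect_less continuous_intros)+
  ultimately show ?thesis by auto
qed

lemma front_bounded: "bounded (front T e h c)"
  by (rule bounded_below_subset[of _ "T + 2 * e * (2 * sqrt T + 1)"]) (auto simp: front_def)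

text \<open>The cap \<open>below q\<close> and the triangle \<open>Tr\<close> of area
  \<open>e * (sqrt q - w)\<^sup>2\<close> are disjoint and covered by the front and a layer
  \<open>Bd\<close>. The layer has height \<open>h + 3 * e * h\<close>: the distance in height from
  \<open>(q, w)\<close> to the corner of its square, plus the margin of the front.\<close>

lemma front_area:
  assumes T: "T > 0" and e: "e > 0" and h: "0 < h" "h \<le> 1" and c: "(q, w) \<in> cell h T c"
  shows "4 / 3 * (q * sqrt q) + e * (sqrt q - w)\<^sup>2 - 2 * sqrt T * (h + 3 * e * h) \<le> measure lborel (front T e h c)"
proof -
  have qw: "(q, w) \<in> below T" using c by (simp add: cell_def)
  note b = below_w[OF qw] and cb = cell_bounds[OF h(1), of q w T "fst c" "snd c"]
  have cb: "real_of_int (fst c) * h \<le> q" "q < real_of_int (fst c) * h + h" "real_of_int (snd c) * h \<le> w" "w < real_of_int (snd c) * h + h" using cb c by auto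
  define \<eta> where "\<eta> = h + 3 * e * h"
  have \<eta>: "\<eta> \<ge> 0" using h e by (simp add: \<eta>_def)
  define Tr where "Tr = {z::real\<times>real. w < snd z \<and> snd z < sqrt q \<and> q \<le> fst z \<and> fst z < q + 2 * e * (snd z - w)}"
  define Bd where "Bd = {z::real\<times>real. - sqrt T \<le> snd z \<and> snd z \<le> sqrt T \<and> q + 2 * e * max 0 (snd z - w) - \<eta> \<le> fst z \<and> fst z \<le> q + 2 * e * max 0 (snd z - w)}"
  have bB: "Bd \<in> sets borel"
  proof -
    have "Bd = {z. - sqrt T \<le> snd z} \<inter> {z. snd z \<le> sqrt T} \<inter> {z. q + 2 * e * max 0 (snd z - w) - \<eta> \<le> fst z} \<inter> {z. fst z \<le> q + 2 * e * max 0 (snd z - w)}"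
      by (auto simp: Bd_def)
    also have "\<dots> \<in> sets borel" by (intro sets.Int borel_closed closed_Collect_le continuous_intros)
    finally show ?thesis .
  qed
  have bT: "Tr \<in> sets borel"
  proof -
    have "Tr = {z. w < snd z} \<inter> {z. snd z < sqrt q} \<inter> {z. q \<le> fst z} \<inter> {z. fst z < q + 2 * e * (snd z - w)}"
      by (auto simp: Tr_def)
    also have "\<dots> \<in> sets borel"
      by (intro sets.Int borel_closed closed_Collect_le borel_open open_Collect_less continuous_intros)
    finally show ?thesis .
  qed
  have Tbd: "bounded Tr"
  proof -
    have "Tr \<subseteq> cbox (q, w) (q + 2 * e * (sqrt q - w), sqrt q)"
    proof
      fix z assume z: "z \<in> Tr"
      then have "2 * e * (snd z - w) \<le> 2 * e * (sqrt q - w)" using e by (intro mult_left_mono) (auto simp: Tr_def)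
      then show "z \<in> cbox (q, w) (q + 2 * e * (sqrt q - w), sqrt q)" using z by (cases z) (auto simp: Tr_def cbox_Pair_eq)
    qed
    then show ?thesis using bounded_cbox bounded_subset by blast
  qed
  have aT: "e * (sqrt q - w)\<^sup>2 \<le> measure lborel Tr"
  proof -
    have "(\<lambda>v. e * (v - w)\<^sup>2) (sqrt q) - (\<lambda>v. e * (v - w)\<^sup>2) w \<le> measure lborel (Tr \<union> cbox (q, w) (q, w))"
    proof (rule area_ge[where f = "\<lambda>v. q" and g = "\<lambda>v. q + 2 * e * (v - w)" and F = "\<lambda>v. e * (v - w)\<^sup>2"])
      show "{(q', v). w \<le> v \<and> v < sqrt q \<and> q < q' \<and> q' < q + 2 * e * (v - w)} \<subseteq> Tr \<union> cbox (q, w) (q, w)"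
        by (auto simp: Tr_def less_le)
    qed (use bT Tbd b e in \<open>auto intro!: derivative_eq_intros\<close>)
    also have "\<dots> \<le> measure lborel Tr + measure lborel (cbox (q, w) (q, w))"
      using bT by (intro measure_Un_le) auto
    also have "measure lborel (cbox (q, w) (q, w)) = 0" by simp
    finally show ?thesis by simp
  qed
  have aB: "measure lborel Bd \<le> 2 * sqrt T * \<eta>"
  proof -
    have "measure lborel Bd \<le> (\<lambda>v. \<eta> * v) (sqrt T) - (\<lambda>v. \<eta> * v) (- sqrt T)"
      by (rule area_le[where f = "\<lambda>v. q + 2 * e * max 0 (v - w) - \<eta>" and g = "\<lambda>v. q + 2 * e * max 0 (v - w)" and F = "\<lambda>v. \<eta> * v"])
         (use bB \<eta> T in \<open>auto simp: Bd_def intro!: derivative_eq_intros\<close>)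
    then show ?thesis by (simp add: algebra_simps)
  qed
  have aq: "4 / 3 * (q * sqrt q) \<le> measure lborel (below q)"
  proof -
    have "2 * sqrt q * q - 2 / 3 * sqrt q ^ 3 \<le> measure lborel {z \<in> below q. \<bar>snd z\<bar> < sqrt q}"
      by (rule area_below_ge(1)) (use b in auto)
    also have "\<dots> \<le> measure lborel (below q)"
      using area_below_ge(2)[of q "sqrt q", OF _ _ _ refl] b emeasure_bounded_finite[OF below_bounded]
      by (intro measure_mono_fmeasurable) (auto intro!: fmeasurableI)
    finally show ?thesis using b by (simp add: power3_eq_cube)
  qed
  have "below q \<inter> Tr = {}" by (auto simp: below_def Tr_def)
  then have "measure lborel (below q) + measure lborel Tr = measure lborel (below q \<union> Tr)"
    using bT emeasure_bounded_finite[OF below_bounded, of q] emeasure_bounded_finite[OF Tbd]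
    by (intro measure_Union[symmetric]) auto
  also have "\<dots> \<le> measure lborel (front T e h c \<union> Bd)"
  proof (rule measure_mono_fmeasurable)
    have "Bd \<in> fmeasurable lborel"
    proof (rule fmeasurableI)
      have "bounded Bd"
      proof -
        have "Bd \<subseteq> cbox (q - \<eta>, - sqrt T) (q + 2 * e * (2 * sqrt T), sqrt T)"
        proof
          fix z assume z: "z \<in> Bd"
          have "snd z \<le> sqrt T" using z by (simp add: Bd_def)
          then have "snd z - w \<le> 2 * sqrt T" using b(1,2) by linarith
          then have "max 0 (snd z - w) \<le> 2 * sqrt T" using T by simp
          then have "2 * e * max 0 (snd z - w) \<le> 2 * e * (2 * sqrt T)" using e by (intro mult_left_mono) auto
          moreover have "0 \<le> 2 * e * max 0 (snd z - w)" using e by simp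
          ultimately show "z \<in> cbox (q - \<eta>, - sqrt T) (q + 2 * e * (2 * sqrt T), sqrt T)"
            using z by (cases z) (auto simp: Bd_def cbox_Pair_eq)
        qed
        then show ?thesis using bounded_cbox bounded_subset by blast
      qed
      then show "emeasure lborel Bd < \<infinity>" by (rule emeasure_bounded_finite)
    qed (use bB in simp)
    moreover have "front T e h c \<in> fmeasurable lborel"
      using emeasure_bounded_finite[OF front_bounded] by (intro fmeasurableI) auto
    ultimately show "front T e h c \<union> Bd \<in> fmeasurable lborel" by auto
    show "below q \<union> Tr \<subseteq> front T e h c \<union> Bd"
    proof
      fix z assume z: "z \<in> below q \<union> Tr"
      obtain q' v where zz: "z = (q', v)" by (cases z)
      have v: "\<bar>v\<bar> < sqrt q" "v\<^sup>2 < q'" "q' < q + 2 * e * max 0 (v - w)"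
      proof -
        have "\<bar>v\<bar> < sqrt q \<and> v\<^sup>2 < q' \<and> q' < q + 2 * e * max 0 (v - w)"
          using z unfolding Un_iff
        proof
          assume "z \<in> below q"
          then have "(q', v) \<in> below q" by (simp add: zz)
          from below_w[OF this] this show ?thesis using e by (auto simp: below_iff intro: order_less_le_trans add_strict_increasing2)
        next
          assume "z \<in> Tr"
          then have tv: "w < v" "v < sqrt q" "q \<le> q'" "q' < q + 2 * e * (v - w)" by (auto simp: Tr_def zz)
          have av: "\<bar>v\<bar> < sqrt q" using tv b(1) by linarith
          then have "v\<^sup>2 < (sqrt q)\<^sup>2" using power_strict_mono[of "\<bar>v\<bar>" "sqrt q" 2] by simp
          then have "v\<^sup>2 < q'" using tv b by simp
          then show ?thesis using av tv by simp
        qed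
        then show "\<bar>v\<bar> < sqrt q" "v\<^sup>2 < q'" "q' < q + 2 * e * max 0 (v - w)" by auto
      qed
      have vT: "\<bar>v\<bar> < sqrt T" using v(1) b(2) by linarith
      show "z \<in> front T e h c \<union> Bd"
      proof (cases "q' < q + 2 * e * max 0 (v - w) - \<eta>")
        case True
        have "v - w \<le> 2 * sqrt T" using vT b(1,2) by linarith
        then have m: "max 0 (v - w) \<le> max 0 (v - real_of_int (snd c) * h)" "max 0 (v - w) \<le> 2 * sqrt T" using cb T by auto
        then have m': "2 * e * max 0 (v - w) \<le> 2 * e * max 0 (v - real_of_int (snd c) * h)" "2 * e * max 0 (v - w) \<le> 2 * e * (2 * sqrt T + 1)"
          using e by (auto intro!: mult_left_mono)
        then have "q' < T + 2 * e * (2 * sqrt T + 1)" using v(3) b(4) by linarith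
        moreover have "q' < real_of_int (fst c) * h + 2 * e * max 0 (v - real_of_int (snd c) * h) - 3 * e * h"
          using True cb(2) m'(1) unfolding \<eta>_def by linarith
        ultimately have "z \<in> front T e h c" using v vT by (simp add: front_def zz below_iff)
        then show ?thesis ..
      next
        case False
        then have "z \<in> Bd" using v vT by (auto simp: Bd_def zz)
        then show ?thesis ..
      qed
    qed
  qed (use bT in auto)
  also have "\<dots> \<le> measure lborel (front T e h c) + measure lborel Bd"
    using bB by (intro measure_Un_le) auto
  finally show ?thesis using aT aB aq unfolding \<eta>_def by linarith
qed

context poisson_outside
begin

text \<open>On this event the nearest point in direction \<open>dirv t\<close> has height below \<open>T\<close>, and every candidate
  \<open>c\<close> for its cell has a point in \<open>front T e h c\<close>, which is nearer either in direction \<open>dirv t\<close> or in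
  the next direction.\<close>

definition turn :: "real \<Rightarrow> real \<Rightarrow> real \<Rightarrow> real \<Rightarrow> 'w set" where
  "turn T e h t = (space M - void (chart r t (below T)))
     - (\<Union>c\<in>cell_index h T. void (chart r t (front T e h c)) - void (chart r t (cell h T c)))"

lemma turn_event [measurable]: "turn T e h t \<in> events"
  unfolding turn_def
  by (intro sets.Diff sets.top sets.finite_UN void_chart_event below_borel below_bounded front_borel front_bounded cell_borel cell_bounded finite_cell_index)

text \<open>A union bound over the squares, which loses little: the front contains nearly everything
  below its square, so the events "occupied square with empty front" nearly specify the lowest
  point. The factor \<open>exp \<rho>\<close> collects the deviation of the density from
  \<open>2\<close> and the layer lost in \<open>front_area\<close>.\<close>

lemma turn_prob:
  assumes T: "T > 0" and e: "e > 0" and h: "0 < h" "h \<le> 1"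
    and \<rho>: "\<rho> = (2 - 2 / (1 + s\<^sup>2 * T)\<^sup>2) * (4 / 3 * (T * sqrt T) + 4 * e * T) + 4 * sqrt T * (h + 3 * e * h)"
    and e1: "32 * e * T \<le> 4"
  shows "prob (turn T e h t) \<ge> 1 - exp \<rho> * (exp (- (8 / 3 * (T * sqrt T))) + 2 * (\<integral>z. lower_integrand e T z * indicator (below T) z \<partial>lborel))"
proof -
  have s: "s > 0" using angle_scale[OF r] by simp
  define l where "l = 2 / (1 + s\<^sup>2 * T)\<^sup>2"
  have "1 \<le> (1 + s\<^sup>2 * T)\<^sup>2" using T by (simp add: one_le_power)
  then have l: "0 < l" "l \<le> 2" by (auto simp: l_def divide_le_eq)
  define X where "X = 4 / 3 * (T * sqrt T) + 4 * e * T"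
  have X: "X \<ge> 0" using T e by (simp add: X_def)
  have \<rho>': "\<rho> = (2 - l) * X + 4 * sqrt T * (h + 3 * e * h)" by (simp add: \<rho> l_def X_def)
  have \<rho>0: "(2 - l) * X \<le> \<rho>" using T h e by (simp add: \<rho>')
  \<comment> \<open>Using the lower density \<open>l\<close> instead of \<open>2\<close> costs at
    most \<open>(2 - l) * X\<close>, uniformly for areas up to \<open>X\<close>.\<close>
  have lX: "- (l * x) \<le> - (2 * x) + (2 - l) * X" if "x \<le> X" for x
    using mult_left_mono[OF that, of "2 - l"] l by (simp add: algebra_simps)
  have eX: "exp (- (l * x)) \<le> exp \<rho> * exp (- (2 * x))" if "x \<le> X" for x
    using lX[OF that] \<rho>0 unfolding exp_add[symmetric] by simp
  have KT: "exp (- chart_mass r (below T)) \<le> exp \<rho> * exp (- (8 / 3 * (T * sqrt T)))"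
  proof -
    have "8 / 3 * (T * sqrt T) / (1 + s\<^sup>2 * T)\<^sup>2 \<le> chart_mass r (below T)" using cap_mass_ge[of T r] T by (simp add: cap_mass_def)
    then have "l * (4 / 3 * (T * sqrt T)) \<le> chart_mass r (below T)" by (simp add: l_def)
    then have "exp (- chart_mass r (below T)) \<le> exp (- (l * (4 / 3 * (T * sqrt T))))" by simp
    also have "\<dots> \<le> exp \<rho> * exp (- (2 * (4 / 3 * (T * sqrt T))))" by (rule eX) (use e T in \<open>simp add: X_def\<close>)
    finally show ?thesis by simp
  qed
  define k where "k c = exp (- chart_mass r (front T e h c))" for c
  let ?U = "\<Union>c\<in>cell_index h T. void (chart r t (front T e h c)) - void (chart r t (cell h T c))"
  have ev: "void (chart r t (front T e h c)) \<in> events" "void (chart r t (cell h T c)) \<in> events" "void (chart r t (below T)) \<in> events" for c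
    by (intro void_chart_event below_borel below_bounded front_borel front_bounded cell_borel cell_bounded)+
  have lower_integrand_nn: "0 \<le> lower_integrand e T z" "lower_integrand e T z \<le> 1 + 32 * e\<^sup>2 * T\<^sup>2" if "z \<in> below T" for z
  proof -
    obtain q w where zz: "z = (q, w)" by (cases z)
    note g = below_gap[OF that[unfolded zz]] and b = below_w[OF that[unfolded zz]]
    have "2 * e * (sqrt q - w)\<^sup>2 \<le> 2 * e * (4 * T)" using g e by (intro mult_left_mono) auto
    then have "2 * e * (sqrt q - w)\<^sup>2 \<le> 1" using e1 by simp
    then show "0 \<le> lower_integrand e T z" by (simp add: lower_integrand_def zz)
    have "lower_integrand e T z \<le> 1 * (1 + 32 * e\<^sup>2 * T\<^sup>2)"
      unfolding lower_integrand_def zz fst_conv snd_conv using b e \<open>2 * e * (sqrt q - w)\<^sup>2 \<le> 1\<close> by (intro mult_mono) auto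
    then show "lower_integrand e T z \<le> 1 + 32 * e\<^sup>2 * T\<^sup>2" by simp
  qed
  have kf: "k c \<le> exp \<rho> * lower_integrand e T z" if zc: "z \<in> cell h T c" for c z
  proof -
    obtain q w where zz: "z = (q, w)" by (cases z)
    have qw: "(q, w) \<in> below T" using zc by (simp add: cell_def zz)
    note g = below_gap[OF qw] and b = below_w[OF qw]
    define x where "x = 4 / 3 * (q * sqrt q) + e * (sqrt q - w)\<^sup>2"
    have xX: "x \<le> X"
    proof -
      have "q * sqrt q \<le> T * sqrt T" using b by (intro mult_mono) auto
      moreover have "e * (sqrt q - w)\<^sup>2 \<le> e * (4 * T)" using g e by (intro mult_left_mono) auto
      ultimately show ?thesis by (simp add: x_def X_def)
    qed
    have "l * measure lborel (front T e h c) \<le> chart_mass r (front T e h c)"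
    proof -
      have "2 / (1 + s\<^sup>2 * (sqrt T)\<^sup>2)\<^sup>2 * measure lborel (front T e h c) \<le> chart_mass r (front T e h c)"
        by (rule chart_mass_ge[OF front_borel front_bounded]) (auto simp: front_def below_def)
      then show ?thesis using T by (simp add: l_def)
    qed
    moreover have "l * (x - 2 * sqrt T * (h + 3 * e * h)) \<le> l * measure lborel (front T e h c)"
      using front_area[OF T e h zc[unfolded zz]] l by (intro mult_left_mono) (auto simp: x_def)
    moreover have "l * (2 * sqrt T * (h + 3 * e * h)) \<le> 2 * (2 * sqrt T * (h + 3 * e * h))"
      using l T h e by (intro mult_right_mono) auto
    ultimately have "- chart_mass r (front T e h c) \<le> - (l * x) + 4 * sqrt T * (h + 3 * e * h)"
      by (simp add: right_diff_distrib)
    also have "\<dots> \<le> - (2 * x) + \<rho>" using lX[OF xX] by (simp add: \<rho>')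
    finally have "k c \<le> exp (\<rho> + (- (2 * x)))" by (simp add: k_def)
    also have "\<dots> = exp \<rho> * exp (- (2 * x))" by (rule exp_add)
    also have "exp (- (2 * x)) = exp (- (8 / 3 * (q * sqrt q))) * exp (- (2 * e * (sqrt q - w)\<^sup>2))"
      by (simp add: x_def exp_add[symmetric])
    also have "exp (- (2 * e * (sqrt q - w)\<^sup>2)) \<le> 1 - 2 * e * (sqrt q - w)\<^sup>2 + 32 * e\<^sup>2 * T\<^sup>2"
    proof -
      define y where "y = 2 * e * (sqrt q - w)\<^sup>2"
      have y: "0 \<le> y" "y \<le> 8 * e * T" using e g mult_left_mono[OF g(3), of "2 * e"] by (auto simp: y_def)
      have "exp (- y) \<le> 1 - y + y\<^sup>2 / 2"
      proof -
        define f where "f v = 1 - v + v\<^sup>2 / 2 - exp (- v)" for v :: real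
        have "f 0 \<le> f y"
        proof (rule DERIV_nonneg_imp_nondecreasing[OF y(1)])
          fix v :: real
          have "(f has_real_derivative (- 1 + v + exp (- v))) (at v)"
            unfolding f_def by (auto intro!: derivative_eq_intros)
          moreover have "- 1 + v + exp (- v) \<ge> 0" using exp_ge_add_one_self[of "- v"] by simp
          ultimately show "\<exists>y. (f has_real_derivative y) (at v) \<and> 0 \<le> y" by blast
        qed
        then show ?thesis by (simp add: f_def)
      qed
      moreover have "y\<^sup>2 \<le> (8 * e * T)\<^sup>2" using y by (intro power_mono) auto
      ultimately show ?thesis unfolding y_def[symmetric] by (simp add: power_mult_distrib)
    qed
    finally show "k c \<le> exp \<rho> * lower_integrand e T z" by (simp add: lower_integrand_def zz mult_left_mono)
  qed
  have "space M - turn T e h t \<subseteq> void (chart r t (below T)) \<union> ?U" by (auto simp: turn_def)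
  then have "prob (space M - turn T e h t) \<le> prob (void (chart r t (below T)) \<union> ?U)"
    using ev by (intro finite_measure_mono sets.Un sets.finite_UN) auto
  also have "\<dots> \<le> prob (void (chart r t (below T))) + prob ?U"
    using ev by (intro measure_Un_le sets.finite_UN) auto
  also have "prob ?U \<le> (\<Sum>c\<in>cell_index h T. prob (void (chart r t (front T e h c)) - void (chart r t (cell h T c))))"
    using ev by (intro finite_measure_subadditive_finite) auto
  also have "\<dots> \<le> (\<Sum>c\<in>cell_index h T. k c * chart_mass r (cell h T c))"
    unfolding k_def by (intro sum_mono cell_prob2 front_borel front_bounded cell_borel cell_bounded)
  also have "\<dots> \<le> 2 * (\<integral>z. (exp \<rho> * lower_integrand e T z) * indicator (below T) z \<partial>lborel)"
  proof (rule cell_sum_le)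
    show "integrable lborel (\<lambda>z. exp \<rho> * lower_integrand e T z * indicator (below T) z)"
    proof (rule Bochner_Integration.integrable_bound[where f = "\<lambda>z. (exp \<rho> * (1 + 32 * e\<^sup>2 * T\<^sup>2)) * indicator (below T) z"])
      show "integrable lborel (\<lambda>z::real \<times> real. (exp \<rho> * (1 + 32 * e\<^sup>2 * T\<^sup>2)) * indicator (below T) z)"
        by (intro integrable_mult_right integrable_real_indicator) (use emeasure_bounded_finite[OF below_bounded] in auto)
      show "(\<lambda>z. exp \<rho> * lower_integrand e T z * indicator (below T) z) \<in> borel_measurable lborel" unfolding lower_integrand_def by measurable
      show "AE z in lborel. norm (exp \<rho> * lower_integrand e T z * indicator (below T) z) \<le> norm ((exp \<rho> * (1 + 32 * e\<^sup>2 * T\<^sup>2)) * indicator (below T) z)"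
      proof (rule AE_I2)
        fix z
        show "norm (exp \<rho> * lower_integrand e T z * indicator (below T) z) \<le> norm ((exp \<rho> * (1 + 32 * e\<^sup>2 * T\<^sup>2)) * indicator (below T) z)"
        proof (cases "z \<in> below T")
          case True
          show ?thesis using lower_integrand_nn[OF True] True by (simp add: abs_mult)
        qed simp
      qed
    qed
    show "0 \<le> k c" for c by (simp add: k_def)
    show "0 \<le> exp \<rho> * lower_integrand e T z" if "z \<in> below T" for z using lower_integrand_nn[OF that] by simp
  qed (rule kf)
  also have "(\<integral>z. (exp \<rho> * lower_integrand e T z) * indicator (below T) z \<partial>lborel) = exp \<rho> * (\<integral>z. lower_integrand e T z * indicator (below T) z \<partial>lborel)"
    by (simp add: mult.assoc)
  also have "prob (void (chart r t (below T))) = exp (- chart_mass r (below T))"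
    by (rule void_chart_prob[OF below_borel below_bounded])
  finally have "prob (space M - turn T e h t) \<le> exp \<rho> * (exp (- (8 / 3 * (T * sqrt T))) + 2 * (\<integral>z. lower_integrand e T z * indicator (below T) z \<partial>lborel))"
    using KT by (simp add: distrib_left)
  then show ?thesis using prob_compl[OF turn_event, of T e h t] by simp
qed

text \<open>A point \<open>x\<close> nearest in both directions would lie in an occupied square
  below height \<open>T\<close>, so the front of this square contains a point \<open>y\<close>. As
  \<open>y\<close> does not beat \<open>x\<close> at first, it lies at least as high, and then on
  the side towards which the direction turns; \<open>tilt_lower\<close> makes it overtake
  \<open>x\<close>.\<close>

lemma turn_no_common:
  assumes T: "T > 0" and e: "e > 0" and h: "0 < h" "h \<le> 1"
    and d: "0 < d" "d < pi / 2" and \<sigma>: "e \<le> tan d / s" "tan d / s \<le> 2 * e"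
    and small: "s\<^sup>2 * (2 * e) * sqrt T \<le> 1 / 2" "16 * s\<^sup>2 * e\<^sup>2 * T * (1 + s\<^sup>2 * T) \<le> e * h"
    and w: "\<omega> \<in> turn T e h t" and out: "\<forall>x\<in>\<Phi> \<omega>. 2 * r < norm x"
  shows "nearest (\<Phi> \<omega>) (dirv t) \<inter> nearest (\<Phi> \<omega>) (dirv (t + d)) = {}"
proof (rule ccontr)
  assume "\<not> ?thesis"
  then obtain x where x1: "x \<in> nearest (\<Phi> \<omega>) (dirv t)" and x2: "x \<in> nearest (\<Phi> \<omega>) (dirv (t + d))" by auto
  define \<sigma>' where "\<sigma>' = tan d / s"
  have s: "s > 0" using angle_scale[OF r] by simp
  have sp: "\<omega> \<in> space M" using w by (auto simp: turn_def)
  have xS: "x \<in> \<Phi> \<omega>" using x1 by (auto simp: nearest_def)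
  obtain z where z: "z \<in> \<Phi> \<omega>" "z \<in> chart r t (below T)" using w by (auto simp: turn_def void_def)
  have za: "z \<bullet> dirv t > 0" and zq: "height_coord r t z < T" using z by (auto simp: chart_def below_def)
  have cmp: "nearness x1 (dirv t) > nearness x2 (dirv t)" if "x1 \<bullet> dirv t > 0" "x2 \<bullet> dirv t > 0" "height_coord r t x1 < height_coord r t x2" for x1 x2
  proof -
    have p: "0 < 1 + s\<^sup>2 * height_coord r t x1" using nearness_chart(1)[OF r that(1)] .
    have "sqrt (1 + s\<^sup>2 * height_coord r t x1) < sqrt (1 + s\<^sup>2 * height_coord r t x2)" using that s by simp
    then show ?thesis unfolding nearness_chart(2)[OF r that(1)] nearness_chart(2)[OF r that(2)]
      using p r by (intro divide_strict_left_mono mult_pos_pos mult_strict_left_mono) auto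
  qed
  have nz: "nearness z (dirv t) \<le> nearness x (dirv t)" using x1 z by (auto simp: nearest_def)
  have "nearness z (dirv t) > 0" unfolding nearness_chart(2)[OF r za] using nearness_chart(1)[OF r za] r by simp
  then have "nearness x (dirv t) > 0" using nz by linarith
  then have xa: "x \<bullet> dirv t > 0" by (rule nearness_pos)
  have xq: "height_coord r t x < T" using cmp[OF za xa] nz zq by (meson not_le order_le_less_trans)
  have xb: "(height_coord r t x, width_coord r t x) \<in> below T"
    using chart_parabola_iff[OF r xa] out xS xq by (auto simp: below_def)
  obtain c where c: "c \<in> cell_index h T" "(height_coord r t x, width_coord r t x) \<in> cell h T c" using in_cell[OF h(1) xb] by auto
  have "x \<in> chart r t (cell h T c)" using xa c by (simp add: chart_def)
  then have "\<omega> \<notin> void (chart r t (cell h T c))" using xS by (auto simp: void_def)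
  then have "\<omega> \<notin> void (chart r t (front T e h c))" using w c by (auto simp: turn_def)
  then obtain y where y: "y \<in> \<Phi> \<omega>" "y \<in> chart r t (front T e h c)" using sp by (auto simp: void_def)
  define q w q' w' where "q = height_coord r t x" and "w = width_coord r t x" and "q' = height_coord r t y" and "w' = width_coord r t y"
  have ya: "y \<bullet> dirv t > 0" and y': "w'\<^sup>2 < q'" "\<bar>w'\<bar> < sqrt T"
     "q' < real_of_int (fst c) * h + 2 * e * max 0 (w' - real_of_int (snd c) * h) - 3 * e * h"
    using y(2) by (auto simp: chart_def front_def below_iff q'_def w'_def)
  note b = below_w[OF xb, folded q_def w_def]
  have cb: "real_of_int (fst c) * h \<le> q" "real_of_int (snd c) * h \<le> w" "w < real_of_int (snd c) * h + h"
    using cell_bounds[OF h(1), of q w T "fst c" "snd c"] c(2) by (auto simp: q_def w_def)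
  have ny: "nearness y (dirv t) \<le> nearness x (dirv t)" "nearness y (dirv (t + d)) \<le> nearness x (dirv (t + d))"
    using x1 x2 y(1) by (auto simp: nearest_def)
  have qq: "q \<le> q'" using cmp[OF ya xa] ny(1) by (force simp: q_def q'_def)
  have eh: "0 < e * h" using e h by simp
  \<comment> \<open>On the other side the front gains at most \<open>2 * e * h\<close> in height,
    less than its margin \<open>3 * e * h\<close>, so \<open>y\<close> would lie below the square
    and be nearer than \<open>x\<close>.\<close>
  have "w \<le> w'"
  proof (rule ccontr)
    assume "\<not> w \<le> w'"
    then have "max 0 (w' - real_of_int (snd c) * h) \<le> h" using cb h by auto
    then have "2 * e * max 0 (w' - real_of_int (snd c) * h) \<le> 2 * e * h" using e by (intro mult_left_mono) auto
    then show False using y'(3) qq cb(1) eh by linarith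
  qed
  have lt: "q' < q + 2 * \<sigma>' * (w' - w) - 4 * s\<^sup>2 * \<sigma>'\<^sup>2 * T * (1 + s\<^sup>2 * T)"
  proof -
    have "max 0 (w' - real_of_int (snd c) * h) \<le> (w' - w) + h" using cb \<open>w \<le> w'\<close> by auto
    then have "2 * e * max 0 (w' - real_of_int (snd c) * h) \<le> 2 * e * ((w' - w) + h)" using e by (intro mult_left_mono) auto
    also have "\<dots> = 2 * e * (w' - w) + 2 * (e * h)" by (simp add: algebra_simps)
    also have "2 * e * (w' - w) \<le> 2 * \<sigma>' * (w' - w)" using \<open>w \<le> w'\<close> \<sigma> by (intro mult_right_mono) (auto simp: \<sigma>'_def)
    finally have 1: "q' < q + 2 * \<sigma>' * (w' - w) - e * h" using y'(3) cb(1) by linarith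
    have "\<sigma>'\<^sup>2 \<le> (2 * e)\<^sup>2" using \<sigma> e by (intro power_mono) (auto simp: \<sigma>'_def)
    then have "4 * s\<^sup>2 * \<sigma>'\<^sup>2 * T * (1 + s\<^sup>2 * T) \<le> 4 * s\<^sup>2 * (2 * e)\<^sup>2 * T * (1 + s\<^sup>2 * T)"
      using T by (intro mult_right_mono mult_left_mono) auto
    also have "\<dots> \<le> e * h" using small(2) by (simp add: power_mult_distrib)
    finally show ?thesis using 1 by linarith
  qed
  have "sqrt (1 + s\<^sup>2 * q') * (1 + s\<^sup>2 * \<sigma>' * w) < sqrt (1 + s\<^sup>2 * q) * (1 + s\<^sup>2 * \<sigma>' * w')"
  proof (rule tilt_lower[OF _ _ _ _ _ _ _ s _ \<open>w \<le> w'\<close> lt])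
    show "\<bar>w\<bar> \<le> sqrt T" using b(1,2) by linarith
    have "s\<^sup>2 * \<sigma>' * sqrt T \<le> s\<^sup>2 * (2 * e) * sqrt T" using \<sigma> T by (intro mult_right_mono mult_left_mono) (auto simp: \<sigma>'_def)
    then show "s\<^sup>2 * \<sigma>' * sqrt T \<le> 1 / 2" using small(1) by linarith
    show "0 \<le> \<sigma>'" using \<sigma> e by (simp add: \<sigma>'_def)
  qed (use T y' b qq in auto)
  moreover have cd: "cos d > 0" using d by (intro cos_gt_zero_pi) auto
  have "sqrt (1 + s\<^sup>2 * q) * (1 + s\<^sup>2 * \<sigma>' * w') \<le> sqrt (1 + s\<^sup>2 * q') * (1 + s\<^sup>2 * \<sigma>' * w)"
  proof -
    have px: "sqrt (1 + s\<^sup>2 * q) > 0" and py: "sqrt (1 + s\<^sup>2 * q') > 0"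
      using nearness_chart(1)[OF r xa] nearness_chart(1)[OF r ya] by (auto simp: q_def q'_def)
    have "cos d * (1 + s\<^sup>2 * \<sigma>' * w') / (2 * r * sqrt (1 + s\<^sup>2 * q')) \<le> cos d * (1 + s\<^sup>2 * \<sigma>' * w) / (2 * r * sqrt (1 + s\<^sup>2 * q))"
      using ny(2) unfolding nearness_rotate_eq[OF xa cd] nearness_rotate_eq[OF ya cd] by (simp add: \<sigma>'_def q_def w_def q'_def w'_def)
    then have "(cos d * (1 + s\<^sup>2 * \<sigma>' * w')) * (2 * r * sqrt (1 + s\<^sup>2 * q)) \<le> (cos d * (1 + s\<^sup>2 * \<sigma>' * w)) * (2 * r * sqrt (1 + s\<^sup>2 * q'))"
      using px py r by (intro divide_le_cross) auto
    then have "(cos d * (2 * r)) * (sqrt (1 + s\<^sup>2 * q) * (1 + s\<^sup>2 * \<sigma>' * w')) \<le> (cos d * (2 * r)) * (sqrt (1 + s\<^sup>2 * q') * (1 + s\<^sup>2 * \<sigma>' * w))"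
      by (simp only: mult_ac)
    then show ?thesis using cd r mult_le_cancel_left_pos[of "cos d * (2 * r)"] by simp
  qed
  ultimately show False by linarith
qed

end

subsection \<open>The limiting integrals\<close>

text \<open>The constant \<open>32 / 3\<close> is \<open>2 * 2 * (8 / 3)\<close>: the intensity of
  the lowest point, the factor of the wedge mass, and the integral of
  \<open>(sqrt q - w)\<^sup>2\<close> over \<open>\<bar>w\<bar> < sqrt q\<close>, which is
  \<open>8 / 3 * (q * sqrt q)\<close>.\<close>

definition limit_kernel :: "real \<Rightarrow> real" where
  "limit_kernel q = 32 / 3 * (q * sqrt q) * exp (- (8 / 3 * (q * sqrt q)))"

lemma limit_kernel_deriv: "x > 0 \<Longrightarrow> ((\<lambda>q. 8 / 3 * (q * sqrt q)) has_real_derivative 4 * sqrt x) (at x)"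
  by (auto intro!: derivative_eq_intros simp: field_simps)

lemma q_sqrt_powr: "x > 0 \<Longrightarrow> x * sqrt x = x powr (3 / 2)"
  by (simp add: powr_half_sqrt[symmetric] powr_mult_base)

text \<open>Substitution of \<open>t = 8 / 3 * (q * sqrt q)\<close> with
  \<open>dt = 4 * sqrt q dq\<close>. The remaining factor \<open>8 / 3 * q\<close> equals
  \<open>C * t powr (2 / 3)\<close>, which leads to the Gamma integral at \<open>5 / 3\<close>, and
  \<open>C = (8 / 3) powr (1 / 3)\<close> is \<open>2 * 3 powr (- 1 / 3)\<close>.\<close>

lemma limit_kernel_integral:
  "limit_kernel absolutely_integrable_on {0<..}" "integral {0<..} limit_kernel = side_const / (2 * pi)"
proof -
  define C :: real where "C = (8 / 3) powr (1 / 3)"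
  define f where "f t = C * (t powr (2 / 3) / exp t)" for t :: real
  let ?g = "\<lambda>q::real. 8 / 3 * (q * sqrt q)"
  have im: "?g ` {0<..} = {0<..}"
  proof (intro equalityI subsetI)
    fix t :: real assume t: "t \<in> {0<..}"
    define q where "q = (3 / 8 * t) powr (2 / 3)"
    have q: "q > 0" using t by (simp add: q_def)
    have "?g q = 8 / 3 * (3 / 8 * t)" unfolding q_sqrt_powr[OF q] using t by (simp add: q_def powr_powr)
    then show "t \<in> ?g ` {0<..}" using q by (intro image_eqI[of _ _ q]) auto
  qed auto
  have inj: "inj_on ?g {0<..}"
  proof (rule inj_onI)
    fix x y :: real assume xy: "x \<in> {0<..}" "y \<in> {0<..}" "?g x = ?g y"
    then have "x powr (3 / 2) = y powr (3 / 2)" by (simp add: q_sqrt_powr)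
    then have "(x powr (3 / 2)) powr (2 / 3) = (y powr (3 / 2)) powr (2 / 3)" by simp
    then show "x = y" using xy by (simp add: powr_powr)
  qed
  have G: "((\<lambda>t. t powr (2 / 3) / exp t) has_integral Gamma (5 / 3 :: real)) {0..}"
    using Gamma_integral_real[of "5 / 3"] by simp
  have "(f has_integral C * Gamma (5 / 3)) {0..}" unfolding f_def by (intro has_integral_mult_right G)
  moreover have "(f has_integral C * Gamma (5 / 3)) {0..} \<longleftrightarrow> (f has_integral C * Gamma (5 / 3)) {0<..}"
  proof (rule has_integral_spike_set_eq)
    show "negligible {x \<in> {0..} - {0<..}. f x \<noteq> 0}" by (rule negligible_subset[of "{0}"]) auto
    show "negligible {x \<in> {0<..} - {0..}. f x \<noteq> 0}" by (rule negligible_subset[of "{}"]) auto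
  qed
  ultimately have "(f has_integral C * Gamma (5 / 3)) {0<..}" by blast
  then have f: "f absolutely_integrable_on {0<..}" "integral {0<..} f = C * Gamma (5 / 3)"
  proof -
    assume h: "(f has_integral C * Gamma (5 / 3)) {0<..}"
    show "integral {0<..} f = C * Gamma (5 / 3)" using h by (rule integral_unique)
    show "f absolutely_integrable_on {0<..}"
      using h by (intro nonnegative_absolutely_integrable_1) (auto simp: f_def C_def integrable_on_def)
  qed
  have "(\<lambda>x. \<bar>4 * sqrt x\<bar> * f (?g x)) absolutely_integrable_on {0<..} \<and>
           integral {0<..} (\<lambda>x. \<bar>4 * sqrt x\<bar> * f (?g x)) = C * Gamma (5 / 3)
     \<longleftrightarrow> f absolutely_integrable_on (?g ` {0<..}) \<and> integral (?g ` {0<..}) f = C * Gamma (5 / 3)"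
  proof (rule has_absolute_integral_change_of_variables_1'[where g = ?g and g' = "\<lambda>x. 4 * sqrt x" and f = f and S = "{0<..}"])
    show "{0<..} \<in> sets (lebesgue :: real measure)" by simp
    show "inj_on ?g {0<..}" by (rule inj)
    fix x :: real assume "x \<in> {0<..}"
    then show "(?g has_real_derivative 4 * sqrt x) (at x within {0<..})"
      by (intro has_field_derivative_at_within[OF limit_kernel_deriv]) simp
  qed
  then have A: "(\<lambda>x. \<bar>4 * sqrt x\<bar> * f (?g x)) absolutely_integrable_on {0<..}"
     "integral {0<..} (\<lambda>x. \<bar>4 * sqrt x\<bar> * f (?g x)) = C * Gamma (5 / 3)"
    using f im by auto
  have eq: "\<bar>4 * sqrt x\<bar> * f (?g x) = limit_kernel x" if "x \<in> {0<..}" for x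
  proof -
    have x: "x > 0" using that by simp
    have "(?g x) powr (2 / 3) = (8 / 3) powr (2 / 3) * x"
      unfolding q_sqrt_powr[OF x] using x by (subst powr_mult) (auto simp: powr_powr)
    then have "f (?g x) = C * ((8 / 3) powr (2 / 3) * x * exp (- ?g x))"
      unfolding f_def by (simp only: exp_minus divide_inverse)
    then have "\<bar>4 * sqrt x\<bar> * f (?g x) = 4 * sqrt x * (C * (8 / 3) powr (2 / 3)) * x * exp (- ?g x)"
      using x by (simp only: abs_mult abs_numeral) (simp only: abs_of_nonneg real_sqrt_ge_zero less_imp_le mult_ac)
    also have "C * (8 / 3) powr (2 / 3) = 8 / 3" by (simp add: C_def powr_add[symmetric])
    finally show ?thesis by (simp add: limit_kernel_def)
  qed
  show "limit_kernel absolutely_integrable_on {0<..}"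
    using A(1) eq by (subst set_integrable_cong[OF refl refl]) (auto simp: eq[symmetric])
  have "C = 2 * 3 powr (- 1 / 3)"
  proof -
    have "(8::real) powr (1 / 3) = (2 powr 3) powr (1 / 3)" by simp
    also have "\<dots> = 2" unfolding powr_powr by simp
    finally have "(8::real) powr (1 / 3) = 2" .
    then show ?thesis by (simp add: C_def powr_divide powr_minus_divide)
  qed
  then have "C * Gamma (5 / 3) = side_const / (2 * pi)" by (simp add: side_const_def)
  then show "integral {0<..} limit_kernel = side_const / (2 * pi)"
    using A(2) eq by (metis (mono_tags, lifting) Henstock_Kurzweil_Integration.integral_cong)
qed

lemma limit_kernel_measurable [measurable]: "limit_kernel \<in> borel_measurable borel" unfolding limit_kernel_def by measurable

lemma limit_kernel_lborel:
  "integrable lborel (\<lambda>q. limit_kernel q * indicator {0<..} q)"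
  "(\<integral>q. limit_kernel q * indicator {0<..} q \<partial>lborel) = side_const / (2 * pi)"
proof -
  have m: "(\<lambda>q. indicator {0<..} q *\<^sub>R limit_kernel q) \<in> borel_measurable lborel" by measurable
  have "integrable lebesgue (\<lambda>q. indicator {0<..} q *\<^sub>R limit_kernel q)"
    using limit_kernel_integral(1) by (simp add: set_integrable_def)
  then have 1: "integrable lborel (\<lambda>q. indicator {0<..} q *\<^sub>R limit_kernel q)" using m by (simp add: integrable_completion)
  then show 2: "integrable lborel (\<lambda>q. limit_kernel q * indicator {0<..} q)" by (simp add: mult.commute)
  have "((\<lambda>q. limit_kernel q * indicator {0<..} q) has_integral (\<integral>q. limit_kernel q * indicator {0<..} q \<partial>lborel)) UNIV"
    by (rule has_integral_integral_real[OF 2])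
  moreover have "(\<lambda>q. limit_kernel q * indicator {0<..} q) = (\<lambda>q. if q \<in> {0<..} then limit_kernel q else 0)" by (auto simp: indicator_def)
  ultimately have "(limit_kernel has_integral (\<integral>q. limit_kernel q * indicator {0<..} q \<partial>lborel)) {0<..}"
    by (simp only: has_integral_restrict_UNIV)
  then show "(\<integral>q. limit_kernel q * indicator {0<..} q \<partial>lborel) = side_const / (2 * pi)"
    using limit_kernel_integral(2) integral_unique by metis
qed

lemma integral_interval_FTC:
  fixes f F :: "real \<Rightarrow> real"
  assumes "a \<le> b" and F: "\<And>x. (F has_real_derivative f x) (at x)" and f: "\<And>x. isCont f x"
  shows "(\<integral>x. f x * indicator {a<..<b} x \<partial>lborel) = F b - F a"
proof -
  have [measurable]: "f \<in> borel_measurable borel"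
    using f by (intro borel_measurable_continuous_onI continuous_at_imp_continuous_on) auto
  have "(\<integral>x. f x * indicator {a<..<b} x \<partial>lborel) = (\<integral>x. f x * indicator {a..b} x \<partial>lborel)"
  proof (rule integral_cong_AE)
    show "AE x in lborel. f x * indicator {a<..<b} x = f x * indicator {a..b} x"
      using AE_lborel_singleton[of a] AE_lborel_singleton[of b] by eventually_elim (auto simp: indicator_def)
  qed auto
  also have "\<dots> = F b - F a" by (rule integral_FTC_Icc_real) (use assms in auto)
  finally show ?thesis .
qed

lemma below_slice: "indicator (below T) (q, w) = indicator {0<..<T} q * (indicator {- sqrt q<..<sqrt q} w :: real)"
proof (cases "(q, w) \<in> below T")
  case True
  from below_w[OF this] have "\<bar>w\<bar> < sqrt q" "0 < q" "q < T" by auto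
  then show ?thesis using True by (auto simp: indicator_def abs_less_iff)
next
  case False
  have "\<not> (0 < q \<and> q < T \<and> - sqrt q < w \<and> w < sqrt q)"
  proof
    assume a: "0 < q \<and> q < T \<and> - sqrt q < w \<and> w < sqrt q"
    then have "\<bar>w\<bar>\<^sup>2 < (sqrt q)\<^sup>2" by (intro power_strict_mono) auto
    then show False using False a by (simp add: below_iff)
  qed
  then show ?thesis using False by (auto simp: indicator_def)
qed

lemma integral_below:
  assumes m[measurable]: "\<phi> \<in> borel_measurable borel" and bd': "\<forall>q. 0 < q \<longrightarrow> q < T \<longrightarrow> \<bar>\<phi> q\<bar> \<le> B"
    and T: "T > 0"
  shows "(\<integral>z. \<phi> (fst z) * indicator (below T) z \<partial>lborel) = (\<integral>q. 2 * sqrt q * \<phi> q * indicator {0<..<T} q \<partial>lborel)" (is ?A)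
    and "(\<integral>z. \<phi> (fst z) * (sqrt (fst z) - snd z)\<^sup>2 * indicator (below T) z \<partial>lborel)
      = (\<integral>q. 8 / 3 * (q * sqrt q) * \<phi> q * indicator {0<..<T} q \<partial>lborel)" (is ?B)
    and "integrable lborel (\<lambda>z. \<phi> (fst z) * indicator (below T) z)"
    and "integrable lborel (\<lambda>z. \<phi> (fst z) * (sqrt (fst z) - snd z)\<^sup>2 * indicator (below T) z)"
proof -
  have bd: "\<bar>\<phi> q\<bar> \<le> B" if "0 < q" "q < T" for q using bd' that by blast
  have B: "B \<ge> 0" using order_trans[OF abs_ge_zero bd[of "T / 2"]] T by simp
  have int: "integrable lborel (\<lambda>z. \<phi> (fst z) * \<psi> z * indicator (below T) z)"
    if \<psi>: "\<psi> \<in> borel_measurable borel" "\<And>z. z \<in> below T \<Longrightarrow> \<bar>\<psi> z\<bar> \<le> D" for \<psi> D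
  proof (rule Bochner_Integration.integrable_bound[where f = "\<lambda>z. (B * D) * indicator (below T) z"])
    show "integrable lborel (\<lambda>z::real \<times> real. (B * D) * indicator (below T) z)"
      by (intro integrable_mult_right integrable_real_indicator) (use emeasure_bounded_finite[OF below_bounded] in auto)
    show "(\<lambda>z. \<phi> (fst z) * \<psi> z * indicator (below T) z) \<in> borel_measurable lborel" using \<psi> by measurable
    show "AE z in lborel. norm (\<phi> (fst z) * \<psi> z * indicator (below T) z) \<le> norm ((B * D) * indicator (below T) z)"
    proof (rule AE_I2)
      fix z
      show "norm (\<phi> (fst z) * \<psi> z * indicator (below T) z) \<le> norm ((B * D) * indicator (below T) z)"
      proof (cases "z \<in> below T")
        case True
        have "\<bar>\<phi> (fst z)\<bar> \<le> B" using below_w[of "fst z" "snd z" T] True bd by simp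
        then have "\<bar>\<phi> (fst z)\<bar> * \<bar>\<psi> z\<bar> \<le> B * D" using \<psi>(2)[OF True] B by (intro mult_mono) auto
        also have "\<dots> \<le> \<bar>B * D\<bar>" by (rule abs_ge_self)
        finally show ?thesis using True by (simp add: abs_mult)
      qed simp
    qed
  qed
  have red: "(\<integral>z. \<phi> (fst z) * \<psi> z * indicator (below T) z \<partial>lborel) = (\<integral>q. \<Psi> q * \<phi> q * indicator {0<..<T} q \<partial>lborel)"
    if \<psi>: "\<psi> \<in> borel_measurable borel" "\<And>z. z \<in> below T \<Longrightarrow> \<bar>\<psi> z\<bar> \<le> D"
      and \<Psi>: "\<And>q. 0 < q \<Longrightarrow> (\<integral>w. \<psi> (q, w) * indicator {- sqrt q<..<sqrt q} w \<partial>lborel) = \<Psi> q" for \<psi> D \<Psi>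
  proof -
    have "(\<integral>z. \<phi> (fst z) * \<psi> z * indicator (below T) z \<partial>lborel) = (\<integral>z. \<phi> (fst z) * \<psi> z * indicator (below T) z \<partial>(lborel \<Otimes>\<^sub>M lborel))"
      by (simp add: lborel_prod)
    also have "\<dots> = (\<integral>q. \<integral>w. \<phi> (fst (q, w)) * \<psi> (q, w) * indicator (below T) (q, w) \<partial>lborel \<partial>lborel)"
      by (rule lborel_pair.integral_fst'[symmetric]) (simp only: lborel_prod int[OF \<psi>])
    also have "\<dots> = (\<integral>q. \<Psi> q * \<phi> q * indicator {0<..<T} q \<partial>lborel)"
    proof (rule Bochner_Integration.integral_cong[OF refl])
      fix q
      have "(\<integral>w. \<phi> (fst (q, w)) * \<psi> (q, w) * indicator (below T) (q, w) \<partial>lborel)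
        = (\<integral>w. (\<phi> q * indicator {0<..<T} q) * (\<psi> (q, w) * indicator {- sqrt q<..<sqrt q} w) \<partial>lborel)"
        unfolding below_slice by (rule Bochner_Integration.integral_cong) (auto simp: mult_ac)
      also have "\<dots> = (\<phi> q * indicator {0<..<T} q) * (\<integral>w. \<psi> (q, w) * indicator {- sqrt q<..<sqrt q} w \<partial>lborel)" by simp
      also have "\<dots> = \<Psi> q * \<phi> q * indicator {0<..<T} q" using \<Psi>[of q] by (auto simp: indicator_def)
      finally show "(\<integral>w. \<phi> (fst (q, w)) * \<psi> (q, w) * indicator (below T) (q, w) \<partial>lborel) = \<Psi> q * \<phi> q * indicator {0<..<T} q" .
    qed
    finally show ?thesis .
  qed
  show "integrable lborel (\<lambda>z. \<phi> (fst z) * indicator (below T) z)" using int[of "\<lambda>z. 1" 1] by simp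
  have gap: "\<bar>(sqrt (fst z) - snd z)\<^sup>2\<bar> \<le> 4 * T" if "z \<in> below T" for z
    using below_gap(3)[of "fst z" "snd z" T] that by simp
  show "integrable lborel (\<lambda>z. \<phi> (fst z) * (sqrt (fst z) - snd z)\<^sup>2 * indicator (below T) z)"
    by (rule int[OF _ gap]) auto
  have i1: "(\<integral>w. 1 * indicator {- sqrt q<..<sqrt q} w \<partial>lborel) = 2 * sqrt q" if "0 < q" for q
    using integral_interval_FTC[of "- sqrt q" "sqrt q" "\<lambda>w. w" "\<lambda>w. 1"] that by simp
  show ?A using red[of "\<lambda>z. 1" 1 "\<lambda>q. 2 * sqrt q", OF _ _ i1] by simp
  have i2: "(\<integral>w. (sqrt (fst (q, w)) - snd (q, w))\<^sup>2 * indicator {- sqrt q<..<sqrt q} w \<partial>lborel) = 8 / 3 * (q * sqrt q)" if q: "0 < q" for q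
  proof -
    define F where "F w = - ((sqrt q - w) ^ 3) / 3" for w
    have "(\<integral>w. (sqrt q - w)\<^sup>2 * indicator {- sqrt q<..<sqrt q} w \<partial>lborel) = F (sqrt q) - F (- sqrt q)"
      unfolding F_def by (rule integral_interval_FTC) (use q in \<open>auto intro!: derivative_eq_intros\<close>)
    also have "\<dots> = 8 / 3 * (q * sqrt q)" using q by (simp add: F_def power3_eq_cube)
    finally show ?thesis by simp
  qed
  show ?B using red[OF _ gap i2] by simp
qed

text \<open>The integrand is the limiting density of the height of the lowest point: the derivative
  \<open>4 * sqrt q\<close> of the mass of the cap times the probability that the cap is
  empty.\<close>

lemma exp_sqrt_integral:
  assumes T: "T > 0"
  shows "integrable lborel (\<lambda>q. 4 * sqrt q * exp (- (8 / 3 * (q * sqrt q))) * indicator {0<..<T} q)"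
   and "(\<integral>q. 4 * sqrt q * exp (- (8 / 3 * (q * sqrt q))) * indicator {0<..<T} q \<partial>lborel) = 1 - exp (- (8 / 3 * (T * sqrt T)))"
proof -
  let ?f = "\<lambda>q. 4 * sqrt q * exp (- (8 / 3 * (q * sqrt q)))"
  show int: "integrable lborel (\<lambda>q. ?f q * indicator {0<..<T} q)"
  proof (rule Bochner_Integration.integrable_bound[where f = "\<lambda>z. (4 * sqrt T) * indicator {0<..<T} z"])
    show "AE x in lborel. norm (?f x * indicator {0<..<T} x) \<le> norm (4 * sqrt T * indicator {0<..<T} x)"
    proof (rule AE_I2)
      fix x
      have "sqrt x * exp (- (8 / 3 * (x * sqrt x))) \<le> sqrt T * 1" if "0 < x" "x < T"
        using that by (intro mult_mono) auto
      then show "norm (?f x * indicator {0<..<T} x) \<le> norm (4 * sqrt T * indicator {0<..<T} x)"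
        using T by (auto simp: indicator_def abs_mult)
    qed
  qed (use T in auto)
  have "((\<lambda>q. - exp (- (8 / 3 * (q * sqrt q)))) has_vector_derivative ?f x) (at x)" if "x \<in> {0<..<T}" for x
  proof -
    have "((\<lambda>q. - exp (- (8 / 3 * (q * sqrt q)))) has_real_derivative (- (exp (- (8 / 3 * (x * sqrt x))) * (- (4 * sqrt x))))) (at x)"
      using that by (intro DERIV_minus DERIV_fun_exp limit_kernel_deriv) auto
    then show ?thesis by (simp add: has_real_derivative_iff_has_vector_derivative mult_ac)
  qed
  then have "(?f has_integral (- exp (- (8 / 3 * (T * sqrt T))) - - exp (- (8 / 3 * (0 * sqrt 0))))) {0..T}"
    using T by (intro fundamental_theorem_of_calculus_interior) (auto intro!: continuous_intros)
  then have "(?f has_integral (1 - exp (- (8 / 3 * (T * sqrt T))))) {0..T}" by simp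
  then have "(?f has_integral (1 - exp (- (8 / 3 * (T * sqrt T))))) {0<..<T}"
    by (simp add: has_integral_Icc_iff_Ioo)
  then have h: "(?f has_integral (1 - exp (- (8 / 3 * (T * sqrt T))))) {0<..<T}" .
  have "((\<lambda>q. ?f q * indicator {0<..<T} q) has_integral (\<integral>q. ?f q * indicator {0<..<T} q \<partial>lborel)) UNIV"
    by (rule has_integral_integral_real[OF int])
  moreover have "(\<lambda>q. ?f q * indicator {0<..<T} q) = (\<lambda>q. if q \<in> {0<..<T} then ?f q else 0)" by (auto simp: indicator_def)
  ultimately have "(?f has_integral (\<integral>q. ?f q * indicator {0<..<T} q \<partial>lborel)) {0<..<T}"
    by (simp only: has_integral_restrict_UNIV)
  then show "(\<integral>q. ?f q * indicator {0<..<T} q \<partial>lborel) = 1 - exp (- (8 / 3 * (T * sqrt T)))"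
    using h by (rule has_integral_unique)
qed

definition partial_limit :: "real \<Rightarrow> real" where "partial_limit T = (\<integral>q. limit_kernel q * indicator {0<..<T} q \<partial>lborel)"

lemma partial_limit_tendsto: "(partial_limit \<longlongrightarrow> side_const / (2 * pi)) at_top"
  unfolding partial_limit_def[abs_def] limit_kernel_lborel(2)[symmetric]
proof (rule integral_dominated_convergence_at_top[where w = "\<lambda>q. limit_kernel q * indicator {0<..} q"])
  show "\<forall>\<^sub>F T in at_top. AE x in lborel. norm (limit_kernel x * indicator {0<..<T} x) \<le> limit_kernel x * indicator {0<..} x"
    by (intro always_eventually allI AE_I2) (auto simp: indicator_def limit_kernel_def)
  show "AE x in lborel. ((\<lambda>T. limit_kernel x * indicator {0<..<T} x) \<longlongrightarrow> limit_kernel x * indicator {0<..} x) at_top"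
  proof (intro AE_I2 tendsto_eventually)
    fix x :: real
    show "\<forall>\<^sub>F T in at_top. limit_kernel x * indicator {0<..<T} x = limit_kernel x * indicator {0<..} x"
      using eventually_gt_at_top[of x] by eventually_elim (auto simp: indicator_def)
  qed
qed (use limit_kernel_lborel(1) in auto)

text \<open>The first term is, up to second order in \<open>e\<close>, the probability that the
  lowest point has height below \<open>T\<close>. Together with the void term
  \<open>exp (- (8 / 3 * (T * sqrt T)))\<close> of \<open>turn_prob\<close> it adds up to
  \<open>1\<close>, so that the linear term \<open>e * partial_limit T\<close> remains as the
  probability of a change.\<close>

lemma lower_integrand_integral:
  assumes T: "T > 0"
  shows "2 * (\<integral>z. lower_integrand e T z * indicator (below T) z \<partial>lborel)
    = (1 + 32 * e\<^sup>2 * T\<^sup>2) * (1 - exp (- (8 / 3 * (T * sqrt T)))) - e * partial_limit T"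
proof -
  define \<phi> where "\<phi> q = exp (- (8 / 3 * (q * sqrt q)))" for q :: real
  have m: "\<phi> \<in> borel_measurable borel" unfolding \<phi>_def by measurable
  have bd: "\<forall>q. 0 < q \<longrightarrow> q < T \<longrightarrow> \<bar>\<phi> q\<bar> \<le> 1" by (simp add: \<phi>_def)
  note I = integral_below[OF m bd T]
  have "(\<integral>z. lower_integrand e T z * indicator (below T) z \<partial>lborel)
    = (\<integral>z. (1 + 32 * e\<^sup>2 * T\<^sup>2) * (\<phi> (fst z) * indicator (below T) z) - 2 * e * (\<phi> (fst z) * (sqrt (fst z) - snd z)\<^sup>2 * indicator (below T) z) \<partial>lborel)"
    by (rule Bochner_Integration.integral_cong) (auto simp: lower_integrand_def \<phi>_def algebra_simps)
  also have "\<dots> = (1 + 32 * e\<^sup>2 * T\<^sup>2) * (\<integral>z. \<phi> (fst z) * indicator (below T) z \<partial>lborel)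
      - 2 * e * (\<integral>z. \<phi> (fst z) * (sqrt (fst z) - snd z)\<^sup>2 * indicator (below T) z \<partial>lborel)"
    using I(3,4) by (subst Bochner_Integration.integral_diff) (auto intro!: integrable_mult_right simp del: integral_mult_right_zero) 
  also have "(\<integral>z. \<phi> (fst z) * indicator (below T) z \<partial>lborel) = (\<integral>q. 1 / 2 * (4 * sqrt q * exp (- (8 / 3 * (q * sqrt q))) * indicator {0<..<T} q) \<partial>lborel)"
    unfolding I(1) by (rule Bochner_Integration.integral_cong) (auto simp: \<phi>_def)
  also have "\<dots> = 1 / 2 * (1 - exp (- (8 / 3 * (T * sqrt T))))"
    unfolding exp_sqrt_integral(2)[OF T, symmetric] by (rule integral_mult_right_zero)
  also have "(\<integral>z. \<phi> (fst z) * (sqrt (fst z) - snd z)\<^sup>2 * indicator (below T) z \<partial>lborel) = (\<integral>q. 1 / 4 * (limit_kernel q * indicator {0<..<T} q) \<partial>lborel)"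
    unfolding I(2) by (rule Bochner_Integration.integral_cong) (auto simp: \<phi>_def limit_kernel_def)
  also have "\<dots> = 1 / 4 * partial_limit T" by (simp add: partial_limit_def)
  finally show ?thesis by (simp add: algebra_simps)
qed

text \<open>The minimum joins \<open>cap_mass_ge\<close>, which has the right limit for each
  \<open>q\<close>, with \<open>cap_mass_tail\<close>, which provides a majorant independent of
  \<open>r\<close>.\<close>

definition upper_kernel :: "real \<Rightarrow> real \<Rightarrow> real" where
  "upper_kernel r q = 32 / 3 * (1 + (angle_scale r)\<^sup>2 * q) * (q * sqrt q) *
     min (exp (2 / 3 - 2 / 3 * q)) (exp (- (8 / 3 * (q * sqrt q) / (1 + (angle_scale r)\<^sup>2 * q)\<^sup>2))) * indicator {0<..} q"

lemma upper_kernel_dominated: "integrable lborel (\<lambda>q::real. 32 / 3 * (1 + q) * (q * sqrt q) * exp (2 / 3 - 2 / 3 * q) * indicator {0<..} q)"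
proof -
  have g: "integrable lborel (\<lambda>q. erlang_density 0 (2 / 3) q * q ^ k)" for k :: nat
  proof (rule integrableI_bounded)
    have "(\<integral>\<^sup>+ x. ennreal (norm (erlang_density 0 (2 / 3) x * x ^ k)) \<partial>lborel) = (\<integral>\<^sup>+ x. ennreal (erlang_density 0 (2 / 3) x * x ^ k) \<partial>lborel)"
      by (intro nn_integral_cong) (auto simp: erlang_density_def)
    also have "\<dots> < \<infinity>" by (subst nn_integral_erlang_ith_moment) auto
    finally show "(\<integral>\<^sup>+ x. ennreal (norm (erlang_density 0 (2 / 3) x * x ^ k)) \<partial>lborel) < \<infinity>" .
  qed simp
  \<comment> \<open>By \<open>sqrt q \<le> 1 + q\<close> the majorant reduces to moments of the
    exponential density of rate \<open>2 / 3\<close>; the constant is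
    \<open>32 / 3 = 16 * (2 / 3)\<close>.\<close>
  have "integrable lborel (\<lambda>q. 16 * exp (2 / 3) * (erlang_density 0 (2 / 3) q * q ^ 1 + 2 * (erlang_density 0 (2 / 3) q * q ^ 2) + erlang_density 0 (2 / 3) q * q ^ 3))"
    by (intro integrable_mult_right Bochner_Integration.integrable_add g)
  then show ?thesis
  proof (rule Bochner_Integration.integrable_bound)
    show "AE q in lborel. norm (32 / 3 * (1 + q) * (q * sqrt q) * exp (2 / 3 - 2 / 3 * q) * indicator {0<..} q)
      \<le> norm (16 * exp (2 / 3) * (erlang_density 0 (2 / 3) q * q ^ 1 + 2 * (erlang_density 0 (2 / 3) q * q ^ 2) + erlang_density 0 (2 / 3) q * q ^ 3))"
    proof (rule AE_I2)
      fix q :: real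
      show "norm (32 / 3 * (1 + q) * (q * sqrt q) * exp (2 / 3 - 2 / 3 * q) * indicator {0<..} q)
      \<le> norm (16 * exp (2 / 3) * (erlang_density 0 (2 / 3) q * q ^ 1 + 2 * (erlang_density 0 (2 / 3) q * q ^ 2) + erlang_density 0 (2 / 3) q * q ^ 3))"
      proof (cases "q > 0")
        case True
        have "sqrt q \<le> 1 + q" using True by (intro real_le_lsqrt) (auto simp: power2_eq_square algebra_simps)
        then have "32 / 3 * (1 + q) * (q * sqrt q) * exp (2 / 3 - 2 / 3 * q) \<le> 32 / 3 * (1 + q) * (q * (1 + q)) * exp (2 / 3 - 2 / 3 * q)"
          using True by (intro mult_right_mono mult_left_mono) auto
        also have "\<dots> = 16 * exp (2 / 3) * (erlang_density 0 (2 / 3) q * q ^ 1 + 2 * (erlang_density 0 (2 / 3) q * q ^ 2) + erlang_density 0 (2 / 3) q * q ^ 3)"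
        proof -
          define E where "E = exp (- (2 / 3 * q))"
          have "exp (2 / 3 - 2 / 3 * q) = exp (2 / 3) * E" by (simp add: E_def exp_add[symmetric])
          moreover have "erlang_density 0 (2 / 3) q = 2 / 3 * E" using True by (simp add: erlang_density_def E_def)
          ultimately show ?thesis by (simp only:) (simp add: power2_eq_square power3_eq_cube algebra_simps)
        qed
        finally show ?thesis using True by simp
      qed simp
    qed
  qed simp
qed

lemma upper_kernel_le_dom:
  assumes r: "r \<ge> 1" shows "0 \<le> upper_kernel r q" "upper_kernel r q \<le> 32 / 3 * (1 + q) * (q * sqrt q) * exp (2 / 3 - 2 / 3 * q) * indicator {0<..} q"
proof -
  have s: "0 < angle_scale r" "angle_scale r \<le> 1" using angle_scale(1)[of r] angle_scale_le_1[OF r] r by auto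
  then have s2: "(angle_scale r)\<^sup>2 \<le> 1" by (simp add: power_le_one)
  show "0 \<le> upper_kernel r q" by (auto simp: upper_kernel_def indicator_def)
  show "upper_kernel r q \<le> 32 / 3 * (1 + q) * (q * sqrt q) * exp (2 / 3 - 2 / 3 * q) * indicator {0<..} q"
  proof (cases "q > 0")
    case True
    have "(angle_scale r)\<^sup>2 * q \<le> 1 * q" using s2 True by (intro mult_right_mono) auto
    then show ?thesis using True unfolding upper_kernel_def by (intro mult_mono) auto
  qed (simp add: upper_kernel_def)
qed

lemma upper_kernel_measurable [measurable]: "upper_kernel r \<in> borel_measurable borel" unfolding upper_kernel_def by measurable

lemma upper_kernel_integrable: "r \<ge> 1 \<Longrightarrow> integrable lborel (upper_kernel r)"
  using upper_kernel_le_dom by (intro Bochner_Integration.integrable_bound[OF upper_kernel_dominated]) (auto intro!: AE_I2 simp: abs_of_nonneg intro: order_trans[OF _ abs_ge_self])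

lemma upper_kernel_tendsto: "((\<lambda>r. \<integral>q. upper_kernel r q \<partial>lborel) \<longlongrightarrow> side_const / (2 * pi)) at_top"
  unfolding limit_kernel_lborel(2)[symmetric]
proof (rule integral_dominated_convergence_at_top[OF _ _ upper_kernel_dominated])
  show "\<forall>\<^sub>F r in at_top. AE q in lborel. norm (upper_kernel r q) \<le> 32 / 3 * (1 + q) * (q * sqrt q) * exp (2 / 3 - 2 / 3 * q) * indicator {0<..} q"
    using eventually_ge_at_top[of 1] by eventually_elim (use upper_kernel_le_dom in \<open>auto intro!: AE_I2\<close>)
  have s0: "(angle_scale \<longlongrightarrow> 0) at_top" unfolding angle_scale_def by real_asymp
  show "AE q in lborel. ((\<lambda>r. upper_kernel r q) \<longlongrightarrow> limit_kernel q * indicator {0<..} q) at_top"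
  proof (rule AE_I2)
    fix q :: real
    show "((\<lambda>r. upper_kernel r q) \<longlongrightarrow> limit_kernel q * indicator {0<..} q) at_top"
    proof (cases "q > 0")
      case True
      have "((\<lambda>r. 32 / 3 * (1 + (angle_scale r)\<^sup>2 * q) * (q * sqrt q) *
          min (exp (2 / 3 - 2 / 3 * q)) (exp (- (8 / 3 * (q * sqrt q) / (1 + (angle_scale r)\<^sup>2 * q)\<^sup>2))) * indicator {0<..} q)
        \<longlongrightarrow> 32 / 3 * (1 + 0\<^sup>2 * q) * (q * sqrt q) *
          min (exp (2 / 3 - 2 / 3 * q)) (exp (- (8 / 3 * (q * sqrt q) / (1 + 0\<^sup>2 * q)\<^sup>2))) * indicator {0<..} q) at_top"
        by (intro tendsto_intros s0) simp
      \<comment> \<open>The majorant must not cut off the limit: for \<open>q \<ge> 1\<close> one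
        has \<open>q * sqrt q \<ge> q\<close>, and for \<open>q < 1\<close> the right-hand side
        exceeds \<open>1\<close>.\<close>
      moreover have "exp (- (8 / 3 * (q * sqrt q))) \<le> exp (2 / 3 - 2 / 3 * q)"
      proof (cases "q \<ge> 1")
        case True
        then have "q * 1 \<le> q * sqrt q" by (intro mult_left_mono) auto
        then have "- (8 / 3 * (q * sqrt q)) \<le> 2 / 3 - 2 / 3 * q" using True by linarith
        then show ?thesis by (simp only: exp_le_cancel_iff)
      next
        case False
        have "0 \<le> q * sqrt q" using \<open>q > 0\<close> by simp
        then have "- (8 / 3 * (q * sqrt q)) \<le> 2 / 3 - 2 / 3 * q" using False by linarith
        then show ?thesis by (simp only: exp_le_cancel_iff)
      qed
      then have "min (exp (2 / 3 - 2 / 3 * q)) (exp (- (8 / 3 * (q * sqrt q) / (1 + 0\<^sup>2 * q)\<^sup>2))) = exp (- (8 / 3 * (q * sqrt q)))"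
        by (simp add: min_absorb2)
      ultimately show ?thesis using True by (simp only: upper_kernel_def limit_kernel_def) simp
    qed (simp add: upper_kernel_def)
  qed
qed auto

context poisson_outside
begin

lemma upper_rate_le:
  assumes r1: "r \<ge> 1" and T: "T > 0"
  shows "upper_rate T \<le> (\<integral>q. upper_kernel r q \<partial>lborel)"
proof -
  define \<phi> where "\<phi> q = 2 * (1 + s\<^sup>2 * q) * exp (- cap_mass r q)" for q :: real
  have m: "\<phi> \<in> borel_measurable borel" unfolding \<phi>_def by measurable
  have bd: "\<bar>\<phi> q\<bar> \<le> 2 * (1 + s\<^sup>2 * T) * 1" if "0 < q" "q < T" for q
  proof -
    have "0 \<le> s\<^sup>2 * q" "s\<^sup>2 * q \<le> s\<^sup>2 * T" using that by (auto intro: mult_left_mono)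
    then have "2 * (1 + s\<^sup>2 * q) * exp (- cap_mass r q) \<le> 2 * (1 + s\<^sup>2 * T) * 1" using cap_mass_nonneg[of r q] by (intro mult_mono) auto
    then show ?thesis using \<open>0 \<le> s\<^sup>2 * q\<close> by (simp add: \<phi>_def)
  qed
  then have "\<forall>q. 0 < q \<longrightarrow> q < T \<longrightarrow> \<bar>\<phi> q\<bar> \<le> 2 * (1 + s\<^sup>2 * T) * 1" by blast
  note I = integral_below[OF m this T]
  have "upper_rate T = 2 * (\<integral>z. \<phi> (fst z) * (sqrt (fst z) - snd z)\<^sup>2 * indicator (below T) z \<partial>lborel)"
    unfolding upper_rate_def by (intro arg_cong[where f = "\<lambda>x. 2 * x"] Bochner_Integration.integral_cong) (auto simp: upper_integrand_def \<phi>_def)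
  also have "\<dots> = (\<integral>q. 2 * (8 / 3 * (q * sqrt q) * \<phi> q * indicator {0<..<T} q) \<partial>lborel)"
    unfolding I(2) by (rule integral_mult_right_zero[symmetric])
  also have "\<dots> \<le> (\<integral>q. upper_kernel r q \<partial>lborel)"
  proof (rule integral_mono')
    show "integrable lborel (upper_kernel r)" by (rule upper_kernel_integrable[OF r1])
    fix q :: real
    show "0 \<le> upper_kernel r q" using upper_kernel_le_dom(1)[OF r1] .
    show "2 * (8 / 3 * (q * sqrt q) * \<phi> q * indicator {0<..<T} q) \<le> upper_kernel r q"
    proof (cases "0 < q \<and> q < T")
      case True
      then have q: "q > 0" by simp
      have "exp (- cap_mass r q) \<le> min (exp (2 / 3 - 2 / 3 * q)) (exp (- (8 / 3 * (q * sqrt q) / (1 + s\<^sup>2 * q)\<^sup>2)))"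
        using cap_mass_tail[OF r1, of q] cap_mass_ge[of q r] q by simp
      then have "32 / 3 * (1 + s\<^sup>2 * q) * (q * sqrt q) * exp (- cap_mass r q) \<le> 32 / 3 * (1 + s\<^sup>2 * q) * (q * sqrt q) * min (exp (2 / 3 - 2 / 3 * q)) (exp (- (8 / 3 * (q * sqrt q) / (1 + s\<^sup>2 * q)\<^sup>2)))"
        using q by (intro mult_left_mono) auto
      then show ?thesis using True by (simp add: upper_kernel_def \<phi>_def algebra_simps)
    next
      case False
      then have "indicator {0<..<T} q = (0::real)" by (auto simp: indicator_def)
      then show ?thesis using upper_kernel_le_dom(1)[OF r1, of q] by simp
    qed
  qed
  finally show ?thesis .
qed

end

subsection \<open>Lower tail\<close>

text \<open>A weak form of Jordan's inequality: up to \<open>pi / 3\<close> the cosine is at least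
  \<open>1 / 2\<close>, and beyond it the sine is at least \<open>sqrt 3 / 2\<close> while
  \<open>x / 4\<close> is at most \<open>1 / 2\<close>.\<close>

lemma sin_ge_quarter: assumes "0 \<le> x" "x \<le> pi / 2" shows "x / 4 \<le> sin x"
proof (cases "x \<le> pi / 3")
  case True
  have "(\<lambda>x. sin x - x / 4) 0 \<le> (\<lambda>x. sin x - x / 4) x"
  proof (rule DERIV_nonneg_imp_nondecreasing[OF assms(1)])
    fix y assume y: "0 \<le> y" "y \<le> x"
    have "cos (pi / 3) \<le> cos y" using y True pi_gt_zero by (intro cos_monotone_0_pi_le) auto
    then have "0 \<le> cos y - 1 / 4" by (simp add: cos_60)
    moreover have "((\<lambda>x. sin x - x / 4) has_real_derivative cos y - 1 / 4) (at y)"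
      by (auto intro!: derivative_eq_intros)
    ultimately show "\<exists>d. ((\<lambda>x. sin x - x / 4) has_real_derivative d) (at y) \<and> 0 \<le> d" by blast
  qed
  then show ?thesis by simp
next
  case False
  have "sin (pi / 3) \<le> sin x" using False assms pi_gt_zero by (intro sin_monotone_2pi_le) auto
  then have "sqrt 3 / 2 \<le> sin x" by (simp add: sin_60)
  moreover have "1 \<le> sqrt 3" by simp
  moreover have "x / 4 \<le> 1 / 2" using assms pi_less_4 by simp
  ultimately show ?thesis by linarith
qed

text \<open>A chord over \<open>j\<close> steps has length \<open>2 * sin (pi * j / n)\<close>,
  which is at least \<open>j / n\<close> for \<open>2 * j \<le> n\<close>; for larger
  \<open>j\<close> the complementary arc is used. The last two alternatives forget \<open>k\<close>
  and cover indices that are close across the end of the range.\<close>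

lemma grid_close:
  assumes k: "k < n" and l: "l < n" and c: "norm (grid n l - grid n k) \<le> \<rho>" and m: "real n * \<rho> \<le> real m"
  shows "(l \<le> k + m \<and> k \<le> l + m) \<or> n \<le> l + m \<or> l < m"
proof -
  have n: "n > 0" using k by simp
  have eq: "norm (grid n l - grid n k) = 2 * \<bar>sin (pi * (real l - real k) / real n)\<bar>"
    unfolding grid_def norm_dirv_diff by (simp add: diff_divide_distrib right_diff_distrib)
  define j where "j = (if k \<le> l then l - k else k - l)"
  have j: "j < n" using k l by (auto simp: j_def)
  have "\<bar>sin (pi * (real l - real k) / real n)\<bar> = \<bar>sin (pi * real j / real n)\<bar>"
  proof (cases "k \<le> l")
    case False
    then have "real l - real k = - real j" by (simp add: j_def of_nat_diff)
    then have "pi * (real l - real k) / real n = - (pi * real j / real n)" by simp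
    then show ?thesis by (simp only: sin_minus abs_minus_cancel)
  qed (simp add: j_def of_nat_diff)
  moreover have half: "real i \<le> real n * \<rho>" if i: "2 * i \<le> n" and b: "2 * sin (pi * real i / real n) \<le> \<rho>" for i
  proof -
    have "pi * real i / real n \<le> pi / 2" using i n by (simp add: field_simps)
    then have "pi * real i / real n / 4 \<le> sin (pi * real i / real n)" by (intro sin_ge_quarter) auto
    then have "pi * real i / real n / 2 \<le> \<rho>" using b by simp
    then have "pi / 2 * real i \<le> real n * \<rho>" using n by (simp add: field_simps)
    moreover have "1 * real i \<le> pi / 2 * real i" using pi_gt3 by (intro mult_right_mono) auto
    ultimately show ?thesis by simp
  qed
  have snn: "\<bar>sin (pi * real j / real n)\<bar> = sin (pi * real j / real n)"
    using j n by (intro abs_of_nonneg sin_ge_zero) (auto simp: field_simps)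
  have b: "2 * sin (pi * real j / real n) \<le> \<rho>" using c calculation unfolding eq snn by simp
  have "j \<le> m \<or> n \<le> j + m"
  proof (cases "2 * j \<le> n")
    case True
    then show ?thesis using half[OF True b] m by linarith
  next
    case False
    have "pi * real (n - j) / real n = pi - pi * real j / real n" using j n by (simp add: of_nat_diff field_simps)
    then have "sin (pi * real (n - j) / real n) = sin (pi * real j / real n)" by (simp only: sin_pi_minus)
    then have "real (n - j) \<le> real n * \<rho>" using False b by (intro half) auto
    then show ?thesis using m by linarith
  qed
  then show ?thesis using k l by (auto simp: j_def split: if_splits)
qed

lemma card_close:
  assumes k: "k < n" and m: "real n * \<rho> \<le> real m"
  shows "card {l. l < n \<and> norm (grid n l - grid n k) \<le> \<rho>} \<le> 4 * m + 1"
proof -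
  have "{l. l < n \<and> norm (grid n l - grid n k) \<le> \<rho>} \<subseteq> {k - m..k + m} \<union> {n - m..<n} \<union> {..<m}"
    using grid_close[OF k _ _ m] by fastforce
  then have "card {l. l < n \<and> norm (grid n l - grid n k) \<le> \<rho>} \<le> card ({k - m..k + m} \<union> {n - m..<n} \<union> {..<m})"
    by (intro card_mono) auto
  also have "\<dots> \<le> card {k - m..k + m} + card {n - m..<n} + card {..<m}"
    by (meson card_Un_le order_trans add_right_mono)
  also have "\<dots> \<le> 4 * m + 1" by simp
  finally show ?thesis .
qed

section \<open>Locality, independence and the second moment\<close>

context poisson_outside
begin

definition sector :: "real \<Rightarrow> real \<Rightarrow> (real ^ 2) set" where
  "sector T t = {x. x \<bullet> dirv t > 0 \<and> \<bar>width_coord r t x\<bar> < sqrt T}"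

lemma chart_sector: assumes "\<And>z. z \<in> E \<Longrightarrow> \<bar>snd z\<bar> < sqrt T" shows "chart r t E \<subseteq> sector T t"
  using assms by (force simp: chart_def sector_def)

text \<open>With \<open>\<bar>b\<bar> \<le> a * V\<close> the cosine \<open>a / norm x\<close> of
  the angle to the axis is at least \<open>1 - V\<^sup>2 / 2\<close>, and the squared chord is
  \<open>2\<close> minus twice this cosine.\<close>

lemma sector_direction:
  assumes T: "T > 0" and x: "x \<in> sector T t" shows "norm (x /\<^sub>R norm x - dirv t) \<le> s * sqrt T"
proof -
  have s: "s > 0" using angle_scale[OF r] by simp
  define V a b where "V = s * sqrt T" and "a = x \<bullet> dirv t" and "b = x \<bullet> dirv (t + pi / 2)"
  have V: "V \<ge> 0" using s T by (simp add: V_def)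
  have a: "a > 0" using x by (simp add: sector_def a_def)
  have b: "\<bar>b\<bar> \<le> a * V"
  proof -
    have "b = a * (s * width_coord r t x)" using a s by (simp add: width_coord_def a_def b_def)
    moreover have "s * \<bar>width_coord r t x\<bar> \<le> V" using x s unfolding V_def by (intro mult_left_mono) (auto simp: sector_def)
    then have "a * (s * \<bar>width_coord r t x\<bar>) \<le> a * V" using a by (intro mult_left_mono) auto
    ultimately show ?thesis using a s by (simp add: abs_mult)
  qed
  have x0: "norm x > 0" using a by (auto simp: a_def)
  have "(norm x)\<^sup>2 = a\<^sup>2 + b\<^sup>2" using inner_self_frame[of x t] by (simp add: a_def b_def dot_square_norm)
  also have "\<dots> \<le> a\<^sup>2 + (a * V)\<^sup>2" using power_mono[OF b, of 2] by simp
  also have "\<dots> \<le> a\<^sup>2 + (a * V)\<^sup>2 + (a * V\<^sup>2 / 2)\<^sup>2" by simp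
  also have "\<dots> = (a * (1 + V\<^sup>2 / 2))\<^sup>2" by (simp add: power2_eq_square algebra_simps)
  finally have "norm x \<le> a * (1 + V\<^sup>2 / 2)" using a by (intro power2_le_imp_le[of "norm x"]) auto
  then have "1 / (1 + V\<^sup>2 / 2) \<le> a / norm x" using x0 by (simp add: divide_simps add_pos_nonneg mult_ac)
  moreover have "1 - V\<^sup>2 / 2 \<le> 1 / (1 + V\<^sup>2 / 2)"
  proof -
    have "(1 - V\<^sup>2 / 2) * (1 + V\<^sup>2 / 2) \<le> 1" by (simp add: algebra_simps)
    moreover have "0 < 1 + V\<^sup>2 / 2" by (simp add: add_pos_nonneg)
    ultimately show ?thesis by (simp add: pos_le_divide_eq)
  qed
  ultimately have c: "1 - V\<^sup>2 / 2 \<le> a / norm x" by linarith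
  have "(norm (x /\<^sub>R norm x - dirv t))\<^sup>2 = 2 - 2 * (a / norm x)"
  proof -
    have "(x /\<^sub>R norm x) \<bullet> (x /\<^sub>R norm x) = 1" using x0 by (simp add: dot_square_norm power2_eq_square)
    moreover have "dirv t \<bullet> dirv t = 1" by (simp add: dot_square_norm)
    moreover have "(x /\<^sub>R norm x) \<bullet> dirv t = a / norm x" by (simp add: a_def divide_inverse)
    ultimately show ?thesis
      by (simp only: power2_norm_eq_inner inner_diff_left inner_diff_right inner_commute[of "dirv t" "x /\<^sub>R norm x"])
  qed
  also have "\<dots> \<le> V\<^sup>2" using c by simp
  finally show ?thesis unfolding V_def[symmetric] using V by (rule power2_le_imp_le)
qed

lemma sector_disjoint:
  assumes T: "T > 0" and far: "norm (dirv t - dirv t') > 2 * (s * sqrt T)"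
  shows "sector T t \<inter> sector T t' = {}"
proof (rule ccontr)
  assume "\<not> ?thesis"
  then obtain x where "x \<in> sector T t" "x \<in> sector T t'" by auto
  then have "norm (x /\<^sub>R norm x - dirv t) \<le> s * sqrt T" "norm (x /\<^sub>R norm x - dirv t') \<le> s * sqrt T"
    using sector_direction[OF T] by auto
  moreover have "norm (dirv t - dirv t') \<le> norm (x /\<^sub>R norm x - dirv t) + norm (x /\<^sub>R norm x - dirv t')"
    by (metis norm_minus_commute norm_triangle_ineq2 diff_add_cancel dist_norm dist_triangle2 dist_commute)
  ultimately show False using far by linarith
qed

text \<open>Void events are stable under intersection, so their product formula for disjoint regions already
  yields the independence of the generated sigma-algebras.\<close>

definition voids :: "(real ^ 2) set \<Rightarrow> 'w set set" where
  "voids U = {void A | A. A \<in> sets borel \<and> bounded A \<and> A \<subseteq> U}"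

lemma voids_events: "voids U \<subseteq> events" by (auto simp: voids_def)

lemma voids_indep:
  assumes "U \<inter> U' = {}"
  shows "indep_set (sigma_sets (space M) (voids U)) (sigma_sets (space M) (voids U'))"
proof (rule indep_set_sigma_sets)
  show "Int_stable (voids U)" for U
  proof (rule Int_stableI)
    fix a b assume "a \<in> voids U" "b \<in> voids U"
    then obtain A B where "A \<in> sets borel" "bounded A" "A \<subseteq> U" "B \<in> sets borel" "bounded B" "B \<subseteq> U" "a = void A" "b = void B"
      by (auto simp: voids_def)
    then show "a \<inter> b \<in> voids U" unfolding voids_def by (intro CollectI exI[of _ "A \<union> B"]) (auto simp: void_Un)
  qed
  then show "Int_stable (voids U')" .
  show "indep_set (voids U) (voids U')"
  proof (rule indep_setI[OF voids_events voids_events])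
    fix a b assume "a \<in> voids U" "b \<in> voids U'"
    then obtain A B where A: "A \<in> sets borel" "bounded A" "A \<subseteq> U" and B: "B \<in> sets borel" "bounded B" "B \<subseteq> U'"
      and ab: "a = void A" "b = void B" by (auto simp: voids_def)
    have fin: "emeasure \<mu> C \<noteq> \<infinity>" if "C \<in> sets borel" "bounded C" for C
    proof -
      have "emeasure \<mu> C = (\<integral>\<^sup>+x. indicator (- cball 0 (2 * r)) x * indicator C x \<partial>lborel)"
        using that by (subst emeasure_density) auto
      also have "\<dots> \<le> (\<integral>\<^sup>+x. indicator C x \<partial>lborel)" by (intro nn_integral_mono) (auto simp: indicator_def)
      also have "\<dots> = emeasure lborel C" using that by simp
      also have "\<dots> < \<infinity>" using emeasure_bounded_finite[OF that(2)] .
      finally show ?thesis by simp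
    qed
    have "prob (a \<inter> b) = exp (- measure \<mu> (A \<union> B))" using A B by (simp add: ab void_Un[symmetric] void_prob)
    also have "measure \<mu> (A \<union> B) = measure \<mu> A + measure \<mu> B"
      using A B assms fin by (intro measure_Union) auto
    also have "exp (- (measure \<mu> A + measure \<mu> B)) = prob a * prob b"
      using A B by (simp add: ab void_prob exp_add[symmetric])
    finally show "prob (a \<inter> b) = prob a * prob b" .
  qed
qed

text \<open>All regions that occur in \<open>turn\<close>, including the fronts by their definition,
  have widths below \<open>sqrt T\<close>; hence the event depends on the points of one sector
  only.\<close>

lemma turn_local: "turn T e h t \<in> sigma_sets (space M) (voids (sector T t))"
proof -
  interpret S: sigma_algebra "space M" "sigma_sets (space M) (voids (sector T t))"
    by (rule sigma_algebra_sigma_sets) (auto simp: voids_def void_def)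
  have v: "void (chart r t E) \<in> sigma_sets (space M) (voids (sector T t))"
    if "E \<in> sets borel" "bounded E" "\<And>z. z \<in> E \<Longrightarrow> \<bar>snd z\<bar> < sqrt T" for E
  proof -
    have "chart r t E \<subseteq> sector T t" by (rule chart_sector) (rule that(3))
    then show ?thesis
      using chart_borel[OF that(1)] bounded_chart[OF r that(2)] unfolding voids_def by (intro sigma_sets.Basic) blast
  qed
  have w: "\<bar>snd z\<bar> < sqrt T" if "z \<in> below T" for z
  proof -
    have "(fst z, snd z) \<in> below T" using that by simp
    from below_w(1,2)[OF this] show ?thesis by linarith
  qed
  have "void (chart r t (below T)) \<in> sigma_sets (space M) (voids (sector T t))"
    by (rule v[OF below_borel below_bounded w])
  moreover have "void (chart r t (cell h T c)) \<in> sigma_sets (space M) (voids (sector T t))" for c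
    by (rule v[OF cell_borel cell_bounded w]) (use cell_below in blast)
  moreover have "void (chart r t (front T e h c)) \<in> sigma_sets (space M) (voids (sector T t))" for c
    by (rule v[OF front_borel front_bounded]) (simp add: front_def)
  ultimately show ?thesis unfolding turn_def by (intro S.Diff S.top S.finite_UN finite_cell_index)
qed

lemma turn_indep:
  assumes T: "T > 0" and far: "norm (dirv t - dirv t') > 2 * (s * sqrt T)"
  shows "prob (turn T e h t \<inter> turn T e h t') = prob (turn T e h t) * prob (turn T e h t')"
  by (rule indep_setD[OF voids_indep[OF sector_disjoint[OF T far]] turn_local turn_local])

text \<open>Chebyshev's inequality: for each index at most \<open>m\<close> covariances do not
  vanish, and each is at most \<open>1\<close>, so the variance is at most \<open>n * m\<close>
  instead of \<open>n\<^sup>2\<close>.\<close>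

lemma count_tail:
  assumes Aev: "\<And>k. k < n \<Longrightarrow> A k \<in> events" and n: "n > 0"
    and dep: "\<And>k. k < n \<Longrightarrow> card {l. l < n \<and> prob (A l \<inter> A k) \<noteq> prob (A l) * prob (A k)} \<le> m"
    and p: "\<And>k. k < n \<Longrightarrow> p \<le> prob (A k)" and \<kappa>: "\<kappa> > 0"
  shows "prob {\<omega> \<in> space M. real (card {k. k < n \<and> \<omega> \<in> A k}) \<le> real n * (p - \<kappa>)} \<le> real m / (real n * \<kappa>\<^sup>2)"
proof -
  define X where "X \<omega> = (\<Sum>k<n. indicator (A k) \<omega> :: real)" for \<omega>
  have Xcard: "X \<omega> = real (card {k. k < n \<and> \<omega> \<in> A k})" for \<omega>
  proof -
    have "X \<omega> = (\<Sum>k\<in>{k. k < n \<and> \<omega> \<in> A k}. 1)"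
      unfolding X_def by (intro sum.mono_neutral_cong_right) (auto simp: indicator_def)
    then show ?thesis by simp
  qed
  have Xm[measurable]: "X \<in> borel_measurable M" unfolding X_def using Aev by (intro borel_measurable_sum) auto
  have Xb: "\<bar>X \<omega>\<bar> \<le> real n" for \<omega> unfolding Xcard using card_mono[of "{..<n}" "{k. k < n \<and> \<omega> \<in> A k}"] by auto
  have iX: "integrable M X" by (rule integrable_const_bound[where B = "real n"]) (use Xb in auto)
  have X2: "X \<omega> ^ 2 = (\<Sum>k<n. \<Sum>l<n. indicator (A l \<inter> A k) \<omega>)" for \<omega>
    unfolding X_def power2_eq_square sum_product by (subst sum.swap) (simp add: indicator_inter_arith)
  have iX2: "integrable M (\<lambda>\<omega>. X \<omega> ^ 2)"
    by (rule integrable_const_bound[where B = "real n ^ 2"]) (use Xb power_mono[OF Xb, where n = 2] in auto)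
  have EX: "expectation X = (\<Sum>k<n. prob (A k))"
    unfolding X_def using Aev by (subst Bochner_Integration.integral_sum) (auto simp: emeasure_eq_measure)
  have EX2: "expectation (\<lambda>\<omega>. X \<omega> ^ 2) = (\<Sum>k<n. \<Sum>l<n. prob (A l \<inter> A k))"
  proof -
    have ii: "integrable M (indicator (A l \<inter> A k) :: 'w \<Rightarrow> real)" if "k < n" "l < n" for k l
      using Aev that by (intro integrable_real_indicator) (auto simp: emeasure_eq_measure)
    have "expectation (\<lambda>\<omega>. X \<omega> ^ 2) = (\<Sum>k<n. expectation (\<lambda>\<omega>. \<Sum>l<n. indicator (A l \<inter> A k) \<omega>))"
      unfolding X2 by (intro Bochner_Integration.integral_sum Bochner_Integration.integrable_sum ii) auto
    also have "\<dots> = (\<Sum>k<n. \<Sum>l<n. expectation (indicator (A l \<inter> A k)))"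
      by (intro sum.cong refl Bochner_Integration.integral_sum ii) auto
    also have "\<dots> = (\<Sum>k<n. \<Sum>l<n. prob (A l \<inter> A k))"
    proof (intro sum.cong refl)
      fix k l assume "k \<in> {..<n}" "l \<in> {..<n}"
      then have "A l \<inter> A k \<subseteq> space M" using Aev sets.sets_into_space by blast
      then show "expectation (indicator (A l \<inter> A k)) = prob (A l \<inter> A k)" by (simp add: Int_absorb1 Int_absorb2)
    qed
    finally show ?thesis .
  qed
  have "variance X = expectation (\<lambda>\<omega>. X \<omega> ^ 2) - (expectation X)\<^sup>2"
    using iX iX2 by (rule variance_eq)
  also have "(expectation X)\<^sup>2 = (\<Sum>k<n. \<Sum>l<n. prob (A l) * prob (A k))"
    unfolding EX power2_eq_square sum_product by (subst sum.swap) simp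
  also have "expectation (\<lambda>\<omega>. X \<omega> ^ 2) - \<dots> = (\<Sum>k<n. \<Sum>l<n. prob (A l \<inter> A k) - prob (A l) * prob (A k))"
    unfolding EX2 by (simp add: sum_subtractf)
  also have "\<dots> \<le> (\<Sum>k<n. real m)"
  proof (rule sum_mono)
    fix k assume k: "k \<in> {..<n}"
    let ?D = "{l. l < n \<and> prob (A l \<inter> A k) \<noteq> prob (A l) * prob (A k)}"
    have "(\<Sum>l<n. prob (A l \<inter> A k) - prob (A l) * prob (A k)) = (\<Sum>l\<in>?D. prob (A l \<inter> A k) - prob (A l) * prob (A k))"
      by (intro sum.mono_neutral_right) auto
    also have "\<dots> \<le> (\<Sum>l\<in>?D. 1)"
      by (intro sum_mono) (smt (verit) prob_le_1 measure_nonneg mult_nonneg_nonneg)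
    also have "\<dots> \<le> real m" using dep k by simp
    finally show "(\<Sum>l<n. prob (A l \<inter> A k) - prob (A l) * prob (A k)) \<le> real m" .
  qed
  finally have var: "variance X \<le> real n * real m" by simp
  have np: "real n * p \<le> expectation X"
    unfolding EX using sum_mono[of "{..<n}" "\<lambda>k. p" "\<lambda>k. prob (A k)"] p by simp
  have nk: "real n * \<kappa> > 0" using n \<kappa> by simp
  have "prob {\<omega> \<in> space M. X \<omega> \<le> real n * (p - \<kappa>)} \<le> prob {\<omega> \<in> space M. real n * \<kappa> \<le> \<bar>X \<omega> - expectation X\<bar>}"
  proof (rule finite_measure_mono)
    show "{\<omega> \<in> space M. X \<omega> \<le> real n * (p - \<kappa>)} \<subseteq> {\<omega> \<in> space M. real n * \<kappa> \<le> \<bar>X \<omega> - expectation X\<bar>}"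
    proof clarify
      fix \<omega> assume "X \<omega> \<le> real n * (p - \<kappa>)"
      then have "real n * \<kappa> \<le> expectation X - X \<omega>" using np by (simp add: right_diff_distrib)
      then show "real n * \<kappa> \<le> \<bar>X \<omega> - expectation X\<bar>" by linarith
    qed
  qed auto
  also have "\<dots> \<le> variance X / (real n * \<kappa>)\<^sup>2" by (rule Chebyshev_inequality[OF Xm iX2 nk])
  also have "\<dots> \<le> (real n * real m) / (real n * \<kappa>)\<^sup>2" by (intro divide_right_mono var) auto
  also have "\<dots> = real m / (real n * \<kappa>\<^sup>2)" using n by (simp add: power2_eq_square)
  finally show ?thesis by (simp add: Xcard)
qed

lemma boundary_chart:
  assumes "norm x = 2 * r" "x \<bullet> dirv t > 0" shows "height_coord r t x = (width_coord r t x)\<^sup>2"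
proof -
  have s: "s > 0" using angle_scale[OF r] by simp
  define a b where "a = x \<bullet> dirv t" and "b = x \<bullet> dirv (t + pi / 2)"
  have a: "a > 0" using assms by (simp add: a_def)
  have xx: "x \<bullet> x = 4 * r\<^sup>2" "x \<bullet> x = a\<^sup>2 + b\<^sup>2"
    using assms inner_self_frame[of x t] by (auto simp: dot_square_norm a_def b_def power_mult_distrib)
  have "s\<^sup>2 * height_coord r t x = (x \<bullet> x)\<^sup>2 / (4 * a\<^sup>2 * r\<^sup>2) - 1" using s by (simp add: height_coord_def a_def)
  also have "\<dots> = (x \<bullet> x) / a\<^sup>2 - 1" using a r by (simp add: xx(1) power2_eq_square)
  also have "\<dots> = b\<^sup>2 / a\<^sup>2" using a by (simp add: xx(2) add_divide_distrib)
  also have "\<dots> = s\<^sup>2 * (width_coord r t x)\<^sup>2"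
  proof -
    have "width_coord r t x = b / a / s" by (simp only: width_coord_def a_def b_def)
    then show ?thesis using s by (simp add: power_divide power_mult_distrib)
  qed
  finally show ?thesis using s by simp
qed

text \<open>The event provides a point below height \<open>T\<close>, so \<open>z\<close> can be
  nearest only if its own height is below \<open>T\<close>. On the circle the height is the square
  of the width by \<open>boundary_chart\<close>.\<close>

lemma turn_boundary_point:
  assumes T: "T > 0" and w: "\<omega> \<in> turn T e h t" and z: "norm z = 2 * r"
    and near: "z \<in> nearest (insert z (\<Phi> \<omega>)) (dirv t)"
  shows "z \<in> sector T t"
proof -
  obtain y where y: "y \<in> \<Phi> \<omega>" "y \<in> chart r t (below T)" using w by (auto simp: turn_def void_def)
  have s: "s > 0" using angle_scale[OF r] by simp
  have ya: "y \<bullet> dirv t > 0" and yq: "height_coord r t y < T" using y by (auto simp: chart_def below_def)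
  have nz: "nearness y (dirv t) \<le> nearness z (dirv t)" using near y by (auto simp: nearest_def)
  have "nearness y (dirv t) > 0" unfolding nearness_chart(2)[OF r ya] using nearness_chart(1)[OF r ya] r by simp
  then have "nearness z (dirv t) > 0" using nz by linarith
  then have za: "z \<bullet> dirv t > 0" by (rule nearness_pos)
  have "1 / (2 * r * sqrt (1 + s\<^sup>2 * height_coord r t y)) \<le> 1 / (2 * r * sqrt (1 + s\<^sup>2 * height_coord r t z))"
    using nz unfolding nearness_chart(2)[OF r ya] nearness_chart(2)[OF r za] .
  then have "sqrt (1 + s\<^sup>2 * height_coord r t z) \<le> sqrt (1 + s\<^sup>2 * height_coord r t y)"
    using nearness_chart(1)[OF r ya] nearness_chart(1)[OF r za] r by (simp add: field_simps)
  then have "height_coord r t z \<le> height_coord r t y" using s by simp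
  then have "(width_coord r t z)\<^sup>2 < T" using yq boundary_chart[OF z za] by simp
  then have "\<bar>width_coord r t z\<bar> < sqrt T" by (simp add: real_less_rsqrt)
  then show ?thesis using za by (simp add: sector_def)
qed

text \<open>The additional point can spoil a change only in directions where it is nearest, whose
  sectors contain it. Any two such directions are close, so at most \<open>4 * m + 1\<close> indices
  are lost; the same number bounds the dependent events for each index.\<close>

lemma lower_tail:
  assumes r1: "r \<ge> 1" and Y: "AE \<omega> in M. norm (Y \<omega>) = 2 * r"
    and num: "(\<lambda>\<omega>. num_sides (voronoi_cell (insert (Y \<omega>) (\<Phi> \<omega>)))) \<in> measurable M (count_space UNIV)"
    and T: "T > 0" and e: "e > 0" and h: "0 < h" "h \<le> 1"
    and n: "n > 4" and \<sigma>: "e \<le> tan (2 * pi / real n) / s" "tan (2 * pi / real n) / s \<le> 2 * e"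
    and small: "s\<^sup>2 * (2 * e) * sqrt T \<le> 1 / 2" "16 * s\<^sup>2 * e\<^sup>2 * T * (1 + s\<^sup>2 * T) \<le> e * h"
    and p: "\<And>t. p \<le> prob (turn T e h t)" and \<kappa>: "\<kappa> > 0"
    and m: "real n * (2 * (s * sqrt T)) \<le> real m"
  shows "prob {\<omega> \<in> space M. real (num_sides (voronoi_cell (insert (Y \<omega>) (\<Phi> \<omega>)))) + real (4 * m + 1) \<le> real n * (p - \<kappa>)}
      \<le> real (4 * m + 1) / (real n * \<kappa>\<^sup>2)"
proof -
  define A where "A k = turn T e h (2 * pi * real k / real n)" for k :: nat
  have n0: "n > 0" using n by simp
  have dl: "0 < 2 * pi / real n" "2 * pi / real n < pi / 2" using n by (auto simp: field_simps)
  have tail: "prob {\<omega> \<in> space M. real (card {k. k < n \<and> \<omega> \<in> A k}) \<le> real n * (p - \<kappa>)} \<le> real (4 * m + 1) / (real n * \<kappa>\<^sup>2)"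
  proof (rule count_tail[OF _ n0 _ _ \<kappa>])
    fix k assume k: "k < n"
    have "{l. l < n \<and> prob (A l \<inter> A k) \<noteq> prob (A l) * prob (A k)} \<subseteq> {l. l < n \<and> norm (grid n l - grid n k) \<le> 2 * (s * sqrt T)}"
      using turn_indep[OF T] unfolding A_def grid_def by (auto simp: not_less[symmetric])
    then have "card {l. l < n \<and> prob (A l \<inter> A k) \<noteq> prob (A l) * prob (A k)} \<le> card {l. l < n \<and> norm (grid n l - grid n k) \<le> 2 * (s * sqrt T)}"
      by (intro card_mono) auto
    also have "\<dots> \<le> 4 * m + 1" by (rule card_close[OF k m])
    finally show "card {l. l < n \<and> prob (A l \<inter> A k) \<noteq> prob (A l) * prob (A k)} \<le> 4 * m + 1" .
  qed (use p in \<open>auto simp: A_def\<close>)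
  have ae: "AE \<omega> in M. card {k. k < n \<and> \<omega> \<in> A k} \<le> num_sides (voronoi_cell (insert (Y \<omega>) (\<Phi> \<omega>))) + (4 * m + 1)"
    using AE_around[OF r1] AE_outside Y
  proof eventually_elim
    case (elim \<omega>)
    then obtain B :: nat where B: "\<omega> \<in> around (real B)" by auto
    \<comment> \<open>The successor makes the level positive, as \<open>around_surrounded\<close>
      requires.\<close>
    then have B': "\<omega> \<in> around (real (Suc B))" using around_mono[of "real B" "real (Suc B)"] by auto
    note sur = around_surrounded(2)[OF r1 _ B' elim(2,3)]
    interpret surrounded "insert (Y \<omega>) (\<Phi> \<omega>)" "1 / (6 * r * sqrt (1 + s\<^sup>2 * real (Suc B)))" "2 * r"
      by (rule sur) simp
    define Bad where "Bad = {k. k < n \<and> Y \<omega> \<in> sector T (2 * pi * real k / real n)}"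
    define Ak where "Ak = {k. k < n \<and> \<omega> \<in> A k}"
    have cB: "card Bad \<le> 4 * m + 1"
    proof (cases "Bad = {}")
      case False
      then obtain k where k: "k \<in> Bad" by auto
      have "Bad \<subseteq> {l. l < n \<and> norm (grid n l - grid n k) \<le> 2 * (s * sqrt T)}"
      proof
        fix l assume l: "l \<in> Bad"
        then have "sector T (2 * pi * real l / real n) \<inter> sector T (2 * pi * real k / real n) \<noteq> {}"
          using k by (auto simp: Bad_def)
        then have "\<not> norm (dirv (2 * pi * real l / real n) - dirv (2 * pi * real k / real n)) > 2 * (s * sqrt T)"
          using sector_disjoint[OF T] by blast
        then show "l \<in> {l. l < n \<and> norm (grid n l - grid n k) \<le> 2 * (s * sqrt T)}"
          using l by (auto simp: Bad_def grid_def)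
      qed
      then have "card Bad \<le> card {l. l < n \<and> norm (grid n l - grid n k) \<le> 2 * (s * sqrt T)}" by (intro card_mono) auto
      also have "\<dots> \<le> 4 * m + 1" using k by (intro card_close m) (simp add: Bad_def)
      finally show ?thesis .
    qed simp
    have "card (Ak - Bad) \<le> num_sides (voronoi_cell (insert (Y \<omega>) (\<Phi> \<omega>)))"
    proof (rule num_sides_ge[where n = n])
      show "Ak - Bad \<subseteq> {..<n}" by (auto simp: Ak_def)
      fix k assume k: "k \<in> Ak - Bad"
      define t where "t = 2 * pi * real k / real n"
      have gr: "grid n k = dirv t" "grid n (Suc k) = dirv (t + 2 * pi / real n)"
        using n0 by (auto simp: grid_def t_def add_divide_distrib algebra_simps)
      have tw: "\<omega> \<in> turn T e h t" using k by (simp add: Ak_def A_def t_def)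
      have ns: "Y \<omega> \<notin> sector T t" using k by (auto simp: Ak_def Bad_def t_def)
      have no: "nearest (\<Phi> \<omega>) (dirv t) \<inter> nearest (\<Phi> \<omega>) (dirv (t + 2 * pi / real n)) = {}"
        by (rule turn_no_common[OF T e h dl \<sigma> small tw elim(2)])
      have "Y \<omega> \<notin> nearest (insert (Y \<omega>) (\<Phi> \<omega>)) (dirv t)" using turn_boundary_point[OF T tw elim(3)] ns by blast
      then show "nearest (insert (Y \<omega>) (\<Phi> \<omega>)) (grid n k) \<inter> nearest (insert (Y \<omega>) (\<Phi> \<omega>)) (grid n (Suc k)) = {}"
        unfolding gr using nearest_mono no by blast
    qed
    moreover have "card Ak \<le> card (Ak - Bad) + card Bad"
    proof -
      have "finite Ak" "finite Bad" by (auto simp: Ak_def Bad_def)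
      then have "card Ak \<le> card ((Ak - Bad) \<union> Bad)" by (intro card_mono) auto
      also have "\<dots> \<le> card (Ak - Bad) + card Bad" by (rule card_Un_le)
      finally show ?thesis .
    qed
    ultimately show ?case using cB unfolding Ak_def by linarith
  qed
  have Am: "A k \<in> events" for k by (simp add: A_def)
  have [measurable]: "(\<lambda>\<omega>. real (card {k. k < n \<and> \<omega> \<in> A k})) \<in> borel_measurable M"
  proof -
    have "real (card {k. k < n \<and> \<omega> \<in> A k}) = (\<Sum>k<n. indicator (A k) \<omega>)" for \<omega>
    proof -
      have "(\<Sum>k<n. indicator (A k) \<omega> :: real) = (\<Sum>k\<in>{k. k < n \<and> \<omega> \<in> A k}. 1)"
        by (intro sum.mono_neutral_cong_right) (auto simp: indicator_def)
      then show ?thesis by simp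
    qed
    then show ?thesis using Am by simp
  qed
  have "prob {\<omega> \<in> space M. real (num_sides (voronoi_cell (insert (Y \<omega>) (\<Phi> \<omega>)))) + real (4 * m + 1) \<le> real n * (p - \<kappa>)}
      \<le> prob {\<omega> \<in> space M. real (card {k. k < n \<and> \<omega> \<in> A k}) \<le> real n * (p - \<kappa>)}"
  proof (rule finite_measure_mono_AE)
    show "AE \<omega> in M. \<omega> \<in> {\<omega> \<in> space M. real (num_sides (voronoi_cell (insert (Y \<omega>) (\<Phi> \<omega>)))) + real (4 * m + 1) \<le> real n * (p - \<kappa>)}
        \<longrightarrow> \<omega> \<in> {\<omega> \<in> space M. real (card {k. k < n \<and> \<omega> \<in> A k}) \<le> real n * (p - \<kappa>)}"
      using ae
    proof eventually_elim
      case (elim \<omega>)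
      then have "real (card {k. k < n \<and> \<omega> \<in> A k}) \<le> real (num_sides (voronoi_cell (insert (Y \<omega>) (\<Phi> \<omega>)))) + real (4 * m + 1)"
        by (simp flip: of_nat_add)
      then show ?case by auto
    qed
  qed measurable
  then show ?thesis using tail by linarith
qed

end

subsection \<open>Convergence\<close>

text \<open>The distribution of a non-measurable map is the null measure, since the preimages outside the
  sigma-algebra are given measure \<open>0\<close>.\<close>

lemma measurable_if_distr_prob:
  assumes "prob_space P" and N: "N \<in> measurable P (count_space UNIV)"
    and eq: "distr P (count_space UNIV) N = distr M (count_space UNIV) (f :: 'a \<Rightarrow> 'b::countable)"
  shows "f \<in> measurable M (count_space UNIV)"
proof -
  interpret P: prob_space P by fact
  let ?D = "distr M (count_space UNIV) f"
  define \<nu> where "\<nu> A = emeasure M (f -` A \<inter> space M)" for A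
  have D1: "emeasure ?D UNIV = 1"
    unfolding eq[symmetric] using N P.emeasure_space_1 by (subst emeasure_distr) (auto simp: measurable_space)
  have conv: "emeasure ?D A = (if measure_space UNIV (sigma_sets UNIV UNIV) \<nu> then \<nu> A else 0)" for A
    unfolding distr_def \<nu>_def[abs_def, symmetric]
    by (subst emeasure_measure_of_conv) (auto simp: sigma_sets_top[of UNIV, simplified] intro: sigma_sets.Basic)
  have nu: "emeasure ?D A = \<nu> A" for A using D1 conv[of UNIV] conv[of A] by (auto split: if_splits)
  have "f -` {a} \<inter> space M \<in> sets M" for a
  proof (rule ccontr)
    assume n: "f -` {a} \<inter> space M \<notin> sets M"
    have "f -` (- {a}) \<inter> space M = space M - (f -` {a} \<inter> space M)" by auto
    then have n': "f -` (- {a}) \<inter> space M \<notin> sets M"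
      using n sets.compl_sets[of "space M - (f -` {a} \<inter> space M)" M] by (metis Diff_Diff_Int inf.absorb_iff2 inf_le2 inf_commute)
    \<comment> \<open>Both the singleton and its complement would have mass \<open>0\<close>,
      against the total mass \<open>1\<close>.\<close>
    have "emeasure ?D {a} + emeasure ?D (- {a}) = emeasure ?D ({a} \<union> - {a})"
      by (rule plus_emeasure) auto
    then show False using D1 nu n n' by (simp add: \<nu>_def emeasure_notin_sets)
  qed
  then show ?thesis by (subst measurable_count_space_eq_countable) auto
qed

lemma poisson_given_inradiusE:
  assumes r: "r > 0" and Z: "poisson_given_inradius M r Z"
  obtains \<Phi> Y where "poisson_outside M r \<Phi>" "AE \<omega> in M. norm (Y \<omega>) = 2 * r"
    "\<And>\<omega>. \<omega> \<in> space M \<Longrightarrow> Z \<omega> = insert (Y \<omega>) (\<Phi> \<omega>)"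
proof -
  obtain \<Phi> X where P: "poisson_process M (density lborel (indicator (- cball 0 (2 * r)))) \<Phi>"
    and X: "distr M borel X = uniform_unit_circle" and Xm: "X \<in> borel_measurable M"
    and Zeq: "\<And>\<omega>. \<omega> \<in> space M \<Longrightarrow> Z \<omega> = \<Phi> \<omega> \<union> {(2 * r) *\<^sub>R X \<omega>}"
    using Z unfolding poisson_given_inradius_def by blast
  have "AE \<omega> in M. norm (X \<omega>) = 1"
    using AE_norm_uniform_unit_circle unfolding X[symmetric] by (subst (asm) AE_distr_iff) (use Xm in auto)
  then have "AE \<omega> in M. norm ((2 * r) *\<^sub>R X \<omega>) = 2 * r" by eventually_elim (use r in simp)
  moreover have "poisson_outside M r \<Phi>" using r P by unfold_locales
  ultimately show ?thesis using that[of \<Phi> "\<lambda>\<omega>. (2 * r) *\<^sub>R X \<omega>"] Zeq by auto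
qed

section \<open>Mesh proportional to the angular scale, and choice of parameters\<close>

lemma angle_scale_powr: "r > 0 \<Longrightarrow> r powr (2 / 3) = 1 / angle_scale r"
  using powr_minus_divide[of r "2 / 3"] by (simp add: angle_scale_def)

lemma angle_scale_tendsto: "(angle_scale \<longlongrightarrow> 0) at_top" unfolding angle_scale_def by real_asymp

lemma side_const_pos: "side_const > 0"
  by (simp add: side_const_def Gamma_real_pos)

lemma le_tan: assumes "0 \<le> x" "x < pi / 2" shows "x \<le> tan x"
proof -
  have "0 \<le> tan x" using assms tan_gt_zero[of x] by (cases "x = 0") auto
  then show ?thesis using abs_tan_ge[of x] assms by simp
qed

text \<open>Rounding down makes the step \<open>2 * pi / n\<close> at least
  \<open>e * angle_scale r\<close>, which with \<open>x \<le> tan x\<close> yields the lower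
  condition on \<open>tan d / s\<close> in \<open>turn_no_common\<close>.\<close>

definition num_dirs :: "real \<Rightarrow> real \<Rightarrow> nat" where "num_dirs e r = nat \<lfloor>2 * pi / (e * angle_scale r)\<rfloor>"

lemma num_dirs_bounds:
  assumes "e > 0" "r > 0"
  shows "real (num_dirs e r) \<le> 2 * pi / (e * angle_scale r)" "2 * pi / (e * angle_scale r) - 1 \<le> real (num_dirs e r)"
proof -
  have "0 \<le> 2 * pi / (e * angle_scale r)" using assms angle_scale(1)[of r] by simp
  then show "real (num_dirs e r) \<le> 2 * pi / (e * angle_scale r)" "2 * pi / (e * angle_scale r) - 1 \<le> real (num_dirs e r)"
    unfolding num_dirs_def by linarith+
qed

lemma num_dirs_filterlim: assumes "e > 0" shows "filterlim (num_dirs e) at_top at_top"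
  unfolding num_dirs_def angle_scale_def using assms by real_asymp

lemma num_dirs_angle_scale: assumes e: "e > 0" shows "((\<lambda>r. real (num_dirs e r) * angle_scale r) \<longlongrightarrow> 2 * pi / e) at_top"
proof (rule tendsto_sandwich)
  have ev: "\<forall>\<^sub>F r::real in at_top. r > 0" by (rule eventually_gt_at_top)
  show "\<forall>\<^sub>F r in at_top. 2 * pi / e - angle_scale r \<le> real (num_dirs e r) * angle_scale r"
    using ev
  proof eventually_elim
    case (elim r)
    have "(2 * pi / (e * angle_scale r) - 1) * angle_scale r \<le> real (num_dirs e r) * angle_scale r"
      using num_dirs_bounds(2)[OF e elim] angle_scale(1)[OF elim] by (intro mult_right_mono) auto
    then show ?case using angle_scale(1)[OF elim] by (simp add: left_diff_distrib)
  qed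
  show "\<forall>\<^sub>F r in at_top. real (num_dirs e r) * angle_scale r \<le> 2 * pi / e"
    using ev
  proof eventually_elim
    case (elim r)
    have "real (num_dirs e r) * angle_scale r \<le> 2 * pi / (e * angle_scale r) * angle_scale r"
      using num_dirs_bounds(1)[OF e elim] angle_scale(1)[OF elim] by (intro mult_right_mono) auto
    then show ?case using angle_scale(1)[OF elim] by simp
  qed
  have "((\<lambda>r. 2 * pi / e - angle_scale r) \<longlongrightarrow> 2 * pi / e - 0) at_top" by (intro tendsto_intros angle_scale_tendsto)
  then show "((\<lambda>r. 2 * pi / e - angle_scale r) \<longlongrightarrow> 2 * pi / e) at_top" by simp
qed simp

lemma num_dirs_tan: assumes e: "e > 0" shows "((\<lambda>r. tan (2 * pi / real (num_dirs e r)) / angle_scale r) \<longlongrightarrow> e) at_top"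
proof -
  have "((\<lambda>r. real (num_dirs e r) * tan (2 * pi / real (num_dirs e r))) \<longlongrightarrow> 2 * pi) at_top"
    using filterlim_compose[OF lim_n_tan_angle num_dirs_filterlim[OF e]] .
  then have "((\<lambda>r. (real (num_dirs e r) * tan (2 * pi / real (num_dirs e r))) / (real (num_dirs e r) * angle_scale r)) \<longlongrightarrow> 2 * pi / (2 * pi / e)) at_top"
    by (rule tendsto_divide[OF _ num_dirs_angle_scale[OF e]]) (use e in simp)
  then have "((\<lambda>r. (real (num_dirs e r) * tan (2 * pi / real (num_dirs e r))) / (real (num_dirs e r) * angle_scale r)) \<longlongrightarrow> e) at_top" by simp
  moreover have "\<forall>\<^sub>F r in at_top. num_dirs e r > 0"
    using num_dirs_filterlim[OF e, unfolded filterlim_at_top, rule_format, of 1] by eventually_elim simp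
  then have "\<forall>\<^sub>F r in at_top. (real (num_dirs e r) * tan (2 * pi / real (num_dirs e r))) / (real (num_dirs e r) * angle_scale r) = tan (2 * pi / real (num_dirs e r)) / angle_scale r"
    by eventually_elim simp
  ultimately show ?thesis by (rule Lim_transform_eventually)
qed

text \<open>The order of choice matters: \<open>T\<close> brings \<open>partial_limit T\<close>
  close to \<open>a\<close>, then \<open>e\<close> depends on \<open>T\<close> so that the quadratic
  term is small against \<open>e * a\<close>, and \<open>h\<close> depends on both. The limit in
  \<open>r\<close> is taken last, with these three fixed.\<close>

lemma choose_parameters:
  assumes \<kappa>: "0 < \<kappa>" "\<kappa> < 1" and a: "a = side_const / (2 * pi)"
  obtains T e h where "T > 0" "e > 0" "0 < h" "h \<le> 1" "32 * e * T \<le> 4"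
    "1 + 32 * e\<^sup>2 * T\<^sup>2 - e * partial_limit T \<le> 1 - e * a * (1 - \<kappa> / 4)"
    "exp (4 * sqrt T * (h + 3 * e * h)) * (1 - e * a * (1 - \<kappa> / 4)) < 1 - e * a * (1 - \<kappa> / 3)"
proof -
  have a0: "a > 0" using side_const_pos by (simp add: a)
  have "a * (1 - \<kappa> / 8) < a" using a0 \<kappa> by simp
  then have "\<forall>\<^sub>F T in at_top. a * (1 - \<kappa> / 8) < partial_limit T"
    using order_tendstoD(1)[OF partial_limit_tendsto] by (simp add: a)
  then have "\<forall>\<^sub>F T in at_top. a * (1 - \<kappa> / 8) < partial_limit T \<and> T > 0"
    using eventually_gt_at_top[of "0::real"] by eventually_elim auto
  then obtain T where T: "a * (1 - \<kappa> / 8) < partial_limit T" "T > 0"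
    using eventually_happens'[OF trivial_limit_at_top_linorder] by blast
  \<comment> \<open>The first entry gives \<open>32 * e * T \<le> 4\<close>, the second
    \<open>32 * e\<^sup>2 * T\<^sup>2 \<le> e * a * \<kappa> / 8\<close>.\<close>
  define e where "e = min (1 / (8 * T)) (a * \<kappa> / (256 * T\<^sup>2))"
  have e: "e > 0" using a0 \<kappa> T by (simp add: e_def)
  have e1: "32 * e * T \<le> 4"
  proof -
    have "e \<le> 1 / (8 * T)" by (simp add: e_def)
    then show ?thesis using T by (simp add: field_simps)
  qed
  have e2: "32 * e\<^sup>2 * T\<^sup>2 \<le> e * a * \<kappa> / 8"
  proof -
    have "e \<le> a * \<kappa> / (256 * T\<^sup>2)" by (simp add: e_def)
    then have "32 * T\<^sup>2 * e \<le> a * \<kappa> / 8" using T by (simp add: field_simps)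
    then have "e * (32 * T\<^sup>2 * e) \<le> e * (a * \<kappa> / 8)" using e by (intro mult_left_mono) auto
    then show ?thesis by (simp add: power2_eq_square mult_ac)
  qed
  have e3: "1 + 32 * e\<^sup>2 * T\<^sup>2 - e * partial_limit T \<le> 1 - e * a * (1 - \<kappa> / 4)"
    using e2 mult_left_mono[OF less_imp_le[OF T(1)], of e] e by (simp add: algebra_simps)
  have "((\<lambda>h. exp (4 * sqrt T * (h + 3 * e * h)) * (1 - e * a * (1 - \<kappa> / 4))) \<longlongrightarrow>
      exp (4 * sqrt T * (0 + 3 * e * 0)) * (1 - e * a * (1 - \<kappa> / 4))) (at_right 0)"
    by (intro tendsto_intros)
  \<comment> \<open>At \<open>h = 0\<close> the inequality is strict because
    \<open>\<kappa> / 4 < \<kappa> / 3\<close>; this leaves room for a positive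
    \<open>h\<close>.\<close>
  moreover have "exp (4 * sqrt T * (0 + 3 * e * 0)) * (1 - e * a * (1 - \<kappa> / 4)) < 1 - e * a * (1 - \<kappa> / 3)"
    using mult_strict_left_mono[of "1 - \<kappa> / 3" "1 - \<kappa> / 4" "e * a"] mult_pos_pos[OF e a0] \<kappa> by simp
  ultimately have "\<forall>\<^sub>F h in at_right 0. exp (4 * sqrt T * (h + 3 * e * h)) * (1 - e * a * (1 - \<kappa> / 4)) < 1 - e * a * (1 - \<kappa> / 3)"
    by (rule order_tendstoD(2))
  moreover have "\<forall>\<^sub>F h::real in at_right 0. 0 < h" by (rule eventually_at_right_less)
  moreover have "\<forall>\<^sub>F h::real in at_right 0. h < 1" using eventually_at_right[of 0 "1::real"] by (auto intro!: exI[of _ 1])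
  ultimately have "\<forall>\<^sub>F h in at_right 0. exp (4 * sqrt T * (h + 3 * e * h)) * (1 - e * a * (1 - \<kappa> / 4)) < 1 - e * a * (1 - \<kappa> / 3) \<and> 0 < h \<and> h \<le> 1"
    by eventually_elim auto
  then obtain h where "exp (4 * sqrt T * (h + 3 * e * h)) * (1 - e * a * (1 - \<kappa> / 4)) < 1 - e * a * (1 - \<kappa> / 3)" "0 < h" "h \<le> 1"
    using eventually_happens'[OF trivial_limit_at_right_real] by blast
  then show ?thesis using that T e e1 e3 by blast
qed

text \<open>The relative loss \<open>\<kappa>\<close> is divided up: \<open>\<kappa> / 3\<close> for
  the probability of a change, \<open>\<kappa> / 6\<close> for the deviation in Chebyshev's
  inequality, and the remaining \<open>\<kappa> / 2\<close> for the rounding of the number of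
  directions and the \<open>4 * m + 1\<close> spoiled indices. The last two are bounded, while the
  main term grows like the inverse of \<open>angle_scale r\<close>.\<close>

lemma lower_tail_eventually:
  fixes M :: "real \<Rightarrow> 'a measure" and Z :: "real \<Rightarrow> 'a \<Rightarrow> (real ^ 2) set"
  assumes Z: "\<And>r. r > 0 \<Longrightarrow> poisson_given_inradius (M r) r (Z r)"
    and meas: "\<And>r. r > 0 \<Longrightarrow> (\<lambda>\<omega>. num_sides (voronoi_cell (Z r \<omega>))) \<in> measurable (M r) (count_space UNIV)"
    and \<kappa>: "0 < \<kappa>" "\<kappa> < 1"
  shows "\<forall>\<^sub>F r in at_top. measure (M r) {\<omega> \<in> space (M r). real (num_sides (voronoi_cell (Z r \<omega>))) < (1 - \<kappa>) * (side_const * r powr (2 / 3))} \<le> \<kappa>"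
proof -
  define a where "a = side_const / (2 * pi)"
  have a0: "a > 0" using side_const_pos by (simp add: a_def)
  obtain T e h where T: "T > 0" and e: "e > 0" and h: "0 < h" "h \<le> 1" and e1: "32 * e * T \<le> 4"
    and e3: "1 + 32 * e\<^sup>2 * T\<^sup>2 - e * partial_limit T \<le> 1 - e * a * (1 - \<kappa> / 4)"
    and h3: "exp (4 * sqrt T * (h + 3 * e * h)) * (1 - e * a * (1 - \<kappa> / 4)) < 1 - e * a * (1 - \<kappa> / 3)"
    using choose_parameters[OF \<kappa> a_def] .
  define \<rho> where "\<rho> r = (2 - 2 / (1 + (angle_scale r)\<^sup>2 * T)\<^sup>2) * (4 / 3 * (T * sqrt T) + 4 * e * T) + 4 * sqrt T * (h + 3 * e * h)" for r
  define p where "p = e * a * (1 - \<kappa> / 3)"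
  define \<kappa>' where "\<kappa>' = e * a * \<kappa> / 6"
  have \<kappa>': "\<kappa>' > 0" using e a0 \<kappa> by (simp add: \<kappa>'_def)
  have pk: "p - \<kappa>' = e * a * (1 - \<kappa> / 2)" by (simp add: p_def \<kappa>'_def algebra_simps)
  \<comment> \<open>With at most \<open>2 * pi / (e * angle_scale r)\<close> directions,
    \<open>angle_scale r\<close> cancels in \<open>real n * (2 * (angle_scale r * sqrt T))\<close>;
    hence the range of dependence \<open>m\<close> is the same for all \<open>r\<close>.\<close>
  define m where "m = nat \<lceil>4 * pi * sqrt T / e\<rceil>"
  have m: "4 * pi * sqrt T / e \<le> real m" unfolding m_def by (rule real_nat_ceiling_ge)
  have "((\<lambda>r. exp (\<rho> r) * (1 - e * a * (1 - \<kappa> / 4))) \<longlongrightarrow>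
     exp ((2 - 2 / (1 + 0\<^sup>2 * T)\<^sup>2) * (4 / 3 * (T * sqrt T) + 4 * e * T) + 4 * sqrt T * (h + 3 * e * h)) * (1 - e * a * (1 - \<kappa> / 4))) at_top"
    unfolding \<rho>_def by (intro tendsto_intros angle_scale_tendsto) simp
  then have "((\<lambda>r. exp (\<rho> r) * (1 - e * a * (1 - \<kappa> / 4))) \<longlongrightarrow> exp (4 * sqrt T * (h + 3 * e * h)) * (1 - e * a * (1 - \<kappa> / 4))) at_top"
    by simp
  from order_tendstoD(2)[OF this h3]
  have E1: "\<forall>\<^sub>F r in at_top. exp (\<rho> r) * (1 - e * a * (1 - \<kappa> / 4)) < 1 - p" by (simp add: p_def)
  have "((\<lambda>r. (angle_scale r)\<^sup>2 * (2 * e) * sqrt T) \<longlongrightarrow> 0\<^sup>2 * (2 * e) * sqrt T) at_top" by (intro tendsto_intros angle_scale_tendsto)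
  from order_tendstoD(2)[OF this, of "1 / 2"]
  have E2: "\<forall>\<^sub>F r in at_top. (angle_scale r)\<^sup>2 * (2 * e) * sqrt T < 1 / 2" by simp
  have "((\<lambda>r. 16 * (angle_scale r)\<^sup>2 * e\<^sup>2 * T * (1 + (angle_scale r)\<^sup>2 * T)) \<longlongrightarrow> 16 * 0\<^sup>2 * e\<^sup>2 * T * (1 + 0\<^sup>2 * T)) at_top"
    by (intro tendsto_intros angle_scale_tendsto)
  from order_tendstoD(2)[OF this, of "e * h"]
  have E3: "\<forall>\<^sub>F r in at_top. 16 * (angle_scale r)\<^sup>2 * e\<^sup>2 * T * (1 + (angle_scale r)\<^sup>2 * T) < e * h" using e h by simp
  have E4: "\<forall>\<^sub>F r in at_top. tan (2 * pi / real (num_dirs e r)) / angle_scale r < 2 * e"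
    using order_tendstoD(2)[OF num_dirs_tan[OF e], of "2 * e"] e by simp
  have E5: "\<forall>\<^sub>F r in at_top. num_dirs e r > 4"
    using num_dirs_filterlim[OF e, unfolded filterlim_at_top, rule_format, of 5] by eventually_elim simp
  have E6: "\<forall>\<^sub>F r in at_top. real (4 * m + 1) / (real (num_dirs e r) * \<kappa>'\<^sup>2) < \<kappa>"
  proof -
    have "filterlim (\<lambda>r. real (num_dirs e r)) at_top at_top"
      using filterlim_compose[OF filterlim_real_sequentially num_dirs_filterlim[OF e]] .
    then have "filterlim (\<lambda>r. real (num_dirs e r) * \<kappa>'\<^sup>2) at_top at_top"
      using \<kappa>' by (intro filterlim_at_top_mult_tendsto_pos[OF tendsto_const]) auto
    then have "((\<lambda>r. real (4 * m + 1) / (real (num_dirs e r) * \<kappa>'\<^sup>2)) \<longlongrightarrow> 0) at_top"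
      by (intro tendsto_divide_0[OF tendsto_const] filterlim_at_top_imp_at_infinity)
    from order_tendstoD(2)[OF this \<kappa>(1)] show ?thesis .
  qed
  have E7: "\<forall>\<^sub>F r in at_top. angle_scale r * (real (4 * m + 1) + e * a) < pi * a * \<kappa>"
  proof -
    have "((\<lambda>r. angle_scale r * (real (4 * m + 1) + e * a)) \<longlongrightarrow> 0 * (real (4 * m + 1) + e * a)) at_top"
      by (intro tendsto_intros angle_scale_tendsto)
    from order_tendstoD(2)[OF this, of "pi * a * \<kappa>"] show ?thesis using a0 \<kappa> by simp
  qed
  show ?thesis
    using E1 E2 E3 E4 E5 E6 E7 eventually_ge_at_top[of "1::real"]
  proof eventually_elim
    case (elim r)
    have r: "r > 0" using elim by simp
    have s: "angle_scale r > 0" using angle_scale(1)[OF r] .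
    obtain \<Phi> Y where Phi: "poisson_outside (M r) r \<Phi>" and Y: "AE \<omega> in M r. norm (Y \<omega>) = 2 * r"
      and Zeq: "\<And>\<omega>. \<omega> \<in> space (M r) \<Longrightarrow> Z r \<omega> = insert (Y \<omega>) (\<Phi> \<omega>)"
      using poisson_given_inradiusE[OF r Z[OF r]] by blast
    interpret poisson_outside "M r" r \<Phi> by (rule Phi)
    let ?N = "\<lambda>\<omega>. num_sides (voronoi_cell (insert (Y \<omega>) (\<Phi> \<omega>)))"
    have Nm: "?N \<in> measurable (M r) (count_space UNIV)"
      using meas[OF r] by (rule measurable_cong[THEN iffD1, rotated]) (simp add: Zeq)
    define n where "n = num_dirs e r"
    have n4: "n > 4" using elim by (simp add: n_def)
    have nb: "real n \<le> 2 * pi / (e * angle_scale r)" "2 * pi / (e * angle_scale r) - 1 \<le> real n"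
      using num_dirs_bounds[OF e r] by (auto simp: n_def)
    have es: "e * angle_scale r \<le> 2 * pi / real n" using nb(1) n4 e s by (simp add: field_simps)
    have \<sigma>1: "e \<le> tan (2 * pi / real n) / angle_scale r"
    proof -
      have "2 * pi / real n \<le> tan (2 * pi / real n)" using n4 by (intro le_tan) (auto simp: field_simps)
      then have "e * angle_scale r \<le> tan (2 * pi / real n)" using es by linarith
      then show ?thesis using s by (simp add: field_simps)
    qed
    have mm: "real n * (2 * (angle_scale r * sqrt T)) \<le> real m"
    proof -
      have "real n * (2 * (angle_scale r * sqrt T)) \<le> 2 * pi / (e * angle_scale r) * (2 * (angle_scale r * sqrt T))"
        using nb(1) s T by (intro mult_right_mono) auto
      also have "\<dots> = 4 * pi * sqrt T / e" using s by simp
      finally show ?thesis using m by linarith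
    qed
    have pt: "p \<le> prob (turn T e h t)" for t
    proof -
      define E where "E = exp (- (8 / 3 * (T * sqrt T)))"
      have E: "0 \<le> E" "E \<le> 1" using T by (auto simp: E_def)
      have "E + 2 * (\<integral>z. lower_integrand e T z * indicator (below T) z \<partial>lborel) = 1 + 32 * e\<^sup>2 * T\<^sup>2 * (1 - E) - e * partial_limit T"
        unfolding lower_integrand_integral[OF T] E_def by (simp add: algebra_simps)
      also have "32 * e\<^sup>2 * T\<^sup>2 * (1 - E) \<le> 32 * e\<^sup>2 * T\<^sup>2" using E by (intro mult_left_le) auto
      finally have "E + 2 * (\<integral>z. lower_integrand e T z * indicator (below T) z \<partial>lborel) \<le> 1 - e * a * (1 - \<kappa> / 4)" using e3 by simp
      then have "exp (\<rho> r) * (E + 2 * (\<integral>z. lower_integrand e T z * indicator (below T) z \<partial>lborel)) \<le> exp (\<rho> r) * (1 - e * a * (1 - \<kappa> / 4))"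
        by (intro mult_left_mono) auto
      also have "\<dots> < 1 - p" using elim by simp
      finally show ?thesis using turn_prob[OF T e h \<rho>_def e1, of t] by (simp add: E_def)
    qed
    have "prob {\<omega> \<in> space (M r). real (?N \<omega>) + real (4 * m + 1) \<le> real n * (p - \<kappa>')} \<le> real (4 * m + 1) / (real n * \<kappa>'\<^sup>2)"
      by (rule lower_tail[OF elim(8) Y Nm T e h n4 \<sigma>1 _ _ _ pt \<kappa>' mm]) (use elim in \<open>auto simp: n_def intro: less_imp_le\<close>)
    also have "\<dots> \<le> \<kappa>" using elim by (simp add: n_def less_imp_le)
    finally have b: "prob {\<omega> \<in> space (M r). real (?N \<omega>) + real (4 * m + 1) \<le> real n * (p - \<kappa>')} \<le> \<kappa>" .
    have "prob {\<omega> \<in> space (M r). real (num_sides (voronoi_cell (Z r \<omega>))) < (1 - \<kappa>) * (side_const * r powr (2 / 3))}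
      \<le> prob {\<omega> \<in> space (M r). real (?N \<omega>) + real (4 * m + 1) \<le> real n * (p - \<kappa>')}"
    proof (rule finite_measure_mono)
      have key: "(1 - \<kappa>) * (side_const * r powr (2 / 3)) + real (4 * m + 1) \<le> real n * (p - \<kappa>')"
      proof -
        define X W where "X = 2 * pi * a / angle_scale r" and "W = pi * a * \<kappa> / angle_scale r"
        have 1: "(2 * pi / (e * angle_scale r) - 1) * (e * a * (1 - \<kappa> / 2)) \<le> real n * (p - \<kappa>')"
          unfolding pk using nb(2) e a0 \<kappa> by (intro mult_right_mono) auto
        have 2: "(2 * pi / (e * angle_scale r) - 1) * (e * a * (1 - \<kappa> / 2)) = X * (1 - \<kappa> / 2) - e * a * (1 - \<kappa> / 2)"
          using e s by (simp add: X_def field_simps)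
        have 3: "e * a * (1 - \<kappa> / 2) \<le> e * a" using e a0 \<kappa> by (intro mult_left_le) auto
        have 4: "real (4 * m + 1) + e * a \<le> W"
          using elim(7) s by (simp add: W_def pos_le_divide_eq mult.commute less_imp_le)
        have 5: "X * (1 - \<kappa> / 2) = (1 - \<kappa>) * X + W"
          using s by (simp add: X_def W_def field_simps)
        have 6: "side_const * r powr (2 / 3) = X" using angle_scale_powr[OF r] by (simp add: a_def X_def)
        show ?thesis unfolding 6 using 1 2 3 4 5 by argo
      qed
      show "{\<omega> \<in> space (M r). real (num_sides (voronoi_cell (Z r \<omega>))) < (1 - \<kappa>) * (side_const * r powr (2 / 3))}
        \<subseteq> {\<omega> \<in> space (M r). real (?N \<omega>) + real (4 * m + 1) \<le> real n * (p - \<kappa>')}"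
        using key Zeq by auto
      have [measurable]: "(\<lambda>\<omega>. real (?N \<omega>)) \<in> borel_measurable (M r)"
        using measurable_compose[OF Nm, of real borel] by simp
      show "{\<omega> \<in> space (M r). real (?N \<omega>) + real (4 * m + 1) \<le> real n * (p - \<kappa>')} \<in> events" by measurable
    qed
    then show ?case using b by linarith
  qed
qed

lemma upper_expectation_num_sides:
  assumes r1: "r \<ge> 1" and Z: "poisson_given_inradius M r Z"
    and meas: "(\<lambda>\<omega>. num_sides (voronoi_cell (Z \<omega>))) \<in> measurable M (count_space UNIV)"
  shows "(\<integral>\<^sup>+\<omega>. ennreal (real (num_sides (voronoi_cell (Z \<omega>)))) \<partial>M) \<le> ennreal (2 + 2 * pi / angle_scale r * (\<integral>q. upper_kernel r q \<partial>lborel))"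
proof -
  have r: "r > 0" using r1 by simp
  obtain \<Phi> Y where Phi: "poisson_outside M r \<Phi>" and Y: "AE \<omega> in M. norm (Y \<omega>) = 2 * r"
    and Zeq: "\<And>\<omega>. \<omega> \<in> space M \<Longrightarrow> Z \<omega> = insert (Y \<omega>) (\<Phi> \<omega>)"
    using poisson_given_inradiusE[OF r Z] by blast
  interpret poisson_outside M r \<Phi> by (rule Phi)
  have Nm: "(\<lambda>\<omega>. num_sides (voronoi_cell (insert (Y \<omega>) (\<Phi> \<omega>)))) \<in> measurable M (count_space UNIV)"
    using meas by (rule measurable_cong[THEN iffD1, rotated]) (simp add: Zeq)
  have "(\<integral>\<^sup>+\<omega>. ennreal (real (num_sides (voronoi_cell (Z \<omega>)))) \<partial>M)
    = (\<integral>\<^sup>+\<omega>. ennreal (real (num_sides (voronoi_cell (insert (Y \<omega>) (\<Phi> \<omega>))))) \<partial>M)"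
    by (intro nn_integral_cong) (simp add: Zeq)
  also have "\<dots> \<le> ennreal (2 + 2 * pi / angle_scale r * (\<integral>q. upper_kernel r q \<partial>lborel))"
    by (rule upper_expectation[OF r1 Y Nm upper_rate_le[OF r1]])
  finally show ?thesis .
qed

theorem theorem1:
  fixes M :: "real \<Rightarrow> 'a measure" and Z :: "real \<Rightarrow> 'a \<Rightarrow> (real ^ 2) set"
    and P :: "real \<Rightarrow> 'b measure" and N :: "real \<Rightarrow> 'b \<Rightarrow> nat"
  assumes "\<And>r. r > 0 \<Longrightarrow> poisson_given_inradius (M r) r (Z r)"
    and "\<And>r. r > 0 \<Longrightarrow> prob_space (P r)"
    and "\<And>r. r > 0 \<Longrightarrow> N r \<in> measurable (P r) (count_space UNIV)"
    and "\<And>r. r > 0 \<Longrightarrow> distr (P r) (count_space UNIV) (N r)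
                 = distr (M r) (count_space UNIV) (\<lambda>\<omega>. num_sides (voronoi_cell (Z r \<omega>)))"
  shows "(\<forall>\<^sub>F r in at_top. integrable (P r) (\<lambda>\<omega>. real (N r \<omega>)))
    \<and> ((\<lambda>r. (\<integral>\<omega>. real (N r \<omega>) \<partial>P r) / (side_const * r powr (2 / 3))) \<longlongrightarrow> 1) at_top
    \<and> ((\<lambda>r. \<integral>\<omega>. \<bar>real (N r \<omega>) / (side_const * r powr (2 / 3)) - 1\<bar> \<partial>P r) \<longlongrightarrow> 0) at_top"
proof -
  define f where "f r \<omega> = num_sides (voronoi_cell (Z r \<omega>))" for r \<omega>
  define A where "A r = side_const * r powr (2 / 3)" for r
  define U where "U r = 2 + 2 * pi / angle_scale r * (\<integral>q. upper_kernel r q \<partial>lborel)" for r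
  \<comment> \<open>Measurability of the number of sides is deduced from the equality of the
    laws.\<close>
  have fm: "f r \<in> measurable (M r) (count_space UNIV)" if "r > 0" for r
    using measurable_if_distr_prob[OF assms(2)[OF that] assms(3)[OF that] assms(4)[OF that]] unfolding f_def[abs_def] .
  have deq: "distr (P r) (count_space UNIV) (N r) = distr (M r) (count_space UNIV) (f r)" if "r > 0" for r
    using assms(4)[OF that] unfolding f_def[abs_def] .
  have A0: "A r > 0" if "r > 0" for r using that side_const_pos by (simp add: A_def)
  have U0: "U r \<ge> 0" if "r \<ge> 1" for r
    using upper_kernel_le_dom(1)[OF that] angle_scale(1)[of r] that by (simp add: U_def integral_nonneg)
  have up: "(\<integral>\<^sup>+\<omega>. ennreal (real (N r \<omega>)) \<partial>P r) \<le> ennreal (U r)" if r1: "r \<ge> 1" for r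
  proof -
    have r: "r > 0" using r1 by simp
    have "(\<integral>\<^sup>+\<omega>. ennreal (real (N r \<omega>)) \<partial>P r) = (\<integral>\<^sup>+k. ennreal (real k) \<partial>distr (P r) (count_space UNIV) (N r))"
      using assms(3)[OF r] by (subst nn_integral_distr) auto
    also have "\<dots> = (\<integral>\<^sup>+\<omega>. ennreal (real (f r \<omega>)) \<partial>M r)"
      unfolding deq[OF r] using fm[OF r] by (subst nn_integral_distr) auto
    also have "\<dots> \<le> ennreal (U r)"
      using upper_expectation_num_sides[OF r1 assms(1)[OF r]] fm[OF r] unfolding f_def[abs_def] U_def by blast
    finally show ?thesis .
  qed
  have Nm: "(\<lambda>\<omega>. real (N r \<omega>)) \<in> borel_measurable (P r)" if "r > 0" for r
    using measurable_compose[OF assms(3)[OF that], of real borel] by simp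
  have int: "integrable (P r) (\<lambda>\<omega>. real (N r \<omega>))" if "r \<ge> 1" for r
    using Nm[of r] up[OF that] that by (intro integrableI_bounded) (auto intro: le_less_trans)
  have EN: "(\<integral>\<omega>. real (N r \<omega>) \<partial>P r) \<le> U r" if "r \<ge> 1" for r
  proof -
    have "ennreal (\<integral>\<omega>. real (N r \<omega>) \<partial>P r) \<le> ennreal (U r)"
      using up[OF that] nn_integral_eq_integral[OF int[OF that]] by simp
    then show ?thesis using U0[OF that] by simp
  qed
  have UA: "((\<lambda>r. U r / A r) \<longlongrightarrow> 1) at_top"
  proof -
    have "((\<lambda>r. 2 * angle_scale r / side_const + 2 * pi / side_const * (\<integral>q. upper_kernel r q \<partial>lborel)) \<longlongrightarrow>
       2 * 0 / side_const + 2 * pi / side_const * (side_const / (2 * pi))) at_top"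
      by (intro tendsto_intros angle_scale_tendsto upper_kernel_tendsto) (use side_const_pos in auto)
    then have "((\<lambda>r. 2 * angle_scale r / side_const + 2 * pi / side_const * (\<integral>q. upper_kernel r q \<partial>lborel)) \<longlongrightarrow> 1) at_top"
      using side_const_pos by simp
    moreover have "\<forall>\<^sub>F r in at_top. 2 * angle_scale r / side_const + 2 * pi / side_const * (\<integral>q. upper_kernel r q \<partial>lborel) = U r / A r"
      using eventually_gt_at_top[of 0]
    proof eventually_elim
      case (elim r)
      have "A r = side_const / angle_scale r" using angle_scale_powr[OF elim] by (simp add: A_def)
      then show ?case using angle_scale(1)[OF elim] side_const_pos by (simp add: U_def field_simps)
    qed
    ultimately show ?thesis by (rule Lim_transform_eventually)
  qed
  define D where "D r = (\<integral>\<omega>. \<bar>real (N r \<omega>) / A r - 1\<bar> \<partial>P r)" for r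
  have D0: "(D \<longlongrightarrow> 0) at_top"
  proof (rule tendstoI)
    fix x :: real assume x: "x > 0"
    \<comment> \<open>The final bound for \<open>D r\<close> is
      \<open>\<kappa> + 2 * (\<kappa> + \<kappa>)\<close>: one \<open>\<kappa>\<close> from the
      mean, and two each from the values above and below the threshold.\<close>
    define \<kappa> where "\<kappa> = min (1 / 2) (x / 10)"
    have \<kappa>: "0 < \<kappa>" "\<kappa> < 1" "5 * \<kappa> < x" using x by (auto simp: \<kappa>_def)
    have e1: "\<forall>\<^sub>F r in at_top. measure (M r) {\<omega> \<in> space (M r). real (f r \<omega>) < (1 - \<kappa>) * A r} \<le> \<kappa>"
      using lower_tail_eventually[OF assms(1) fm[unfolded f_def[abs_def]] \<kappa>(1,2)] unfolding f_def A_def by blast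
    have e2: "\<forall>\<^sub>F r in at_top. U r / A r < 1 + \<kappa>" using order_tendstoD(2)[OF UA] \<kappa> by simp
    show "\<forall>\<^sub>F r in at_top. dist (D r) 0 < x"
      using e1 e2 eventually_ge_at_top[of "1::real"]
    proof eventually_elim
      case (elim r)
      have r: "r > 0" using elim by simp
      interpret P: prob_space "P r" by (rule assms(2)[OF r])
      note [measurable] = Nm[OF r]
      define B where "B = {\<omega> \<in> space (P r). real (N r \<omega>) < (1 - \<kappa>) * A r}"
      have B[measurable]: "B \<in> sets (P r)" unfolding B_def by measurable
      have pB: "measure (P r) B \<le> \<kappa>"
      proof -
        let ?S = "{k. real k < (1 - \<kappa>) * A r}"
        have "measure (P r) B = measure (distr (P r) (count_space UNIV) (N r)) ?S"
          using assms(3)[OF r] by (subst measure_distr) (auto simp: B_def intro!: arg_cong[where f = "measure _"])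
        also have "\<dots> = measure (M r) {\<omega> \<in> space (M r). real (f r \<omega>) < (1 - \<kappa>) * A r}"
          unfolding deq[OF r] using fm[OF r] by (subst measure_distr) (auto intro!: arg_cong[where f = "measure _"])
        finally show ?thesis using elim(1) by simp
      qed
      have iN: "integrable (P r) (\<lambda>\<omega>. real (N r \<omega>) / A r)" using int[OF elim(3)] by simp
      \<comment> \<open>The modulus of \<open>y - 1\<close> is
        \<open>(y - 1) + 2 * max 0 (1 - y)\<close>, and the positive part is at most
        \<open>\<kappa>\<close> off \<open>B\<close> and at most \<open>1\<close> on
        \<open>B\<close>. Thus a bound on the mean from above and a small lower tail control the
        modulus.\<close>
      have "D r \<le> (\<integral>\<omega>. (real (N r \<omega>) / A r - 1) + 2 * (\<kappa> + indicator B \<omega>) \<partial>P r)"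
        unfolding D_def
      proof (rule integral_mono)
        show "integrable (P r) (\<lambda>\<omega>. \<bar>real (N r \<omega>) / A r - 1\<bar>)"
          using iN by (intro integrable_abs Bochner_Integration.integrable_diff) auto
        show "integrable (P r) (\<lambda>\<omega>. (real (N r \<omega>) / A r - 1) + 2 * (\<kappa> + indicator B \<omega>))"
          using iN B by (intro Bochner_Integration.integrable_add Bochner_Integration.integrable_diff integrable_mult_right) (auto simp: P.emeasure_eq_measure)
        fix \<omega> assume w: "\<omega> \<in> space (P r)"
        define y where "y = real (N r \<omega>) / A r"
        have y0: "y \<ge> 0" using A0[OF r] by (simp add: y_def)
        show "\<bar>real (N r \<omega>) / A r - 1\<bar> \<le> (real (N r \<omega>) / A r - 1) + 2 * (\<kappa> + indicator B \<omega>)"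
        proof (cases "\<omega> \<in> B")
          case True
          then show ?thesis unfolding y_def[symmetric] using y0 \<kappa> by simp
        next
          case False
          then have "(1 - \<kappa>) * A r \<le> real (N r \<omega>)" using w by (auto simp: B_def)
          then have "1 - \<kappa> \<le> y" using A0[OF r] by (simp add: y_def pos_le_divide_eq)
          then show ?thesis unfolding y_def[symmetric] using False \<kappa> by simp
        qed
      qed
      also have "\<dots> = (\<integral>\<omega>. real (N r \<omega>) / A r \<partial>P r) - 1 + 2 * (\<kappa> + measure (P r) B)"
        using iN B by (simp add: P.prob_space P.emeasure_eq_measure)
      also have "\<dots> \<le> U r / A r - 1 + 2 * (\<kappa> + \<kappa>)"
        using EN[OF elim(3)] pB A0[OF r] by (simp add: divide_right_mono add_mono)
      also have "\<dots> < \<kappa> + 2 * (\<kappa> + \<kappa>)" using elim(2) by simp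
      also have "\<dots> < x" using \<kappa> by simp
      finally have "D r < x" .
      moreover have "D r \<ge> 0" unfolding D_def by (rule Bochner_Integration.integral_nonneg) simp
      ultimately show ?case by (simp add: dist_real_def)
    qed
  qed
  have "((\<lambda>r. (\<integral>\<omega>. real (N r \<omega>) \<partial>P r) / A r) \<longlongrightarrow> 1) at_top"
  proof (rule Lim_null[THEN iffD2], rule Lim_null_comparison[OF _ D0])
    show "\<forall>\<^sub>F r in at_top. norm ((\<integral>\<omega>. real (N r \<omega>) \<partial>P r) / A r - 1) \<le> D r"
      using eventually_ge_at_top[of "1::real"]
    proof eventually_elim
      case (elim r)
      have r: "r > 0" using elim by simp
      interpret P: prob_space "P r" by (rule assms(2)[OF r])
      have "(\<integral>\<omega>. real (N r \<omega>) \<partial>P r) / A r - 1 = (\<integral>\<omega>. real (N r \<omega>) / A r - 1 \<partial>P r)"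
        using int[OF elim] by (simp add: P.prob_space)
      also have "norm \<dots> \<le> (\<integral>\<omega>. norm (real (N r \<omega>) / A r - 1) \<partial>P r)" by (rule integral_norm_bound)
      finally show ?case by (simp add: D_def)
    qed
  qed
  moreover have "\<forall>\<^sub>F r in at_top. integrable (P r) (\<lambda>\<omega>. real (N r \<omega>))"
    using eventually_ge_at_top[of "1::real"] by eventually_elim (rule int)
  ultimately show ?thesis using D0 unfolding D_def A_def by blast
qed

end
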